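(* Suppose $(G,P,\theta)$ is an irreversible algebraic dynamical system and let $S=G\rtimes_\theta P$. Then $\mathcal{O}[G,P,\theta]$ is canonically isomorphic to $\mathcal{Q}(S)$, the isomorphism sending $u_gs_p$ to $\bar v_{(g,p)}$ for all $g\in G$, $p\in P$.
   Context: All semigroups are countable, discrete and left cancellative. A semigroup is right LCM if the intersection of two principal right ideals is either empty or again a principal right ideal. An irreversible algebraic dynamical system $(G,P,\theta)$ consists of a countably infinite discrete group $G$, a countably generated free abelian monoid $P$ with identity, and an action $\theta$ of $P$ on $G$ by injective group endomorphisms such that, for $p,q\in P$, $\theta_p$ and $\theta_q$ are independent, meaning $\theta_p(G)\cap\theta_q(G)=\theta_{pq}(G)$, if and only if $p$ and $q$ are relatively prime in $P$. The $C^*$-algebra $\mathcal{O}[G,P,\theta]$ is the universal $C^*$-algebra generated by a unitary representation $(u_g)_{g\in G}$ of $G$ and a representation $(s_p)_{p\in P}$ of $P$ by isometries subject to the relations: (CNP 1) $s_pu_g=u_{\theta_p(g)}s_p$ for all $p\in P$, $g\in G$; (CNP 2) for $p,q\in P$ and $g\in G$, with $p\wedge q$ the greatest common divisor of $p$ and $q$: $s_p^*u_gs_q=u_{k}\,s_{(p\wedge q)^{-1}q}\,s_{(p\wedge q)^{-1}p}^*\,u_{\ell}$ if $g=\theta_p(k)\theta_q(\ell)$ for some $k,\ell\in G$, and $s_p^*u_gs_q=0$ otherwise; (CNP 3) $1=\sum_{[g]\in G/\theta_p(G)}u_gs_ps_p^*u_g^*$ for every $p\in P$ with $[G:\theta_p(G)]<\infty$.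 $G\rtimes_\theta P$ is the set $G\times P$ with product $(g,p)(h,q)=(g\theta_p(h),pq)$; it is a right LCM semigroup with identity. For a right LCM semigroup $S$ with identity, $\mathcal{J}(S)=\{sS\mid s\in S\}\cup\{\emptyset\}$, and $C^*(S)$ is the universal $C^*$-algebra generated by isometries $(v_s)_{s\in S}$ and projections $(e_X)_{X\in\mathcal{J}(S)}$ satisfying $v_sv_t=v_{st}$, $v_se_Xv_s^*=e_{sX}$, $e_S=1$, $e_\emptyset=0$, $e_Xe_Y=e_{X\cap Y}$ for all $s,t\in S$, $X,Y\in\mathcal{J}(S)$. A finite subset $F\subset S$ is a foundation set for $S$ if for every $s\in S$ there is $t\in F$ with $sS\cap tS\neq\emptyset$. The boundary quotient $\mathcal{Q}(S)$ is the quotient of $C^*(S)$ by the relations $\prod_{s\in F}(1-e_{sS})=0$ for every foundation set $F$ for $S$; the image of $v_s$ is $\bar v_s$. *)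

theory Defs
  imports
    Complex_Main
    "HOL-Library.Poly_Mapping"
    "HOL-Library.Countable_Set"
    "HOL-Algebra.Divisibility"
    "HOL-Algebra.QuotRing"
    "HOL-Algebra.Left_Coset"
begin

section \<open>Unital C*-algebras\<close>

record 'a cstar = "'a ring" +
  cscale :: "complex \<Rightarrow> 'a \<Rightarrow> 'a"
  cadj   :: "'a \<Rightarrow> 'a"
  cnorm  :: "'a \<Rightarrow> real"

locale cstar_algebra = ring A for A :: "('a, 'b) cstar_scheme" (structure) +
  assumes scale_closed: "x \<in> carrier A \<Longrightarrow> cscale A c x \<in> carrier A"
    and scale_add_right: "\<lbrakk>x \<in> carrier A; y \<in> carrier A\<rbrakk> \<Longrightarrow>
          cscale A c (x \<oplus> y) = cscale A c x \<oplus> cscale A c y"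
    and scale_add_left: "x \<in> carrier A \<Longrightarrow> cscale A (c + d) x = cscale A c x \<oplus> cscale A d x"
    and scale_scale: "x \<in> carrier A \<Longrightarrow> cscale A c (cscale A d x) = cscale A (c * d) x"
    and scale_one: "x \<in> carrier A \<Longrightarrow> cscale A 1 x = x"
    and scale_mult_left: "\<lbrakk>x \<in> carrier A; y \<in> carrier A\<rbrakk> \<Longrightarrow>
          cscale A c x \<otimes> y = cscale A c (x \<otimes> y)"
    and scale_mult_right: "\<lbrakk>x \<in> carrier A; y \<in> carrier A\<rbrakk> \<Longrightarrow>
          x \<otimes> cscale A c y = cscale A c (x \<otimes> y)"
    and adj_closed: "x \<in> carrier A \<Longrightarrow> cadj A x \<in> carrier A"
    and adj_adj: "x \<in> carrier A \<Longrightarrow> cadj A (cadj A x) = x"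
    and adj_add: "\<lbrakk>x \<in> carrier A; y \<in> carrier A\<rbrakk> \<Longrightarrow>
          cadj A (x \<oplus> y) = cadj A x \<oplus> cadj A y"
    and adj_scale: "x \<in> carrier A \<Longrightarrow> cadj A (cscale A c x) = cscale A (cnj c) (cadj A x)"
    and adj_mult: "\<lbrakk>x \<in> carrier A; y \<in> carrier A\<rbrakk> \<Longrightarrow>
          cadj A (x \<otimes> y) = cadj A y \<otimes> cadj A x"
    and norm_eq_zero: "x \<in> carrier A \<Longrightarrow> cnorm A x = 0 \<longleftrightarrow> x = \<zero>"
    and norm_triangle: "\<lbrakk>x \<in> carrier A; y \<in> carrier A\<rbrakk> \<Longrightarrow>
          cnorm A (x \<oplus> y) \<le> cnorm A x + cnorm A y"
    and norm_scale: "x \<in> carrier A \<Longrightarrow> cnorm A (cscale A c x) = cmod c * cnorm A x"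
    and norm_mult: "\<lbrakk>x \<in> carrier A; y \<in> carrier A\<rbrakk> \<Longrightarrow>
          cnorm A (x \<otimes> y) \<le> cnorm A x * cnorm A y"
    and norm_cstar: "x \<in> carrier A \<Longrightarrow> cnorm A (cadj A x \<otimes> x) = (cnorm A x)\<^sup>2"
    and norm_complete: "\<lbrakk>\<And>n. X n \<in> carrier A;
          \<And>\<epsilon>. \<epsilon> > 0 \<Longrightarrow> \<exists>M. \<forall>m\<ge>M. \<forall>n\<ge>M. cnorm A (X m \<ominus> X n) < \<epsilon>\<rbrakk> \<Longrightarrow>
          \<exists>L\<in>carrier A. (\<lambda>n. cnorm A (X n \<ominus> L)) \<longlonglongrightarrow> 0"

definition star_hom :: "('a, 'm) cstar_scheme \<Rightarrow> ('b, 'n) cstar_scheme \<Rightarrow> ('a \<Rightarrow> 'b) \<Rightarrow> bool" where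
  "star_hom A B \<phi> \<longleftrightarrow> \<phi> \<in> ring_hom A B \<and>
     (\<forall>x\<in>carrier A. \<forall>c. \<phi> (cscale A c x) = cscale B c (\<phi> x)) \<and>
     (\<forall>x\<in>carrier A. \<phi> (cadj A x) = cadj B (\<phi> x))"

definition star_iso :: "('a, 'm) cstar_scheme \<Rightarrow> ('b, 'n) cstar_scheme \<Rightarrow> ('a \<Rightarrow> 'b) \<Rightarrow> bool" where
  "star_iso A B \<phi> \<longleftrightarrow> star_hom A B \<phi> \<and> bij_betw \<phi> (carrier A) (carrier B)"

definition norm_closed :: "('a, 'm) cstar_scheme \<Rightarrow> 'a set \<Rightarrow> bool" where
  "norm_closed A I \<longleftrightarrow> (\<forall>X. \<forall>x\<in>carrier A.
     (\<forall>n::nat. X n \<in> I) \<and> (\<lambda>n. cnorm A (X n \<ominus>\<^bsub>A\<^esub> x)) \<longlonglongrightarrow> 0 \<longrightarrow> x \<in> I)"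

definition closed_ideal_gen :: "('a, 'm) cstar_scheme \<Rightarrow> 'a set \<Rightarrow> 'a set" where
  "closed_ideal_gen A R = \<Inter>{I. ideal I A \<and> norm_closed A I \<and> R \<subseteq> I}"

definition cstar_quot :: "('a, 'm) cstar_scheme \<Rightarrow> 'a set \<Rightarrow> 'a set cstar" where
  "cstar_quot A I =
     \<lparr>carrier = carrier (A Quot I), mult = mult (A Quot I), one = one (A Quot I),
      zero = zero (A Quot I), add = add (A Quot I),
      cscale = (\<lambda>c X. \<Union>x\<in>X. I +>\<^bsub>A\<^esub> cscale A c x),
      cadj = (\<lambda>X. \<Union>x\<in>X. I +>\<^bsub>A\<^esub> cadj A x),
      cnorm = (\<lambda>X. Inf (cnorm A ` X))\<rparr>"


section \<open>Universal C*-algebras given by generators and relations\<close>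

subsection \<open>The free unital *-algebra\<close>

text \<open>The complex monoid algebra of the free monoid on the letters \<open>x\<close> and \<open>x\<^sup>*\<close>; the monoid is
  written additively because \<^typ>\<open>'a \<Rightarrow>\<^sub>0 'b\<close> carries the convolution product over an additive
  (not necessarily commutative) monoid.\<close>

datatype 'x star_letter = Plain 'x | Starred 'x

datatype 'x star_word = Word (letters: "'x star_letter list")

instantiation star_word :: (type) monoid_add
begin
definition zero_star_word :: "'a star_word" where "0 = Word []"
definition plus_star_word :: "'a star_word \<Rightarrow> 'a star_word \<Rightarrow> 'a star_word" where
  "v + w = Word (letters v @ letters w)"
instance
  by standard (simp_all add: zero_star_word_def plus_star_word_def)
end

type_synonym 'x free_star = "'x star_word \<Rightarrow>\<^sub>0 complex"

fun letter_adj :: "'x star_letter \<Rightarrow> 'x star_letter" where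
  "letter_adj (Plain x) = Starred x"
| "letter_adj (Starred x) = Plain x"

definition word_adj :: "'x star_word \<Rightarrow> 'x star_word" where
  "word_adj w = Word (rev (map letter_adj (letters w)))"

definition gen :: "'x \<Rightarrow> 'x free_star" where
  "gen x = Poly_Mapping.single (Word [Plain x]) 1"

definition scl :: "complex \<Rightarrow> 'x free_star \<Rightarrow> 'x free_star" where
  "scl c a = Poly_Mapping.single 0 c * a"

text \<open>The involution: \<open>lookup (adj a) w = cnj (lookup a (word_adj w))\<close>.\<close>

definition adj :: "'x free_star \<Rightarrow> 'x free_star" where
  "adj a = Poly_Mapping.map cnj (Poly_Mapping.map_key word_adj a)"


subsection \<open>The universal C*-seminorm and its completion\<close>

definition cstar_seminorm :: "('x free_star \<Rightarrow> real) \<Rightarrow> bool" where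
  "cstar_seminorm q \<longleftrightarrow>
     (\<forall>a. 0 \<le> q a) \<and>
     (\<forall>a b. q (a + b) \<le> q a + q b) \<and>
     (\<forall>c a. q (scl c a) = cmod c * q a) \<and>
     (\<forall>a b. q (a * b) \<le> q a * q b) \<and>
     (\<forall>a. q (adj a * a) = (q a)\<^sup>2)"

text \<open>The C*-seminorms vanishing on \<open>R\<close> are exactly the functions \<open>a \<mapsto> \<parallel>\<rho> a\<parallel>\<close> for a unital
  *-homomorphism \<open>\<rho>\<close> from the free *-algebra into some unital C*-algebra (possibly zero) such that
  \<open>\<rho>\<close> kills \<open>R\<close>. Quantifying over them instead of over \<open>\<rho>\<close> avoids a quantification over the
  types of all C*-algebras.  The supremum is meaningful as soon as \<open>R\<close> bounds every generator,
  which is the case whenever a universal C*-algebra exists.\<close>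

definition seminorms :: "'x free_star set \<Rightarrow> ('x free_star \<Rightarrow> real) set" where
  "seminorms R = {q. cstar_seminorm q \<and> (\<forall>r\<in>R. q r = 0)}"

definition univ_seminorm :: "'x free_star set \<Rightarrow> 'x free_star \<Rightarrow> real" where
  "univ_seminorm R a = (SUP q\<in>seminorms R. q a)"

definition cauchy_in :: "('x free_star \<Rightarrow> real) \<Rightarrow> (nat \<Rightarrow> 'x free_star) \<Rightarrow> bool" where
  "cauchy_in q x \<longleftrightarrow> (\<forall>\<epsilon>>0. \<exists>M. \<forall>m\<ge>M. \<forall>n\<ge>M. q (x m - x n) < \<epsilon>)"

definition cauchy_class ::
    "('x free_star \<Rightarrow> real) \<Rightarrow> (nat \<Rightarrow> 'x free_star) \<Rightarrow> (nat \<Rightarrow> 'x free_star) set" where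
  "cauchy_class q x = {y. cauchy_in q y \<and> (\<lambda>n. q (x n - y n)) \<longlonglongrightarrow> 0}"

definition repr :: "'y set \<Rightarrow> 'y" where
  "repr X = (SOME x. x \<in> X)"

text \<open>Hausdorff completion of the free *-algebra with respect to a C*-seminorm.\<close>

definition cstar_completion ::
    "('x free_star \<Rightarrow> real) \<Rightarrow> (nat \<Rightarrow> 'x free_star) set cstar" where
  "cstar_completion q =
     \<lparr>carrier = {cauchy_class q x | x. cauchy_in q x},
      mult = (\<lambda>X Y. cauchy_class q (\<lambda>n. repr X n * repr Y n)),
      one = cauchy_class q (\<lambda>n. 1),
      zero = cauchy_class q (\<lambda>n. 0),
      add = (\<lambda>X Y. cauchy_class q (\<lambda>n. repr X n + repr Y n)),
      cscale = (\<lambda>c X. cauchy_class q (\<lambda>n. scl c (repr X n))),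
      cadj = (\<lambda>X. cauchy_class q (\<lambda>n. adj (repr X n))),
      cnorm = (\<lambda>X. lim (\<lambda>n. q (repr X n)))\<rparr>"

text \<open>The universal unital C*-algebra on the generators \<open>x \<in> X\<close> subject to the relations \<open>r = 0\<close> for
  \<open>r \<in> R\<close>. Generators in the type \<open>'x\<close> but not in \<open>X\<close> are discarded by setting them to zero.\<close>

definition all_relations :: "'x set \<Rightarrow> 'x free_star set \<Rightarrow> 'x free_star set" where
  "all_relations X R = R \<union> gen ` (- X)"

definition univ_cstar ::
    "'x set \<Rightarrow> 'x free_star set \<Rightarrow> (nat \<Rightarrow> 'x free_star) set cstar" where
  "univ_cstar X R = cstar_completion (univ_seminorm (all_relations X R))"

definition univ_gen ::
    "'x set \<Rightarrow> 'x free_star set \<Rightarrow> 'x \<Rightarrow> (nat \<Rightarrow> 'x free_star) set" where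
  "univ_gen X R x = cauchy_class (univ_seminorm (all_relations X R)) (\<lambda>n. gen x)"


section \<open>Irreversible algebraic dynamical systems\<close>

text \<open>\<open>P\<close> is free abelian on a countable basis \<open>B\<close>: every element is a product \<open>\<Prod>b\<in>B. b\<^sup>e\<^sup>(\<^sup>b\<^sup>)\<close>
  for a unique finitely supported exponent function \<open>e\<close>. The trivial monoid (\<open>B = {}\<close>) is allowed.\<close>

definition free_abelian_monoid_on :: "('p, 'm) monoid_scheme \<Rightarrow> 'p set \<Rightarrow> bool" where
  "free_abelian_monoid_on P B \<longleftrightarrow> comm_monoid P \<and> B \<subseteq> carrier P \<and>
     (\<forall>p\<in>carrier P. \<exists>!e :: 'p \<Rightarrow> nat. finite {b. e b \<noteq> 0} \<and> {b. e b \<noteq> 0} \<subseteq> B \<and>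
        p = (\<Otimes>\<^bsub>P\<^esub>b\<in>{b. e b \<noteq> 0}. b [^]\<^bsub>P\<^esub> e b))"

locale irreversible_system = G?: group G + P?: comm_monoid P
  for G :: "'g monoid" and P :: "'p monoid" and \<theta> :: "'p \<Rightarrow> 'g \<Rightarrow> 'g" +
  assumes G_countable: "countable (carrier G)"
    and G_infinite: "infinite (carrier G)"
    and P_free: "\<exists>B. countable B \<and> free_abelian_monoid_on P B"
    and \<theta>_hom: "p \<in> carrier P \<Longrightarrow> \<theta> p \<in> hom G G"
    and \<theta>_inj: "p \<in> carrier P \<Longrightarrow> inj_on (\<theta> p) (carrier G)"
    and \<theta>_one: "g \<in> carrier G \<Longrightarrow> \<theta> \<one>\<^bsub>P\<^esub> g = g"
    and \<theta>_mult: "\<lbrakk>p \<in> carrier P; q \<in> carrier P; g \<in> carrier G\<rbrakk> \<Longrightarrow>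
          \<theta> (p \<otimes>\<^bsub>P\<^esub> q) g = \<theta> p (\<theta> q g)"
    and independent_iff: "\<lbrakk>p \<in> carrier P; q \<in> carrier P\<rbrakk> \<Longrightarrow>
          \<theta> p ` carrier G \<inter> \<theta> q ` carrier G = \<theta> (p \<otimes>\<^bsub>P\<^esub> q) ` carrier G
            \<longleftrightarrow> \<one>\<^bsub>P\<^esub> gcdof\<^bsub>P\<^esub> p q"

definition semidirect :: "'g monoid \<Rightarrow> 'p monoid \<Rightarrow> ('p \<Rightarrow> 'g \<Rightarrow> 'g) \<Rightarrow> ('g \<times> 'p) monoid" where
  "semidirect G P \<theta> =
     \<lparr>carrier = carrier G \<times> carrier P,
      mult = (\<lambda>(g, p) (h, q). (g \<otimes>\<^bsub>G\<^esub> \<theta> p h, p \<otimes>\<^bsub>P\<^esub> q)),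
      one = (\<one>\<^bsub>G\<^esub>, \<one>\<^bsub>P\<^esub>)\<rparr>"


section \<open>The C*-algebra of an irreversible algebraic dynamical system\<close>

datatype ('g, 'p) cnp_letter = LetterU 'g | LetterS 'p

definition cnp_letters :: "'g monoid \<Rightarrow> 'p monoid \<Rightarrow> ('g, 'p) cnp_letter set" where
  "cnp_letters G P = LetterU ` carrier G \<union> LetterS ` carrier P"

abbreviation \<u> :: "'g \<Rightarrow> ('g, 'p) cnp_letter free_star" where "\<u> g \<equiv> gen (LetterU g)"
abbreviation \<s> :: "'p \<Rightarrow> ('g, 'p) cnp_letter free_star" where "\<s> p \<equiv> gen (LetterS p)"

definition rep_relations :: "'g monoid \<Rightarrow> 'p monoid \<Rightarrow> ('g, 'p) cnp_letter free_star set" where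
  "rep_relations G P =
     {adj (\<u> g) * \<u> g - 1 | g. g \<in> carrier G} \<union>
     {\<u> g * adj (\<u> g) - 1 | g. g \<in> carrier G} \<union>
     {\<u> g * \<u> h - \<u> (g \<otimes>\<^bsub>G\<^esub> h) | g h. g \<in> carrier G \<and> h \<in> carrier G} \<union>
     {adj (\<s> p) * \<s> p - 1 | p. p \<in> carrier P} \<union>
     {\<s> p * \<s> q - \<s> (p \<otimes>\<^bsub>P\<^esub> q) | p q. p \<in> carrier P \<and> q \<in> carrier P} \<union>
     {\<s> \<one>\<^bsub>P\<^esub> - 1}"

definition CNP1 ::
    "'g monoid \<Rightarrow> 'p monoid \<Rightarrow> ('p \<Rightarrow> 'g \<Rightarrow> 'g) \<Rightarrow> ('g, 'p) cnp_letter free_star set" where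
  "CNP1 G P \<theta> = {\<s> p * \<u> g - \<u> (\<theta> p g) * \<s> p | p g. p \<in> carrier P \<and> g \<in> carrier G}"

text \<open>Here \<open>p = d p'\<close> and \<open>q = d q'\<close> with \<open>d\<close> the greatest common divisor of \<open>p\<close> and \<open>q\<close>.\<close>

definition CNP2 ::
    "'g monoid \<Rightarrow> 'p monoid \<Rightarrow> ('p \<Rightarrow> 'g \<Rightarrow> 'g) \<Rightarrow> ('g, 'p) cnp_letter free_star set" where
  "CNP2 G P \<theta> =
     {adj (\<s> p) * \<u> g * \<s> q - \<u> k * \<s> q' * adj (\<s> p') * \<u> l | p q g k l d p' q'.
        p \<in> carrier P \<and> q \<in> carrier P \<and> g \<in> carrier G \<and>
        k \<in> carrier G \<and> l \<in> carrier G \<and> g = \<theta> p k \<otimes>\<^bsub>G\<^esub> \<theta> q l \<and>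
        d \<in> carrier P \<and> d gcdof\<^bsub>P\<^esub> p q \<and> p' \<in> carrier P \<and> q' \<in> carrier P \<and>
        p = d \<otimes>\<^bsub>P\<^esub> p' \<and> q = d \<otimes>\<^bsub>P\<^esub> q'} \<union>
     {adj (\<s> p) * \<u> g * \<s> q | p q g.
        p \<in> carrier P \<and> q \<in> carrier P \<and> g \<in> carrier G \<and>
        \<not> (\<exists>k\<in>carrier G. \<exists>l\<in>carrier G. g = \<theta> p k \<otimes>\<^bsub>G\<^esub> \<theta> q l)}"

text \<open>The sum over \<open>G / \<theta>\<^sub>p(G)\<close> is imposed for every transversal \<open>T\<close> of the left cosets; by
  \<open>CNP1\<close> its terms do not depend on the choice of representatives.\<close>

definition CNP3 ::
    "'g monoid \<Rightarrow> 'p monoid \<Rightarrow> ('p \<Rightarrow> 'g \<Rightarrow> 'g) \<Rightarrow> ('g, 'p) cnp_letter free_star set" where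
  "CNP3 G P \<theta> =
     {1 - (\<Sum>g\<in>T. \<u> g * \<s> p * adj (\<s> p) * adj (\<u> g)) | p T.
        p \<in> carrier P \<and> finite (lcosets\<^bsub>G\<^esub> (\<theta> p ` carrier G)) \<and> T \<subseteq> carrier G \<and>
        bij_betw (\<lambda>g. g <#\<^bsub>G\<^esub> (\<theta> p ` carrier G)) T (lcosets\<^bsub>G\<^esub> (\<theta> p ` carrier G))}"

definition cnp_relations ::
    "'g monoid \<Rightarrow> 'p monoid \<Rightarrow> ('p \<Rightarrow> 'g \<Rightarrow> 'g) \<Rightarrow> ('g, 'p) cnp_letter free_star set" where
  "cnp_relations G P \<theta> = rep_relations G P \<union> CNP1 G P \<theta> \<union> CNP2 G P \<theta> \<union> CNP3 G P \<theta>"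

definition ads_cstar ::
    "'g monoid \<Rightarrow> 'p monoid \<Rightarrow> ('p \<Rightarrow> 'g \<Rightarrow> 'g) \<Rightarrow>
     (nat \<Rightarrow> ('g, 'p) cnp_letter free_star) set cstar" ("\<O>[_, _, _]") where
  "\<O>[G, P, \<theta>] = univ_cstar (cnp_letters G P) (cnp_relations G P \<theta>)"

definition ads_u where
  "ads_u G P \<theta> g = univ_gen (cnp_letters G P) (cnp_relations G P \<theta>) (LetterU g)"

definition ads_s where
  "ads_s G P \<theta> p = univ_gen (cnp_letters G P) (cnp_relations G P \<theta>) (LetterS p)"


section \<open>The C*-algebra of a right LCM semigroup and its boundary quotient\<close>

definition pideal :: "('s, 'm) monoid_scheme \<Rightarrow> 's \<Rightarrow> 's set" where
  "pideal S s = s <#\<^bsub>S\<^esub> carrier S"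

text \<open>\<open>\<J>(S)\<close>; it is closed under intersection because \<open>S\<close> is right LCM.\<close>

definition cideals :: "('s, 'm) monoid_scheme \<Rightarrow> 's set set" where
  "cideals S = pideal S ` carrier S \<union> {{}}"

datatype 's sg_letter = LetterV 's | LetterE "'s set"

definition sg_letters :: "('s, 'm) monoid_scheme \<Rightarrow> 's sg_letter set" where
  "sg_letters S = LetterV ` carrier S \<union> LetterE ` cideals S"

abbreviation \<v> :: "'s \<Rightarrow> 's sg_letter free_star" where "\<v> s \<equiv> gen (LetterV s)"
abbreviation \<e> :: "'s set \<Rightarrow> 's sg_letter free_star" where "\<e> X \<equiv> gen (LetterE X)"

definition sg_relations :: "('s, 'm) monoid_scheme \<Rightarrow> 's sg_letter free_star set" where
  "sg_relations S =
     {adj (\<v> s) * \<v> s - 1 | s. s \<in> carrier S} \<union>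
     {\<e> X * \<e> X - \<e> X | X. X \<in> cideals S} \<union>
     {adj (\<e> X) - \<e> X | X. X \<in> cideals S} \<union>
     {\<v> s * \<v> t - \<v> (s \<otimes>\<^bsub>S\<^esub> t) | s t. s \<in> carrier S \<and> t \<in> carrier S} \<union>
     {\<v> s * \<e> X * adj (\<v> s) - \<e> (s <#\<^bsub>S\<^esub> X) | s X. s \<in> carrier S \<and> X \<in> cideals S} \<union>
     {\<e> (carrier S) - 1} \<union>
     {\<e> {}} \<union>
     {\<e> X * \<e> Y - \<e> (X \<inter> Y) | X Y. X \<in> cideals S \<and> Y \<in> cideals S}"

definition sg_cstar ::
    "('s, 'm) monoid_scheme \<Rightarrow> (nat \<Rightarrow> 's sg_letter free_star) set cstar" ("C\<^sup>*'(_')") where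
  "C\<^sup>*(S) = univ_cstar (sg_letters S) (sg_relations S)"

definition sg_v where
  "sg_v S s = univ_gen (sg_letters S) (sg_relations S) (LetterV s)"

definition sg_e where
  "sg_e S X = univ_gen (sg_letters S) (sg_relations S) (LetterE X)"

definition foundation_set :: "('s, 'm) monoid_scheme \<Rightarrow> 's set \<Rightarrow> bool" where
  "foundation_set S F \<longleftrightarrow> finite F \<and> F \<subseteq> carrier S \<and>
     (\<forall>s\<in>carrier S. \<exists>t\<in>F. pideal S s \<inter> pideal S t \<noteq> {})"

text \<open>The products \<open>\<Prod>s\<in>F. (1 - e\<^sub>s\<^sub>S)\<close>. The factors commute in \<open>C\<^sup>*(S)\<close>, but the ring is not
  commutative, so that the product is taken along an enumeration of \<open>F\<close>.\<close>

definition boundary_elements ::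
    "('s, 'm) monoid_scheme \<Rightarrow> (nat \<Rightarrow> 's sg_letter free_star) set set" where
  "boundary_elements S =
     {foldr (\<lambda>s x. (\<one>\<^bsub>C\<^sup>*(S)\<^esub> \<ominus>\<^bsub>C\<^sup>*(S)\<^esub> sg_e S (pideal S s)) \<otimes>\<^bsub>C\<^sup>*(S)\<^esub> x) ss \<one>\<^bsub>C\<^sup>*(S)\<^esub> | ss.
        distinct ss \<and> foundation_set S (set ss)}"

definition boundary_ideal ::
    "('s, 'm) monoid_scheme \<Rightarrow> (nat \<Rightarrow> 's sg_letter free_star) set set" where
  "boundary_ideal S = closed_ideal_gen C\<^sup>*(S) (boundary_elements S)"

definition boundary_quotient ::
    "('s, 'm) monoid_scheme \<Rightarrow> (nat \<Rightarrow> 's sg_letter free_star) set set cstar" ("\<Q>'(_')") where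
  "\<Q>(S) = cstar_quot C\<^sup>*(S) (boundary_ideal S)"

definition boundary_v where
  "boundary_v S s = boundary_ideal S +>\<^bsub>C\<^sup>*(S)\<^esub> sg_v S s"

section \<open>Soundness of the construction\<close>

text \<open>Nothing below is used by the definitions above.  It is shown that the completion is a C*-algebra,
  that it has the universal property with respect to C*-algebras on arbitrary types, and that both
  presentations above bound their generators, so that these facts apply to them.\<close>

lemma null_comparison:
  fixes f g :: "nat \<Rightarrow> real"
  assumes "\<And>n. norm (f n) \<le> g n" "g \<longlonglongrightarrow> 0"
  shows "f \<longlonglongrightarrow> 0"
  by (rule metric_tendsto_imp_tendsto[OF assms(2)]) (auto intro!: always_eventually order_trans[OF assms(1)[unfolded real_norm_def]])

lemma free_star_induct [case_names single sum]:
  fixes a :: "'x free_star"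
  assumes 1: "\<And>w c. P (Poly_Mapping.single w c)"
    and 2: "\<And>f k v. P f \<Longrightarrow> P (Poly_Mapping.single k v) \<Longrightarrow> P (f + Poly_Mapping.single k v)"
  shows "P a"
proof (induction a rule: Poly_Mapping.update_induct)
  case const
  then show ?case using 1[of 0 0] by simp
next
  case (update f a b)
  then have "Poly_Mapping.update a b f = f + Poly_Mapping.single a b"
    by (intro poly_mapping_eqI) (auto simp: lookup_update lookup_add lookup_single when_def in_keys_iff)
  then show ?case using update 1 2 by simp
qed

lemma letter_adj_idem [simp]: "letter_adj (letter_adj x) = x"
  by (cases x) auto

lemma word_adj_idem [simp]: "word_adj (word_adj w) = w"
  by (cases w) (simp add: word_adj_def rev_map o_def)

lemma word_adj_add: "word_adj (v + w) = word_adj w + word_adj v"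
  by (simp add: word_adj_def plus_star_word_def)

lemma inj_word_adj: "inj word_adj"
  by (metis injI word_adj_idem)

lemma lookup_adj: "Poly_Mapping.lookup (adj a) w = cnj (Poly_Mapping.lookup a (word_adj w))"
  by (simp add: adj_def Poly_Mapping.map.rep_eq map_key.rep_eq inj_word_adj when_def)

lemma adj_single: "adj (Poly_Mapping.single w c) = Poly_Mapping.single (word_adj w) (cnj c)"
  by (rule poly_mapping_eqI) (auto simp: lookup_adj lookup_single when_def)

lemma adj_add_free: "adj (a + b) = adj a + adj b"
  by (rule poly_mapping_eqI) (simp add: lookup_adj lookup_add)

lemma adj_idem: "adj (adj a) = a"
  by (rule poly_mapping_eqI) (simp add: lookup_adj)

lemma adj_diff: "adj (a - b) = adj a - adj b"
  by (rule poly_mapping_eqI) (simp add: lookup_adj lookup_minus)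

lemma adj_times_single: "adj (a * Poly_Mapping.single w c) = adj (Poly_Mapping.single w c) * adj a"
proof (induction a rule: free_star_induct)
  case (single k v)
  show ?case by (simp add: mult_single adj_single word_adj_add mult.commute)
next
  case (sum f k v)
  then show ?case by (simp add: distrib_left distrib_right adj_add_free)
qed

lemma adj_mult_free: "adj (a * b) = adj b * adj a"
proof (induction b rule: free_star_induct)
  case (single k v)
  show ?case by (rule adj_times_single)
next
  case (sum f k v)
  then show ?case by (simp add: distrib_left distrib_right adj_add_free)
qed

lemma scl_central: "scl c a = a * Poly_Mapping.single 0 c"
proof (induction a rule: free_star_induct)
  case (single k v)
  show ?case by (simp add: scl_def mult_single mult.commute)
next
  case (sum f k v)
  then show ?case by (simp add: distrib_left distrib_right scl_def)
qed

lemma scl_add_right: "scl c (a + b) = scl c a + scl c b"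
  by (simp add: scl_def distrib_left)
lemma scl_diff_right: "scl c (a - b) = scl c a - scl c b"
  by (simp add: scl_def right_diff_distrib)
lemma scl_add_left: "scl (c + d) a = scl c a + scl d a"
  by (simp add: scl_def single_add distrib_right)
lemma scl_scl: "scl c (scl d a) = scl (c * d) a"
  by (simp add: scl_def mult_single mult.assoc[symmetric])
lemma scl_one: "scl 1 a = a"
  by (simp add: scl_def)
lemma scl_mult_left: "scl c a * b = scl c (a * b)"
  by (simp add: scl_def mult.assoc)
lemma scl_mult_right: "a * scl c b = scl c (a * b)"
  by (metis mult.assoc scl_central)
lemma adj_scl: "adj (scl c a) = scl (cnj c) (adj a)"
proof -
  have "word_adj 0 = 0" by (simp add: word_adj_def zero_star_word_def)
  then show ?thesis
    by (metis adj_mult_free adj_single scl_def scl_central)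
qed

locale seminormed =
  fixes q :: "'x free_star \<Rightarrow> real"
  assumes cs: "cstar_seminorm q"
begin

lemma q_ge0 [simp]: "0 \<le> q a" and q_tri: "q (a + b) \<le> q a + q b"
  and q_scl: "q (scl c a) = cmod c * q a" and q_mult: "q (a * b) \<le> q a * q b"
  and q_star: "q (adj a * a) = (q a)\<^sup>2"
  using cs by (auto simp: cstar_seminorm_def)

lemma q_zero [simp]: "q 0 = 0"
  using q_scl[of 0 0] by (simp add: scl_def)

lemma q_minus: "q (- a) = q a"
proof -
  have "scl (-1) a = - a" by (simp add: scl_def single_uminus)
  then show ?thesis using q_scl[of "-1" a] by simp
qed

lemma q_diff_commute: "q (a - b) = q (b - a)"
  using q_minus[of "a - b"] by simp

lemma q_tri_diff: "q (a - c) \<le> q (a - b) + q (b - c)"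
  using q_tri[of "a - b" "b - c"] by simp

lemma q_abs_diff: "\<bar>q a - q b\<bar> \<le> q (a - b)"
  using q_tri[of "a - b" b] q_tri[of "b - a" a] q_diff_commute[of a b] by auto

lemma q_adj: "q (adj a) = q a"
proof -
  have *: "q b \<le> q (adj b)" for b
  proof (cases "q b = 0")
    case False
    have "q b * q b \<le> q (adj b) * q b"
      using q_star[of b] q_mult[of "adj b" b] by (simp add: power2_eq_square)
    then show ?thesis using False q_ge0[of b] by (simp add: mult_le_cancel_right)
  qed simp
  show ?thesis using *[of a] *[of "adj a"] by (simp add: adj_idem)
qed

abbreviation "CA \<equiv> cauchy_in q"
abbreviation "cl \<equiv> cauchy_class q"
definition "eqv x y \<longleftrightarrow> (\<lambda>n. q (x n - y n)) \<longlonglongrightarrow> 0"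

lemma eqv_refl [simp]: "eqv x x" by (simp add: eqv_def)
lemma eqv_sym: "eqv x y \<Longrightarrow> eqv y x" by (simp add: eqv_def q_diff_commute)
lemma eqv_trans: assumes "eqv x y" "eqv y z" shows "eqv x z"
proof -
  have "(\<lambda>n. q (x n - y n) + q (y n - z n)) \<longlonglongrightarrow> 0"
    using tendsto_add[OF assms[unfolded eqv_def]] by simp
  then show ?thesis unfolding eqv_def
    by (rule null_comparison[rotated]) (auto intro!: q_tri_diff)
qed

lemma cl_eq: assumes "CA x" "CA y" shows "cl x = cl y \<longleftrightarrow> eqv x y"
  using assms eqv_sym eqv_trans eqv_refl unfolding cauchy_class_def eqv_def[symmetric] by blast

lemma repr_cl: assumes "CA x" shows "CA (repr (cl x))" "eqv x (repr (cl x))"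
proof -
  have "x \<in> cl x" using assms by (simp add: cauchy_class_def)
  then have "repr (cl x) \<in> cl x" unfolding repr_def by (metis someI)
  then show "CA (repr (cl x))" "eqv x (repr (cl x))" by (auto simp: cauchy_class_def eqv_def)
qed

lemma CA_const [simp]: "CA (\<lambda>n. a)" by (simp add: cauchy_in_def)

lemma CA_lip: assumes "CA x" "\<And>a b. q (f a - f b) \<le> K * q (a - b)" shows "CA (\<lambda>n. f (x n))"
  unfolding cauchy_in_def
proof (intro allI impI)
  fix e :: real assume "e > 0"
  then obtain M where M: "\<forall>m\<ge>M. \<forall>n\<ge>M. q (x m - x n) < e / (\<bar>K\<bar> + 1)"
    using assms(1) unfolding cauchy_in_def
    by (metis abs_ge_zero add_nonneg_pos divide_pos_pos zero_less_one)
  have "q (f (x m) - f (x n)) < e" if "m \<ge> M" "n \<ge> M" for m n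
  proof -
    have "q (f (x m) - f (x n)) \<le> K * q (x m - x n)" by (rule assms)
    also have "\<dots> \<le> (\<bar>K\<bar> + 1) * q (x m - x n)" by (intro mult_right_mono) auto
    also have "\<dots> < e" using M that by (simp add: field_simps)
    finally show ?thesis .
  qed
  then show "\<exists>M. \<forall>m\<ge>M. \<forall>n\<ge>M. q (f (x m) - f (x n)) < e" by blast
qed

lemma CA_add: assumes "CA x" "CA y" shows "CA (\<lambda>n. x n + y n)"
  unfolding cauchy_in_def
proof (intro allI impI)
  fix e :: real assume "e > 0"
  then have "e / 2 > 0" by simp
  then obtain M N where M: "\<forall>m\<ge>M. \<forall>n\<ge>M. q (x m - x n) < e / 2" "\<forall>m\<ge>N. \<forall>n\<ge>N. q (y m - y n) < e / 2"
    using assms unfolding cauchy_in_def by metis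
  have "q ((x m + y m) - (x n + y n)) < e" if "m \<ge> max M N" "n \<ge> max M N" for m n
  proof -
    have "q ((x m + y m) - (x n + y n)) \<le> q (x m - x n) + q (y m - y n)"
      using q_tri[of "x m - x n" "y m - y n"] by (simp add: algebra_simps)
    also have "\<dots> < e" using M(1)[rule_format, of m n] M(2)[rule_format, of m n] that by simp
    finally show ?thesis .
  qed
  then show "\<exists>M. \<forall>m\<ge>M. \<forall>n\<ge>M. q ((x m + y m) - (x n + y n)) < e" by blast
qed

lemma CA_scl: "CA x \<Longrightarrow> CA (\<lambda>n. scl c (x n))"
  by (rule CA_lip[where K = "cmod c"]) (auto simp flip: scl_diff_right simp: q_scl)
lemma CA_adj: "CA x \<Longrightarrow> CA (\<lambda>n. adj (x n))"
  by (rule CA_lip[where K = 1]) (auto simp flip: adj_diff simp: q_adj)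

lemma CA_bounded: assumes "CA x" shows "\<exists>K>0. \<forall>n. q (x n) \<le> K"
proof -
  obtain M where M: "\<forall>m\<ge>M. \<forall>n\<ge>M. q (x m - x n) < 1" using assms unfolding cauchy_in_def
    by (metis zero_less_one)
  define K where "K = (\<Sum>n\<le>M. q (x n)) + 1"
  have le: "q (x n) \<le> K - 1" if "n \<le> M" for n
    unfolding K_def using that by (simp, intro member_le_sum) auto
  have "q (x n) \<le> K" for n
  proof (cases "n \<le> M")
    case False
    then have "q (x n - x M) < 1" using M by simp
    moreover have "q (x n) \<le> q (x n - x M) + q (x M)" using q_tri[of "x n - x M" "x M"] by simp
    ultimately show ?thesis using le[of M] by simp
  qed (use le in force)
  moreover have "K > 0" unfolding K_def by (simp add: add_nonneg_pos sum_nonneg)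
  ultimately show ?thesis by blast
qed

lemma q_mult_diff: "q (a * b - c * d) \<le> q (a - c) * q b + q c * q (b - d)"
proof -
  have "a * b - c * d = (a - c) * b + c * (b - d)" by (simp add: algebra_simps)
  then have "q (a * b - c * d) \<le> q ((a - c) * b) + q (c * (b - d))" using q_tri by metis
  then show ?thesis using q_mult[of "a - c" b] q_mult[of c "b - d"] by linarith
qed

lemma CA_mult: assumes "CA x" "CA y" shows "CA (\<lambda>n. x n * y n)"
  unfolding cauchy_in_def
proof (intro allI impI)
  fix e :: real assume e: "e > 0"
  obtain K L where K: "K > 0" "\<And>n. q (x n) \<le> K" and L: "L > 0" "\<And>n. q (y n) \<le> L"
    using CA_bounded assms by meson
  have "e / (2 * L) > 0" "e / (2 * K) > 0" using e K L by auto
  then obtain M N where M: "\<forall>m\<ge>M. \<forall>n\<ge>M. q (x m - x n) < e / (2 * L)" "\<forall>m\<ge>N. \<forall>n\<ge>N. q (y m - y n) < e / (2 * K)"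
    using assms unfolding cauchy_in_def by metis
  have "q (x m * y m - x n * y n) < e" if mn: "m \<ge> max M N" "n \<ge> max M N" for m n
  proof -
    have "q (x m * y m - x n * y n) \<le> q (x m - x n) * q (y m) + q (x n) * q (y m - y n)"
      by (rule q_mult_diff)
    also have "\<dots> \<le> q (x m - x n) * L + K * q (y m - y n)"
      by (intro add_mono mult_left_mono mult_right_mono K L) auto
    also have "\<dots> < e / (2 * L) * L + K * (e / (2 * K))"
      using M(1)[rule_format, of m n] M(2)[rule_format, of m n] mn K(1) L(1)
      by (intro add_strict_mono mult_strict_right_mono mult_strict_left_mono) auto
    also have "\<dots> = e" using K(1) L(1) by simp
    finally show ?thesis .
  qed
  then show "\<exists>M. \<forall>m\<ge>M. \<forall>n\<ge>M. q (x m * y m - x n * y n) < e" by blast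
qed

lemma eqv_lip: assumes "eqv x y" "\<And>a b. q (f a - f b) \<le> K * q (a - b)"
  shows "eqv (\<lambda>n. f (x n)) (\<lambda>n. f (y n))"
proof -
  have "(\<lambda>n. K * q (x n - y n)) \<longlonglongrightarrow> 0"
    using tendsto_mult_left[OF assms(1)[unfolded eqv_def], of K] by simp
  then show ?thesis unfolding eqv_def
    by (rule null_comparison[rotated]) (auto intro!: assms(2))
qed

lemma eqv_add: assumes "eqv x y" "eqv x' y'" shows "eqv (\<lambda>n. x n + x' n) (\<lambda>n. y n + y' n)"
proof -
  have "(\<lambda>n. q (x n - y n) + q (x' n - y' n)) \<longlonglongrightarrow> 0"
    using tendsto_add[OF assms[unfolded eqv_def]] by simp
  then show ?thesis unfolding eqv_def
  proof (rule null_comparison[rotated])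
    fix n show "norm (q (x n + x' n - (y n + y' n))) \<le> q (x n - y n) + q (x' n - y' n)"
      using q_tri[of "x n - y n" "x' n - y' n"] by (simp add: algebra_simps)
  qed
qed

lemma eqv_scl: "eqv x y \<Longrightarrow> eqv (\<lambda>n. scl c (x n)) (\<lambda>n. scl c (y n))"
  by (rule eqv_lip[where K = "cmod c"]) (auto simp flip: scl_diff_right simp: q_scl)
lemma eqv_adj: "eqv x y \<Longrightarrow> eqv (\<lambda>n. adj (x n)) (\<lambda>n. adj (y n))"
  by (rule eqv_lip[where K = 1]) (auto simp flip: adj_diff simp: q_adj)

lemma eqv_mult: assumes "eqv x y" "eqv x' y'" "CA y" "CA x'"
  shows "eqv (\<lambda>n. x n * x' n) (\<lambda>n. y n * y' n)"
proof -
  obtain K L where K: "K > 0" "\<And>n. q (y n) \<le> K" and L: "L > 0" "\<And>n. q (x' n) \<le> L"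
    using CA_bounded assms by meson
  have "(\<lambda>n. q (x n - y n) * L + K * q (x' n - y' n)) \<longlonglongrightarrow> 0 * L + K * 0"
    using assms(1,2)[unfolded eqv_def] by (intro tendsto_intros)
  then have "(\<lambda>n. q (x n - y n) * L + K * q (x' n - y' n)) \<longlonglongrightarrow> 0" by simp
  then show ?thesis unfolding eqv_def
  proof (rule null_comparison[rotated])
    fix n
    have "q (x n * x' n - y n * y' n) \<le> q (x n - y n) * q (x' n) + q (y n) * q (x' n - y' n)"
      by (rule q_mult_diff)
    also have "\<dots> \<le> q (x n - y n) * L + K * q (x' n - y' n)"
      by (intro add_mono mult_left_mono mult_right_mono K L) auto
    finally show "norm (q (x n * x' n - y n * y' n)) \<le> q (x n - y n) * L + K * q (x' n - y' n)" by simp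
  qed
qed

lemma CA_conv: assumes "CA x" shows "convergent (\<lambda>n. q (x n))"
proof -
  have "Cauchy (\<lambda>n. q (x n))"
  proof (rule metric_CauchyI)
    fix e :: real assume "e > 0"
    then obtain M where "\<forall>m\<ge>M. \<forall>n\<ge>M. q (x m - x n) < e" using assms unfolding cauchy_in_def by blast
    then show "\<exists>M. \<forall>m\<ge>M. \<forall>n\<ge>M. dist (q (x m)) (q (x n)) < e"
      using q_abs_diff unfolding dist_real_def by (meson order_le_less_trans)
  qed
  then show ?thesis using Cauchy_convergent by blast
qed

lemma lim_eqv: assumes "CA x" "eqv x y" shows "(\<lambda>n. q (y n)) \<longlonglongrightarrow> lim (\<lambda>n. q (x n))"
proof -
  have 1: "(\<lambda>n. q (x n)) \<longlonglongrightarrow> lim (\<lambda>n. q (x n))" using CA_conv[OF assms(1)] convergent_LIMSEQ_iff by blast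
  have "(\<lambda>n. q (y n) - q (x n)) \<longlonglongrightarrow> 0"
  proof (rule null_comparison)
    show "norm (q (y n) - q (x n)) \<le> q (x n - y n)" for n
      using q_abs_diff[of "x n" "y n"] by (simp add: abs_minus_commute)
  qed (use assms(2) in \<open>simp add: eqv_def\<close>)
  from tendsto_add[OF this 1] show ?thesis by simp
qed

abbreviation "A \<equiv> cstar_completion q"

lemma carrier_A: "X \<in> carrier A \<longleftrightarrow> (\<exists>x. CA x \<and> X = cl x)"
  by (auto simp: cstar_completion_def)

lemma cl_in: "CA x \<Longrightarrow> cl x \<in> carrier A" by (auto simp: carrier_A)

lemma mult_cl: "CA x \<Longrightarrow> CA y \<Longrightarrow> cl x \<otimes>\<^bsub>A\<^esub> cl y = cl (\<lambda>n. x n * y n)"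
  by (simp add: cstar_completion_def cl_eq CA_mult repr_cl eqv_mult eqv_sym)
lemma add_cl: "CA x \<Longrightarrow> CA y \<Longrightarrow> cl x \<oplus>\<^bsub>A\<^esub> cl y = cl (\<lambda>n. x n + y n)"
  by (simp add: cstar_completion_def cl_eq CA_add repr_cl eqv_add eqv_sym)
lemma scale_cl: "CA x \<Longrightarrow> cscale A c (cl x) = cl (\<lambda>n. scl c (x n))"
  by (simp add: cstar_completion_def cl_eq CA_scl repr_cl eqv_scl eqv_sym)
lemma adj_cl: "CA x \<Longrightarrow> cadj A (cl x) = cl (\<lambda>n. adj (x n))"
  by (simp add: cstar_completion_def cl_eq CA_adj repr_cl eqv_adj eqv_sym)
lemma one_cl: "\<one>\<^bsub>A\<^esub> = cl (\<lambda>n. 1)" and zero_cl: "\<zero>\<^bsub>A\<^esub> = cl (\<lambda>n. 0)"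
  by (simp_all add: cstar_completion_def)
lemma norm_cl: assumes "CA x" shows "cnorm A (cl x) = lim (\<lambda>n. q (x n))"
  unfolding cstar_completion_def
  using limI[OF lim_eqv[OF assms repr_cl(2)[OF assms]]] by simp
lemma norm_cl_tendsto: "CA x \<Longrightarrow> (\<lambda>n. q (x n)) \<longlonglongrightarrow> cnorm A (cl x)"
  unfolding norm_cl by (rule lim_eqv[OF _ eqv_refl])

lemma ring_A: "ring A"
proof -
  have ex: "\<exists>x. CA x \<and> X = cl x" if "X \<in> carrier A" for X using that by (simp add: carrier_A)
  note cls = mult_cl add_cl one_cl zero_cl CA_add CA_mult cl_in
  show ?thesis
  proof (intro ringI abelian_groupI Group.monoidI)
    fix X assume "X \<in> carrier A"
    then obtain x where x: "CA x" "X = cl x" using ex by blast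
    then have "CA (\<lambda>n. scl (-1) (x n))" by (simp add: CA_scl)
    moreover have "scl (-1) a + a = 0" for a :: "'x free_star" by (simp add: scl_def single_uminus)
    ultimately show "\<exists>Y\<in>carrier A. Y \<oplus>\<^bsub>A\<^esub> X = \<zero>\<^bsub>A\<^esub>"
      using x by (intro bexI[of _ "cl (\<lambda>n. scl (-1) (x n))"]) (simp_all add: cls)
    show "\<zero>\<^bsub>A\<^esub> \<oplus>\<^bsub>A\<^esub> X = X" "\<one>\<^bsub>A\<^esub> \<otimes>\<^bsub>A\<^esub> X = X" "X \<otimes>\<^bsub>A\<^esub> \<one>\<^bsub>A\<^esub> = X" using x by (simp_all add: cls)
    fix Y assume "Y \<in> carrier A"
    then obtain y where y: "CA y" "Y = cl y" using ex by blast
    show "X \<oplus>\<^bsub>A\<^esub> Y \<in> carrier A" "X \<otimes>\<^bsub>A\<^esub> Y \<in> carrier A" using x y by (simp_all add: cls)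
    show "X \<oplus>\<^bsub>A\<^esub> Y = Y \<oplus>\<^bsub>A\<^esub> X" using x y by (simp add: cls add.commute)
    fix Z assume "Z \<in> carrier A"
    then obtain z where z: "CA z" "Z = cl z" using ex by blast
    show "X \<oplus>\<^bsub>A\<^esub> Y \<oplus>\<^bsub>A\<^esub> Z = X \<oplus>\<^bsub>A\<^esub> (Y \<oplus>\<^bsub>A\<^esub> Z)" "X \<otimes>\<^bsub>A\<^esub> Y \<otimes>\<^bsub>A\<^esub> Z = X \<otimes>\<^bsub>A\<^esub> (Y \<otimes>\<^bsub>A\<^esub> Z)"
      "(X \<oplus>\<^bsub>A\<^esub> Y) \<otimes>\<^bsub>A\<^esub> Z = X \<otimes>\<^bsub>A\<^esub> Z \<oplus>\<^bsub>A\<^esub> Y \<otimes>\<^bsub>A\<^esub> Z"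
      "Z \<otimes>\<^bsub>A\<^esub> (X \<oplus>\<^bsub>A\<^esub> Y) = Z \<otimes>\<^bsub>A\<^esub> X \<oplus>\<^bsub>A\<^esub> Z \<otimes>\<^bsub>A\<^esub> Y"
      using x y z by (simp_all add: cls add.assoc mult.assoc distrib_left distrib_right)
  qed (simp_all add: cls)
qed

lemma a_inv_cl: assumes "CA x" shows "\<ominus>\<^bsub>A\<^esub> cl x = cl (\<lambda>n. - x n)"
proof -
  interpret ring A by (rule ring_A)
  have CA: "CA (\<lambda>n. - x n)" using CA_scl[OF assms, of "-1"] by (simp add: scl_def single_uminus)
  then show ?thesis using assms by (intro minus_equality) (auto simp: add_cl zero_cl cl_in)
qed

lemma diff_cl: assumes "CA x" "CA y" shows "cl x \<ominus>\<^bsub>A\<^esub> cl y = cl (\<lambda>n. x n - y n)"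
proof -
  have CA: "CA (\<lambda>n. - y n)" using CA_scl[OF assms(2), of "-1"] by (simp add: scl_def single_uminus)
  then show ?thesis using assms unfolding a_minus_def by (simp add: a_inv_cl add_cl)
qed

lemma CA_diff: assumes "CA x" "CA y" shows "CA (\<lambda>n. x n - y n)"
  using CA_add[OF assms(1) CA_scl[OF assms(2), of "-1"]] by (simp add: scl_def single_uminus)

lemma norm_const: "cnorm A (cl (\<lambda>n. a)) = q a"
  by (simp add: norm_cl limI)

lemma approx: assumes "CA x" "e > 0" shows "\<exists>a. cnorm A (cl x \<ominus>\<^bsub>A\<^esub> cl (\<lambda>n. a)) < e"
proof -
  have "e / 2 > 0" using assms by simp
  then obtain M where M: "\<forall>m\<ge>M. \<forall>n\<ge>M. q (x m - x n) < e / 2"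
    using assms unfolding cauchy_in_def by metis
  have "cnorm A (cl (\<lambda>n. x n - x M)) \<le> e / 2"
    by (rule LIMSEQ_le_const2[OF norm_cl_tendsto]) (use assms M CA_diff in \<open>auto intro!: exI[of _ M] less_imp_le\<close>)
  then show ?thesis using assms by (intro exI[of _ "x M"]) (simp add: diff_cl)
qed

lemma norm_tri_A: assumes "X \<in> carrier A" "Y \<in> carrier A"
  shows "cnorm A (X \<oplus>\<^bsub>A\<^esub> Y) \<le> cnorm A X + cnorm A Y"
proof -
  obtain x y where x: "CA x" "X = cl x" "CA y" "Y = cl y" using assms by (auto simp: carrier_A)
  have "cnorm A (cl (\<lambda>n. x n + y n)) \<le> cnorm A (cl x) + cnorm A (cl y)"
    by (rule LIMSEQ_le[OF norm_cl_tendsto tendsto_add[OF norm_cl_tendsto norm_cl_tendsto]])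
       (use x CA_add q_tri in auto)
  then show ?thesis using x by (simp add: add_cl)
qed

lemma complete_A:
  assumes X: "\<And>n. X n \<in> carrier A"
    and Cau: "\<And>e. e > 0 \<Longrightarrow> \<exists>M. \<forall>m\<ge>M. \<forall>n\<ge>M. cnorm A (X m \<ominus>\<^bsub>A\<^esub> X n) < e"
  shows "\<exists>L\<in>carrier A. (\<lambda>n. cnorm A (X n \<ominus>\<^bsub>A\<^esub> L)) \<longlonglongrightarrow> 0"
proof -
  interpret ring A by (rule ring_A)
  let ?c = "\<lambda>a. cl (\<lambda>n::nat. a)"
  have cc: "?c a \<in> carrier A" for a by (simp add: cl_in)
  have "\<exists>a. cnorm A (X k \<ominus>\<^bsub>A\<^esub> ?c a) < 1 / real (Suc k)" for k
    
  proof -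
    obtain x where x: "CA x" "X k = cl x" using X[of k] by (auto simp: carrier_A)
    show ?thesis unfolding x(2) by (rule approx[OF x(1)]) simp
  qed
  then obtain a where a: "\<And>k. cnorm A (X k \<ominus>\<^bsub>A\<^esub> ?c (a k)) < 1 / real (Suc k)" by metis
  have tri: "cnorm A (x \<ominus>\<^bsub>A\<^esub> z) \<le> cnorm A (x \<ominus>\<^bsub>A\<^esub> y) + cnorm A (y \<ominus>\<^bsub>A\<^esub> z)"
    if "x \<in> carrier A" "y \<in> carrier A" "z \<in> carrier A" for x y z
  proof -
    have "x \<ominus>\<^bsub>A\<^esub> z = (x \<ominus>\<^bsub>A\<^esub> y) \<oplus>\<^bsub>A\<^esub> (y \<ominus>\<^bsub>A\<^esub> z)" using that by algebra
    then show ?thesis using norm_tri_A[of "x \<ominus>\<^bsub>A\<^esub> y" "y \<ominus>\<^bsub>A\<^esub> z"] that by simp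
  qed
  have comm: "cnorm A (x \<ominus>\<^bsub>A\<^esub> y) = cnorm A (y \<ominus>\<^bsub>A\<^esub> x)"
    if "x \<in> carrier A" "y \<in> carrier A" for x y
  proof -
    obtain x' y' where "CA x'" "x = cl x'" "CA y'" "y = cl y'" using \<open>x \<in> carrier A\<close> \<open>y \<in> carrier A\<close> by (auto simp: carrier_A)
    then show ?thesis by (simp add: diff_cl norm_cl CA_diff q_diff_commute)
  qed
  have qa: "q (b - c) = cnorm A (?c b \<ominus>\<^bsub>A\<^esub> ?c c)" for b c by (simp add: diff_cl norm_const)
  have CAa: "CA a"
    unfolding cauchy_in_def
  proof (intro allI impI)
    fix e :: real assume "e > 0"
    then have e3: "e / 3 > 0" by simp
    obtain M where M: "\<forall>m\<ge>M. \<forall>n\<ge>M. cnorm A (X m \<ominus>\<^bsub>A\<^esub> X n) < e / 3" using Cau[OF e3] by blast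
    obtain N where N: "1 / real (Suc N) < e / 3" using nat_approx_posE[OF e3] by blast
    have small: "1 / real (Suc n) < e / 3" if "n \<ge> N" for n
      by (rule order_le_less_trans[OF _ N]) (use that in \<open>simp add: frac_le\<close>)
    have "q (a m - a n) < e" if mn: "m \<ge> max M N" "n \<ge> max M N" for m n
    proof -
      have "q (a m - a n) \<le> cnorm A (?c (a m) \<ominus>\<^bsub>A\<^esub> X m) + (cnorm A (X m \<ominus>\<^bsub>A\<^esub> X n) + cnorm A (X n \<ominus>\<^bsub>A\<^esub> ?c (a n)))"
        unfolding qa using tri[OF cc[of "a m"] X[of m] cc[of "a n"]] tri[OF X[of m] X[of n] cc[of "a n"]] by linarith
      moreover have "cnorm A (?c (a m) \<ominus>\<^bsub>A\<^esub> X m) < e / 3" using a[of m] small[of m] mn comm[OF cc[of "a m"] X[of m]] by linarith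
      moreover have "cnorm A (X n \<ominus>\<^bsub>A\<^esub> ?c (a n)) < e / 3" using a[of n] small[of n] mn by simp
      moreover have "cnorm A (X m \<ominus>\<^bsub>A\<^esub> X n) < e / 3" using M mn by simp
      ultimately show ?thesis by simp
    qed
    then show "\<exists>M. \<forall>m\<ge>M. \<forall>n\<ge>M. q (a m - a n) < e" by blast
  qed
  show ?thesis
  proof (intro bexI[of _ "cl a"] LIMSEQ_I)
    fix e :: real assume "e > 0"
    then have e2: "e / 2 > 0" by simp
    obtain M where M: "\<forall>m\<ge>M. \<forall>n\<ge>M. q (a m - a n) < e / 2" using CAa e2 unfolding cauchy_in_def by blast
    obtain N where N: "1 / real (Suc N) < e / 2" using nat_approx_posE[OF e2] by blast
    have "norm (cnorm A (X n \<ominus>\<^bsub>A\<^esub> cl a) - 0) < e" if mn: "n \<ge> max M N" for n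
    proof -
      have "1 / real (Suc n) \<le> 1 / real (Suc N)" using mn by (simp add: frac_le)
      then have 1: "cnorm A (X n \<ominus>\<^bsub>A\<^esub> ?c (a n)) < e / 2" using a[of n] N by linarith
      have CA': "CA (\<lambda>m. a n - a m)" using CA_diff[OF CA_const CAa] .
      have "cnorm A (cl (\<lambda>m. a n - a m)) \<le> e / 2"
        by (rule LIMSEQ_le_const2[OF norm_cl_tendsto[OF CA']]) (use M mn in \<open>auto intro!: exI[of _ M] less_imp_le\<close>)
      then have "cnorm A (?c (a n) \<ominus>\<^bsub>A\<^esub> cl a) \<le> e / 2" using CAa by (simp add: diff_cl)
      moreover have "cnorm A (X n \<ominus>\<^bsub>A\<^esub> cl a) \<le> cnorm A (X n \<ominus>\<^bsub>A\<^esub> ?c (a n)) + cnorm A (?c (a n) \<ominus>\<^bsub>A\<^esub> cl a)"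
        using tri X cc cl_in[OF CAa] by blast
      moreover have "0 \<le> cnorm A (X n \<ominus>\<^bsub>A\<^esub> cl a)"
      proof -
        have "X n \<ominus>\<^bsub>A\<^esub> cl a \<in> carrier A" using X cl_in[OF CAa] by simp
        then obtain z where "CA z" "X n \<ominus>\<^bsub>A\<^esub> cl a = cl z" using carrier_A by blast
        then show ?thesis using LIMSEQ_le_const[OF norm_cl_tendsto, of z 0] by auto
      qed
      ultimately show ?thesis using 1 by simp
    qed
    then show "\<exists>no. \<forall>n\<ge>no. norm (cnorm A (X n \<ominus>\<^bsub>A\<^esub> cl a) - 0) < e" by blast
  qed (rule cl_in[OF CAa])
qed

lemma ex_scl: "CA x \<Longrightarrow> \<exists>z. CA z \<and> cl (\<lambda>n. scl c (x n)) = cl z"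
  by (rule exI[of _ "\<lambda>n. scl c (x n)"]) (simp add: CA_scl)
lemma ex_adj: "CA x \<Longrightarrow> \<exists>z. CA z \<and> cl (\<lambda>n. adj (x n)) = cl z"
  by (rule exI[of _ "\<lambda>n. adj (x n)"]) (simp add: CA_adj)

theorem cstar_algebra_completion: "cstar_algebra A"
proof (intro cstar_algebra.intro ring_A cstar_algebra_axioms.intro)
  fix X assume "X \<in> carrier A"
  then obtain x where x: "CA x" "X = cl x" by (auto simp: carrier_A)
  show "(cnorm A X = 0) = (X = \<zero>\<^bsub>A\<^esub>)"
  proof
    assume "cnorm A X = 0"
    then have "eqv x (\<lambda>n. 0)" using norm_cl_tendsto[OF x(1)] x by (simp add: eqv_def)
    then show "X = \<zero>\<^bsub>A\<^esub>" using x by (simp add: zero_cl cl_eq)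
  qed (simp add: zero_cl norm_const)
  show "cnorm A (cscale A c X) = cmod c * cnorm A X" for c
    using tendsto_mult_left[OF norm_cl_tendsto[OF x(1)], of "cmod c"] x by (simp add: scale_cl norm_cl CA_scl q_scl limI)
  show "cnorm A (cadj A X \<otimes>\<^bsub>A\<^esub> X) = (cnorm A X)\<^sup>2"
    using tendsto_power[OF norm_cl_tendsto[OF x(1)], of 2] x
    by (simp add: adj_cl mult_cl norm_cl CA_adj CA_mult q_star limI)
  fix Y assume "Y \<in> carrier A"
  then obtain y where y: "CA y" "Y = cl y" by (auto simp: carrier_A)
  have "cnorm A (cl (\<lambda>n. x n * y n)) \<le> cnorm A (cl x) * cnorm A (cl y)"
    by (rule LIMSEQ_le[OF norm_cl_tendsto tendsto_mult[OF norm_cl_tendsto norm_cl_tendsto]])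
       (use x y CA_mult q_mult in auto)
  then show "cnorm A (X \<otimes>\<^bsub>A\<^esub> Y) \<le> cnorm A X * cnorm A Y" using x y by (simp add: mult_cl)
next
  fix X Y assume "X \<in> carrier A" "Y \<in> carrier A"
  then show "cnorm A (X \<oplus>\<^bsub>A\<^esub> Y) \<le> cnorm A X + cnorm A Y" by (rule norm_tri_A)
next
  fix X :: "nat \<Rightarrow> _"
  assume "\<And>n. X n \<in> carrier A"
    "\<And>e. e > 0 \<Longrightarrow> \<exists>M. \<forall>m\<ge>M. \<forall>n\<ge>M. cnorm A (X m \<ominus>\<^bsub>A\<^esub> X n) < e"
  then show "\<exists>L\<in>carrier A. (\<lambda>n. cnorm A (X n \<ominus>\<^bsub>A\<^esub> L)) \<longlonglongrightarrow> 0" by (rule complete_A)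
qed (auto simp: carrier_A mult_cl add_cl scale_cl adj_cl CA_add CA_mult CA_scl CA_adj
      scl_add_right scl_add_left scl_scl scl_one scl_mult_left scl_mult_right adj_idem
      adj_add_free adj_scl adj_mult_free intro: ex_scl ex_adj)

end


lemma adj_one: "adj 1 = 1"
proof -
  have "adj (Poly_Mapping.single 0 1) = Poly_Mapping.single 0 1"
    by (simp add: adj_single word_adj_def zero_star_word_def)
  then show ?thesis by simp
qed

lemma zero_seminorm: "(\<lambda>_. 0) \<in> seminorms R"
  by (auto simp: seminorms_def cstar_seminorm_def)

locale bounded_relations =
  fixes R :: "'x free_star set"
  assumes bounded: "\<And>x. \<exists>K. \<forall>q\<in>seminorms R. q (gen x) \<le> K"
begin

lemma sn: "q \<in> seminorms R \<Longrightarrow> seminormed q"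
  by (simp add: seminorms_def seminormed_def)

lemma q_one: assumes "q \<in> seminorms R" shows "q 1 \<le> 1"
proof -
  interpret seminormed q using assms by (rule sn)
  have "q 1 * q 1 = q 1" using q_star[of 1] by (simp add: adj_one power2_eq_square)
  then show ?thesis by (cases "q 1 = 0") auto
qed

lemma bounded_letters: "\<exists>K. \<forall>q\<in>seminorms R. q (Poly_Mapping.single (Word ls) 1) \<le> K"
proof (induction ls)
  case Nil
  have "Poly_Mapping.single (Word []) 1 = (1 :: 'x free_star)"
    by (simp flip: zero_star_word_def)
  then show ?case using q_one by auto
next
  case (Cons l ls)
  then obtain K where K: "\<forall>q\<in>seminorms R. q (Poly_Mapping.single (Word ls) 1) \<le> K" by blast
  obtain x where x: "l = Plain x \<or> l = Starred x" by (cases l) auto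
  obtain L where L: "\<forall>q\<in>seminorms R. q (gen x) \<le> L" using bounded by blast
  have L': "q (Poly_Mapping.single (Word [l]) 1) \<le> L" if "q \<in> seminorms R" for q
  proof -
    interpret seminormed q using that by (rule sn)
    have "Poly_Mapping.single (Word [l]) 1 = gen x \<or> Poly_Mapping.single (Word [l]) 1 = adj (gen x)"
      using x by (auto simp: gen_def adj_single word_adj_def)
    then show ?thesis using L that q_adj by auto
  qed
  have "q (Poly_Mapping.single (Word (l # ls)) 1) \<le> L * K" if "q \<in> seminorms R" for q
  proof -
    interpret seminormed q using that by (rule sn)
    have "Poly_Mapping.single (Word (l # ls)) 1 = (Poly_Mapping.single (Word [l]) 1 * Poly_Mapping.single (Word ls) 1 :: 'x free_star)"
      by (simp add: mult_single plus_star_word_def)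
    then have "q (Poly_Mapping.single (Word (l # ls)) 1) \<le> q (Poly_Mapping.single (Word [l]) 1) * q (Poly_Mapping.single (Word ls) 1)"
      using q_mult by metis
    also have "\<dots> \<le> L * K" using L'[OF that] K that
      by (intro mult_mono) (auto intro: order_trans[OF q_ge0])
    finally show ?thesis .
  qed
  then show ?case by blast
qed

lemma bounded_all: "\<exists>K. \<forall>q\<in>seminorms R. q a \<le> K"
proof (induction a rule: free_star_induct)
  case (single w c)
  obtain ls where w: "w = Word ls" by (cases w)
  obtain K where K: "\<forall>q\<in>seminorms R. q (Poly_Mapping.single w 1) \<le> K"
    using bounded_letters w by blast
  have "q (Poly_Mapping.single w c) \<le> cmod c * K" if "q \<in> seminorms R" for q
  proof -
    interpret seminormed q using that by (rule sn)
    have "Poly_Mapping.single w c = scl c (Poly_Mapping.single w 1)" by (simp add: scl_def mult_single)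
    then show ?thesis using K that q_scl[of c "Poly_Mapping.single w 1"] by (simp add: mult_left_mono)
  qed
  then show ?case by blast
next
  case (sum f k v)
  then obtain K L where KL: "\<forall>q\<in>seminorms R. q f \<le> K" "\<forall>q\<in>seminorms R. q (Poly_Mapping.single k v) \<le> L" by blast
  have "q (f + Poly_Mapping.single k v) \<le> K + L" if "q \<in> seminorms R" for q
  proof -
    interpret seminormed q using that by (rule sn)
    show ?thesis using q_tri[of f "Poly_Mapping.single k v"] KL that by force
  qed
  then show ?case by blast
qed

abbreviation "N \<equiv> univ_seminorm R"

lemma N_def: "N a = (SUP q\<in>seminorms R. q a)"
  by (rule univ_seminorm_def)

lemma bdd: "bdd_above ((\<lambda>q. q a) ` seminorms R)"
  using bounded_all[of a] unfolding bdd_above_def by blast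

lemma le_N: "q \<in> seminorms R \<Longrightarrow> q a \<le> N a"
  unfolding N_def by (rule cSUP_upper[OF _ bdd])

lemma N_le: "(\<And>q. q \<in> seminorms R \<Longrightarrow> q a \<le> K) \<Longrightarrow> N a \<le> K"
  unfolding N_def using zero_seminorm by (intro cSUP_least) auto

lemma N_ge0: "0 \<le> N a" using le_N[OF zero_seminorm] .

lemma N_seminorm: "cstar_seminorm N"
  unfolding cstar_seminorm_def
proof (intro conjI allI)
  fix a b :: "'x free_star" and c :: complex
  show "0 \<le> N a" by (rule N_ge0)
  show "N (a + b) \<le> N a + N b"
  proof (rule N_le)
    fix q assume q: "q \<in> seminorms R"
    show "q (a + b) \<le> N a + N b"
      using seminormed.q_tri[OF sn[OF q], of a b] le_N[OF q, of a] le_N[OF q, of b] by linarith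
  qed
  have scl_le: "N (scl c a) \<le> cmod c * N a" for c a
    by (rule N_le) (simp add: seminormed.q_scl[OF sn] le_N mult_left_mono)
  show "N (scl c a) = cmod c * N a"
  proof (cases "c = 0")
    case True
    then show ?thesis using scl_le[of 0 a] N_ge0[of "scl 0 a"] by simp
  next
    case False
    have "N a \<le> cmod (1 / c) * N (scl c a)"
      using scl_le[of "1 / c" "scl c a"] False by (simp add: scl_scl scl_one)
    then have "cmod c * N a \<le> N (scl c a)" using False by (simp add: norm_divide field_simps)
    then show ?thesis using scl_le[of c a] by simp
  qed
  show "N (a * b) \<le> N a * N b"
  proof (rule N_le)
    fix q assume q: "q \<in> seminorms R"
    interpret seminormed q using q by (rule sn)
    show "q (a * b) \<le> N a * N b"
      by (rule order_trans[OF q_mult]) (intro mult_mono le_N q N_ge0 q_ge0)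
  qed
  show "N (adj a * a) = (N a)\<^sup>2"
  proof (rule antisym)
    show "N (adj a * a) \<le> (N a)\<^sup>2"
    proof (rule N_le)
      fix q assume q: "q \<in> seminorms R"
      interpret seminormed q using q by (rule sn)
      show "q (adj a * a) \<le> (N a)\<^sup>2" unfolding q_star by (intro power_mono le_N q q_ge0)
    qed
    have "N a \<le> sqrt (N (adj a * a))"
    proof (rule N_le)
      fix q assume q: "q \<in> seminorms R"
      interpret seminormed q using q by (rule sn)
      show "q a \<le> sqrt (N (adj a * a))"
        using le_N[OF q, of "adj a * a"] by (simp add: q_star real_le_rsqrt)
    qed
    then show "(N a)\<^sup>2 \<le> N (adj a * a)"
      using N_ge0 by (metis real_sqrt_le_iff real_sqrt_pow2 power_mono)
  qed
qed

lemma N_rel: "r \<in> R \<Longrightarrow> N r = 0"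
  using N_ge0[of r] by (intro antisym N_le) (auto simp: seminorms_def)

sublocale seminormed N by unfold_locales (rule N_seminorm)

end

definition letter_val :: "('b, 'm) cstar_scheme \<Rightarrow> ('x \<Rightarrow> 'b) \<Rightarrow> 'x star_letter \<Rightarrow> 'b" where
  "letter_val B f l = (case l of Plain x \<Rightarrow> f x | Starred x \<Rightarrow> cadj B (f x))"

definition word_val :: "('b, 'm) cstar_scheme \<Rightarrow> ('x \<Rightarrow> 'b) \<Rightarrow> 'x star_word \<Rightarrow> 'b" where
  "word_val B f w = foldr (\<lambda>l y. letter_val B f l \<otimes>\<^bsub>B\<^esub> y) (letters w) \<one>\<^bsub>B\<^esub>"

definition eval_in :: "('b, 'm) cstar_scheme \<Rightarrow> ('x \<Rightarrow> 'b) \<Rightarrow> 'x free_star \<Rightarrow> 'b" where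
  "eval_in B f a = (\<Oplus>\<^bsub>B\<^esub>w\<in>Poly_Mapping.keys a. cscale B (Poly_Mapping.lookup a w) (word_val B f w))"

context cstar_algebra begin

lemma scale_zero: "x \<in> carrier A \<Longrightarrow> cscale A 0 x = \<zero>"
  using norm_eq_zero[OF scale_closed[of x 0]] norm_scale[of x 0] by simp

lemma adj_one_A: "cadj A \<one> = \<one>"
proof -
  have "\<one> = cadj A (cadj A \<one> \<otimes> \<one>)" by (simp add: adj_adj adj_closed)
  also have "\<dots> = cadj A \<one> \<otimes> cadj A (cadj A \<one>)" by (simp only: adj_mult adj_closed one_closed)
  also have "\<dots> = cadj A \<one>" by (simp add: adj_adj adj_closed)
  finally show ?thesis by simp
qed

lemma norm_nonneg: "x \<in> carrier A \<Longrightarrow> 0 \<le> cnorm A x"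
proof -
  assume x: "x \<in> carrier A"
  have "x \<oplus> cscale A (-1) x = \<zero>"
    using scale_add_left[OF x, of 1 "-1"] x by (simp add: scale_one scale_zero)
  moreover have "cnorm A \<zero> = 0" using norm_eq_zero by simp
  ultimately show ?thesis using norm_triangle[OF x scale_closed[OF x, of "-1"]] norm_scale[OF x, of "-1"] by simp
qed

context fixes f :: "'x \<Rightarrow> 'a" assumes f: "\<And>x. f x \<in> carrier A"
begin

lemma letter_closed: "letter_val A f l \<in> carrier A"
  by (cases l) (auto simp: letter_val_def f adj_closed)

lemma fold_closed: "foldr (\<lambda>l y. letter_val A f l \<otimes> y) ls \<one> \<in> carrier A"
  by (induction ls) (auto simp: letter_closed)

lemma word_closed: "word_val A f w \<in> carrier A"
  by (simp add: word_val_def fold_closed)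

lemma word_plus: "word_val A f (v + w) = word_val A f v \<otimes> word_val A f w"
proof -
  have "foldr (\<lambda>l y. letter_val A f l \<otimes> y) (xs @ ys) \<one>
     = foldr (\<lambda>l y. letter_val A f l \<otimes> y) xs \<one> \<otimes> foldr (\<lambda>l y. letter_val A f l \<otimes> y) ys \<one>" for xs ys
    by (induction xs) (simp_all add: letter_closed fold_closed m_assoc del: foldr_append)
  then show ?thesis by (simp add: word_val_def plus_star_word_def)
qed

lemma word_single: "word_val A f (Word [l]) = letter_val A f l"
  by (simp add: word_val_def letter_closed)

lemma word_zero: "word_val A f 0 = \<one>"
  by (simp add: word_val_def zero_star_word_def)

lemma word_val_adj: "word_val A f (word_adj w) = cadj A (word_val A f w)"
proof -
  have "word_val A f (word_adj (Word ls)) = cadj A (word_val A f (Word ls))" for ls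
  proof (induction ls)
    case Nil
    then show ?case by (simp add: word_val_def word_adj_def adj_one_A)
  next
    case (Cons l ls)
    have 1: "Word (l # ls) = Word [l] + Word ls" by (simp add: plus_star_word_def)
    have 2: "word_val A f (word_adj (Word [l])) = cadj A (word_val A f (Word [l]))"
      by (cases l) (simp_all add: word_adj_def word_single, simp_all add: letter_val_def f adj_adj)
    show ?case unfolding 1 word_adj_add word_plus Cons 2 by (simp add: adj_mult word_closed)
  qed
  then show ?thesis by (cases w) simp
qed

abbreviation "ev \<equiv> eval_in A f"

lemma eval_superset:
  assumes "finite K" "Poly_Mapping.keys a \<subseteq> K"
  shows "ev a = (\<Oplus>w\<in>K. cscale A (Poly_Mapping.lookup a w) (word_val A f w))"
  unfolding eval_in_def
  by (rule add.finprod_mono_neutral_cong_left)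
     (use assms in \<open>auto simp: in_keys_iff scale_zero word_closed scale_closed\<close>)

lemma ev_closed: "ev a \<in> carrier A"
  unfolding eval_in_def by (auto intro!: finsum_closed scale_closed word_closed)

lemma ev_add: "ev (a + b) = ev a \<oplus> ev b"
proof -
  let ?K = "Poly_Mapping.keys a \<union> Poly_Mapping.keys b"
  have "ev (a + b) = (\<Oplus>w\<in>?K. cscale A (Poly_Mapping.lookup (a + b) w) (word_val A f w))"
    by (rule eval_superset) (auto simp: Poly_Mapping.keys_add)
  also have "\<dots> = (\<Oplus>w\<in>?K. cscale A (Poly_Mapping.lookup a w) (word_val A f w) \<oplus> cscale A (Poly_Mapping.lookup b w) (word_val A f w))"
    by (rule finsum_cong') (auto simp: lookup_add scale_add_left word_closed scale_closed)
  also have "\<dots> = (\<Oplus>w\<in>?K. cscale A (Poly_Mapping.lookup a w) (word_val A f w)) \<oplus> (\<Oplus>w\<in>?K. cscale A (Poly_Mapping.lookup b w) (word_val A f w))"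
    by (rule finsum_addf) (auto simp: word_closed scale_closed)
  also have "\<dots> = ev a \<oplus> ev b" by (simp add: eval_superset[of ?K])
  finally show ?thesis .
qed

lemma ev_single: "ev (Poly_Mapping.single w c) = cscale A c (word_val A f w)"
proof -
  have "ev (Poly_Mapping.single w c) = (\<Oplus>v\<in>{w}. cscale A (Poly_Mapping.lookup (Poly_Mapping.single w c) v) (word_val A f v))"
    by (rule eval_superset) auto
  then show ?thesis by (simp add: scale_closed word_closed)
qed

lemma ev_zero: "ev 0 = \<zero>" by (simp add: eval_in_def)

lemma ev_one: "ev 1 = \<one>"
  using ev_single[of 0 1] by (simp add: word_zero scale_one)

lemma ev_gen: "ev (gen x) = f x"
  by (simp add: gen_def ev_single word_single scale_one letter_closed) (simp add: letter_val_def f scale_one)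

lemma ev_mult_single: "ev (Poly_Mapping.single w c * b) = ev (Poly_Mapping.single w c) \<otimes> ev b"
proof (induction b rule: free_star_induct)
  case (single k v)
  show ?case by (simp add: mult_single ev_single word_plus scale_mult_left scale_mult_right word_closed scale_closed scale_scale mult.commute)
next
  case (sum g k v)
  then show ?case by (simp add: distrib_left ev_add ev_closed r_distr)
qed

lemma ev_mult: "ev (a * b) = ev a \<otimes> ev b"
proof (induction a rule: free_star_induct)
  case (single k v)
  show ?case by (rule ev_mult_single)
next
  case (sum g k v)
  then show ?case by (simp add: distrib_right ev_add ev_closed l_distr)
qed

lemma ev_scl: "ev (scl c a) = cscale A c (ev a)"
  by (simp add: scl_def ev_mult ev_single word_zero scale_mult_left ev_closed)

lemma ev_adj: "ev (adj a) = cadj A (ev a)"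
proof (induction a rule: free_star_induct)
  case (single k v)
  show ?case by (simp add: adj_single ev_single word_val_adj adj_scale word_closed)
next
  case (sum g k v)
  then show ?case by (simp add: adj_add_free ev_add ev_closed adj_add)
qed

lemma ev_seminorm: "cstar_seminorm (\<lambda>a. cnorm A (ev a))"
  by (simp add: cstar_seminorm_def ev_add ev_mult ev_scl ev_adj ev_closed norm_nonneg norm_triangle norm_scale norm_mult norm_cstar)

end
end

context bounded_relations begin

abbreviation "UA \<equiv> cstar_completion N"
abbreviation "const_cl a \<equiv> cauchy_class N (\<lambda>n. a)"

text \<open>Existence half of the universal property; uniqueness among continuous maps holds because the
  free *-algebra is dense (lemma \<open>approx\<close>).\<close>

theorem universal:
  assumes B: "cstar_algebra B" and f: "\<And>x. f x \<in> carrier B"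
    and rel: "\<And>r. r \<in> R \<Longrightarrow> eval_in B f r = \<zero>\<^bsub>B\<^esub>"
  shows "\<exists>\<phi>. star_hom UA B \<phi> \<and> (\<forall>x. \<phi> (const_cl (gen x)) = f x)"
proof -
  interpret B: cstar_algebra B by (rule B)
  interpret UA: cstar_algebra UA by (rule cstar_algebra_completion)
  let ?ev = "eval_in B f"
  have ev: "?ev a \<in> carrier B" "?ev (a + b) = ?ev a \<oplus>\<^bsub>B\<^esub> ?ev b" "?ev (a * b) = ?ev a \<otimes>\<^bsub>B\<^esub> ?ev b"
    "?ev (scl c a) = cscale B c (?ev a)" "?ev (adj a) = cadj B (?ev a)" "?ev 1 = \<one>\<^bsub>B\<^esub>" "?ev (gen x) = f x" for a b c x
    using f by (rule B.ev_closed B.ev_add B.ev_mult B.ev_scl B.ev_adj B.ev_one B.ev_gen)+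
  have ev_sn: "cstar_seminorm (\<lambda>a. cnorm B (?ev a))" using f by (rule B.ev_seminorm)
  have "(\<lambda>a. cnorm B (?ev a)) \<in> seminorms R"
    using ev_sn rel B.norm_eq_zero by (simp add: seminorms_def)
  from le_N[OF this] have le: "cnorm B (?ev a) \<le> N a" for a .
  have ev_diff: "?ev (a - b) = ?ev a \<ominus>\<^bsub>B\<^esub> ?ev b" for a b
  proof -
    have "?ev (a - b) \<oplus>\<^bsub>B\<^esub> ?ev b = ?ev a" using ev(2)[of "a - b" b] by simp
    then have "?ev a \<ominus>\<^bsub>B\<^esub> ?ev b = (?ev (a - b) \<oplus>\<^bsub>B\<^esub> ?ev b) \<ominus>\<^bsub>B\<^esub> ?ev b" by simp
    also have "\<dots> = ?ev (a - b)" using ev(1)[of b] ev(1)[of "a - b"] by (simp add: a_minus_def B.a_assoc B.r_neg)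
    finally show ?thesis by simp
  qed
  define conv where "conv x L \<longleftrightarrow> L \<in> carrier B \<and> (\<lambda>n. cnorm B (?ev (x n) \<ominus>\<^bsub>B\<^esub> L)) \<longlonglongrightarrow> 0" for x :: "nat \<Rightarrow> 'x free_star" and L
  have conv_ex: "\<exists>L. conv x L" if "CA x" for x
    unfolding conv_def
  proof -
    have "\<exists>M. \<forall>m\<ge>M. \<forall>n\<ge>M. cnorm B (?ev (x m) \<ominus>\<^bsub>B\<^esub> ?ev (x n)) < e" if "e > 0" for e
      using \<open>CA x\<close> that le unfolding cauchy_in_def ev_diff[symmetric] by (meson order_le_less_trans)
    then show "\<exists>L. L \<in> carrier B \<and> (\<lambda>n. cnorm B (?ev (x n) \<ominus>\<^bsub>B\<^esub> L)) \<longlonglongrightarrow> 0"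
      using B.norm_complete[of "\<lambda>n. ?ev (x n)"] ev(1) by blast
  qed
  have tri: "cnorm B (a \<ominus>\<^bsub>B\<^esub> c) \<le> cnorm B (b \<ominus>\<^bsub>B\<^esub> a) + cnorm B (b \<ominus>\<^bsub>B\<^esub> c)"
    if "a \<in> carrier B" "b \<in> carrier B" "c \<in> carrier B" for a b c
  proof -
    have "cscale B (-1) (b \<ominus>\<^bsub>B\<^esub> a) \<oplus>\<^bsub>B\<^esub> (b \<ominus>\<^bsub>B\<^esub> a) = \<zero>\<^bsub>B\<^esub>"
      using B.scale_add_left[of "b \<ominus>\<^bsub>B\<^esub> a" "-1" 1] that by (simp add: B.scale_one B.scale_zero)
    then have "cscale B (-1) (b \<ominus>\<^bsub>B\<^esub> a) = \<ominus>\<^bsub>B\<^esub> (b \<ominus>\<^bsub>B\<^esub> a)"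
      using that by (simp add: B.minus_equality B.scale_closed)
    also have "\<dots> = a \<ominus>\<^bsub>B\<^esub> b" using that by algebra
    finally have 1: "cnorm B (a \<ominus>\<^bsub>B\<^esub> b) = cnorm B (b \<ominus>\<^bsub>B\<^esub> a)"
      using B.norm_scale[of "b \<ominus>\<^bsub>B\<^esub> a" "-1"] that by simp
    have "a \<ominus>\<^bsub>B\<^esub> c = (a \<ominus>\<^bsub>B\<^esub> b) \<oplus>\<^bsub>B\<^esub> (b \<ominus>\<^bsub>B\<^esub> c)" using that by algebra
    then show ?thesis using B.norm_triangle[of "a \<ominus>\<^bsub>B\<^esub> b" "b \<ominus>\<^bsub>B\<^esub> c"] that 1 by simp
  qed
  have conv_unique: "L = L'" if "conv x L" "conv y L'" "eqv x y" for x y L L'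
  proof -
    have c: "L \<in> carrier B" "L' \<in> carrier B" using that by (auto simp: conv_def)
    have b: "cnorm B (L \<ominus>\<^bsub>B\<^esub> L') \<le> cnorm B (?ev (x n) \<ominus>\<^bsub>B\<^esub> L) + (N (y n - x n) + cnorm B (?ev (y n) \<ominus>\<^bsub>B\<^esub> L'))" for n
    proof -
      have "cnorm B (?ev (x n) \<ominus>\<^bsub>B\<^esub> L') \<le> cnorm B (?ev (y n) \<ominus>\<^bsub>B\<^esub> ?ev (x n)) + cnorm B (?ev (y n) \<ominus>\<^bsub>B\<^esub> L')"
        by (rule tri) (simp_all add: ev c)
      moreover have "cnorm B (L \<ominus>\<^bsub>B\<^esub> L') \<le> cnorm B (?ev (x n) \<ominus>\<^bsub>B\<^esub> L) + cnorm B (?ev (x n) \<ominus>\<^bsub>B\<^esub> L')"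
        by (rule tri) (simp_all add: ev c)
      ultimately show ?thesis using le[of "y n - x n"] by (simp add: ev_diff)
    qed
    have "(\<lambda>n. cnorm B (?ev (x n) \<ominus>\<^bsub>B\<^esub> L) + (N (y n - x n) + cnorm B (?ev (y n) \<ominus>\<^bsub>B\<^esub> L'))) \<longlonglongrightarrow> 0 + (0 + 0)"
      using that by (intro tendsto_add) (auto simp: conv_def eqv_def q_diff_commute)
    then have "cnorm B (L \<ominus>\<^bsub>B\<^esub> L') \<le> 0" using b by (intro LIMSEQ_le_const[where a = "cnorm B (L \<ominus>\<^bsub>B\<^esub> L')"]) auto
    then have "cnorm B (L \<ominus>\<^bsub>B\<^esub> L') = 0" using B.norm_nonneg[of "L \<ominus>\<^bsub>B\<^esub> L'"] c by simp
    then have "L \<ominus>\<^bsub>B\<^esub> L' = \<zero>\<^bsub>B\<^esub>" using c by (subst (asm) B.norm_eq_zero) auto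
    moreover have "L = (L \<ominus>\<^bsub>B\<^esub> L') \<oplus>\<^bsub>B\<^esub> L'" using c by algebra
    ultimately show "L = L'" using c by simp
  qed
  define \<phi> where "\<phi> X = (SOME L. conv (repr X) L)" for X
  have \<phi>: "\<phi> (cl x) = L" if "CA x" "conv x L" for x L
  proof -
    have "conv (repr (cl x)) (\<phi> (cl x))"
      unfolding \<phi>_def using conv_ex[OF repr_cl(1)[OF that(1)]] by (rule someI_ex)
    from conv_unique[OF that(2) this repr_cl(2)[OF that(1)]] show ?thesis by simp
  qed
  have lip: "conv (\<lambda>n. g (x n)) (h L)"
    if "conv x L" "\<And>a. ?ev (g a) = h (?ev a)" "\<And>b. b \<in> carrier B \<Longrightarrow> h b \<in> carrier B"
      "\<And>a b. a \<in> carrier B \<Longrightarrow> b \<in> carrier B \<Longrightarrow> cnorm B (h a \<ominus>\<^bsub>B\<^esub> h b) \<le> K * cnorm B (a \<ominus>\<^bsub>B\<^esub> b)" for x L g h K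
  proof -
    have "(\<lambda>n. K * cnorm B (?ev (x n) \<ominus>\<^bsub>B\<^esub> L)) \<longlonglongrightarrow> 0"
      using tendsto_mult_left[of "\<lambda>n. cnorm B (?ev (x n) \<ominus>\<^bsub>B\<^esub> L)" 0 sequentially K] that(1) by (simp add: conv_def)
    then have "(\<lambda>n. cnorm B (h (?ev (x n)) \<ominus>\<^bsub>B\<^esub> h L)) \<longlonglongrightarrow> 0"
      by (rule null_comparison[rotated]) (use that in \<open>simp add: conv_def ev B.norm_nonneg\<close>)
    then show ?thesis using that by (simp add: conv_def)
  qed
  have conv_const: "conv (\<lambda>n. a) (?ev a)" for a
  proof -
    have "?ev a \<ominus>\<^bsub>B\<^esub> ?ev a = \<zero>\<^bsub>B\<^esub>" using ev(1)[of a] by (simp add: a_minus_def B.r_neg)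
    moreover have "cnorm B \<zero>\<^bsub>B\<^esub> = 0" using B.norm_eq_zero[of "\<zero>\<^bsub>B\<^esub>"] by simp
    ultimately show ?thesis using ev(1)[of a] by (simp add: conv_def)
  qed
  have conv_add: "conv (\<lambda>n. x n + y n) (L \<oplus>\<^bsub>B\<^esub> M)" if "conv x L" "conv y M" for x y L M
  proof -
    have c: "L \<in> carrier B" "M \<in> carrier B" using that by (auto simp: conv_def)
    have "(\<lambda>n. cnorm B (?ev (x n) \<ominus>\<^bsub>B\<^esub> L) + cnorm B (?ev (y n) \<ominus>\<^bsub>B\<^esub> M)) \<longlonglongrightarrow> 0"
      using that by (intro tendsto_add_zero) (auto simp: conv_def)
    then have "(\<lambda>n. cnorm B (?ev (x n + y n) \<ominus>\<^bsub>B\<^esub> (L \<oplus>\<^bsub>B\<^esub> M))) \<longlonglongrightarrow> 0"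
    proof (rule null_comparison[rotated])
      fix n
      have ec: "?ev (x n) \<in> carrier B" "?ev (y n) \<in> carrier B" by (simp_all add: ev)
      have "?ev (x n + y n) \<ominus>\<^bsub>B\<^esub> (L \<oplus>\<^bsub>B\<^esub> M) = (?ev (x n) \<ominus>\<^bsub>B\<^esub> L) \<oplus>\<^bsub>B\<^esub> (?ev (y n) \<ominus>\<^bsub>B\<^esub> M)"
        unfolding ev(2) using c ec by algebra
      then show "norm (cnorm B (?ev (x n + y n) \<ominus>\<^bsub>B\<^esub> (L \<oplus>\<^bsub>B\<^esub> M))) \<le> cnorm B (?ev (x n) \<ominus>\<^bsub>B\<^esub> L) + cnorm B (?ev (y n) \<ominus>\<^bsub>B\<^esub> M)"
        using B.norm_triangle[of "?ev (x n) \<ominus>\<^bsub>B\<^esub> L" "?ev (y n) \<ominus>\<^bsub>B\<^esub> M"] c ec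
        by (simp add: B.norm_nonneg)
    qed
    then show ?thesis using c by (simp add: conv_def)
  qed
  have conv_mult: "conv (\<lambda>n. x n * y n) (L \<otimes>\<^bsub>B\<^esub> M)" if "conv x L" "conv y M" "CA y" for x y L M
  proof -
    have c: "L \<in> carrier B" "M \<in> carrier B" using that by (auto simp: conv_def)
    from CA_bounded[OF that(3)] obtain K where K: "\<And>n. N (y n) \<le> K" by blast
    have "(\<lambda>n. cnorm B (?ev (x n) \<ominus>\<^bsub>B\<^esub> L) * K + cnorm B L * cnorm B (?ev (y n) \<ominus>\<^bsub>B\<^esub> M)) \<longlonglongrightarrow> 0"
      using that by (intro tendsto_add_zero tendsto_mult_left_zero tendsto_mult_right_zero) (auto simp: conv_def)
    then have "(\<lambda>n. cnorm B (?ev (x n * y n) \<ominus>\<^bsub>B\<^esub> (L \<otimes>\<^bsub>B\<^esub> M))) \<longlonglongrightarrow> 0"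
    proof (rule null_comparison[rotated])
      fix n
      have ec: "?ev (x n) \<in> carrier B" "?ev (y n) \<in> carrier B" by (simp_all add: ev)
      have "?ev (x n * y n) \<ominus>\<^bsub>B\<^esub> (L \<otimes>\<^bsub>B\<^esub> M) = (?ev (x n) \<ominus>\<^bsub>B\<^esub> L) \<otimes>\<^bsub>B\<^esub> ?ev (y n) \<oplus>\<^bsub>B\<^esub> L \<otimes>\<^bsub>B\<^esub> (?ev (y n) \<ominus>\<^bsub>B\<^esub> M)"
        unfolding ev(3) using c ec by algebra
      moreover have "cnorm B ((?ev (x n) \<ominus>\<^bsub>B\<^esub> L) \<otimes>\<^bsub>B\<^esub> ?ev (y n) \<oplus>\<^bsub>B\<^esub> L \<otimes>\<^bsub>B\<^esub> (?ev (y n) \<ominus>\<^bsub>B\<^esub> M))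
         \<le> cnorm B ((?ev (x n) \<ominus>\<^bsub>B\<^esub> L) \<otimes>\<^bsub>B\<^esub> ?ev (y n)) + cnorm B (L \<otimes>\<^bsub>B\<^esub> (?ev (y n) \<ominus>\<^bsub>B\<^esub> M))"
        using c ec by (intro B.norm_triangle) simp_all
      moreover have "cnorm B ((?ev (x n) \<ominus>\<^bsub>B\<^esub> L) \<otimes>\<^bsub>B\<^esub> ?ev (y n)) \<le> cnorm B (?ev (x n) \<ominus>\<^bsub>B\<^esub> L) * K"
      proof (rule order_trans[OF B.norm_mult])
        show "cnorm B (?ev (x n) \<ominus>\<^bsub>B\<^esub> L) * cnorm B (?ev (y n)) \<le> cnorm B (?ev (x n) \<ominus>\<^bsub>B\<^esub> L) * K"
          by (rule mult_left_mono[OF order_trans[OF le K] B.norm_nonneg]) (use c ec in simp)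
      qed (use c ec in simp_all)
      moreover have "cnorm B (L \<otimes>\<^bsub>B\<^esub> (?ev (y n) \<ominus>\<^bsub>B\<^esub> M)) \<le> cnorm B L * cnorm B (?ev (y n) \<ominus>\<^bsub>B\<^esub> M)"
        using c ec by (intro B.norm_mult) simp_all
      moreover have "0 \<le> cnorm B (?ev (x n * y n) \<ominus>\<^bsub>B\<^esub> (L \<otimes>\<^bsub>B\<^esub> M))"
        by (rule B.norm_nonneg) (simp add: ev c)
      ultimately show "norm (cnorm B (?ev (x n * y n) \<ominus>\<^bsub>B\<^esub> (L \<otimes>\<^bsub>B\<^esub> M))) \<le> cnorm B (?ev (x n) \<ominus>\<^bsub>B\<^esub> L) * K + cnorm B L * cnorm B (?ev (y n) \<ominus>\<^bsub>B\<^esub> M)"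
        by simp
    qed
    then show ?thesis using c by (simp add: conv_def)
  qed
  have conv_scl: "conv (\<lambda>n. scl c (x n)) (cscale B c L)" if "conv x L" for x L c
  proof (rule lip[OF that])
    fix a b assume ab: "a \<in> carrier B" "b \<in> carrier B"
    have "cscale B c a = cscale B c (a \<ominus>\<^bsub>B\<^esub> b) \<oplus>\<^bsub>B\<^esub> cscale B c b"
    proof -
      have "a = (a \<ominus>\<^bsub>B\<^esub> b) \<oplus>\<^bsub>B\<^esub> b" using ab by algebra
      then show ?thesis using ab B.scale_add_right[of "a \<ominus>\<^bsub>B\<^esub> b" b c] by simp
    qed
    then have "cscale B c a \<ominus>\<^bsub>B\<^esub> cscale B c b = cscale B c (a \<ominus>\<^bsub>B\<^esub> b)"
      using ab by (simp add: a_minus_def B.a_assoc B.r_neg B.scale_closed)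
    then show "cnorm B (cscale B c a \<ominus>\<^bsub>B\<^esub> cscale B c b) \<le> cmod c * cnorm B (a \<ominus>\<^bsub>B\<^esub> b)"
      using ab by (simp add: B.norm_scale)
  qed (simp_all add: ev B.scale_closed)
  have norm_adj: "cnorm B (cadj B a) \<le> cnorm B a" if a: "a \<in> carrier B" for a
  proof (cases "cnorm B (cadj B a) = 0")
    case False
    have "cnorm B (cadj B a) * cnorm B (cadj B a) \<le> cnorm B a * cnorm B (cadj B a)"
      using B.norm_cstar[OF B.adj_closed[OF a]] B.norm_mult[OF a B.adj_closed[OF a]] a
      by (simp add: B.adj_adj power2_eq_square)
    then show ?thesis using False B.norm_nonneg[OF B.adj_closed[OF a]] by (simp add: mult_le_cancel_right)
  qed (use B.norm_nonneg[OF a] in simp)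
  have conv_adj: "conv (\<lambda>n. adj (x n)) (cadj B L)" if "conv x L" for x L
  proof (rule lip[OF that])
    fix a b assume ab: "a \<in> carrier B" "b \<in> carrier B"
    have "cadj B a = cadj B (a \<ominus>\<^bsub>B\<^esub> b) \<oplus>\<^bsub>B\<^esub> cadj B b"
    proof -
      have "a = (a \<ominus>\<^bsub>B\<^esub> b) \<oplus>\<^bsub>B\<^esub> b" using ab by algebra
      then show ?thesis using ab B.adj_add[of "a \<ominus>\<^bsub>B\<^esub> b" b] by simp
    qed
    then have "cadj B a \<ominus>\<^bsub>B\<^esub> cadj B b = cadj B (a \<ominus>\<^bsub>B\<^esub> b)"
      using ab by (simp add: a_minus_def B.a_assoc B.r_neg B.adj_closed)
    then show "cnorm B (cadj B a \<ominus>\<^bsub>B\<^esub> cadj B b) \<le> 1 * cnorm B (a \<ominus>\<^bsub>B\<^esub> b)"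
      using ab norm_adj[of "a \<ominus>\<^bsub>B\<^esub> b"] by simp
  qed (simp_all add: ev B.adj_closed)
  have rep: "\<exists>x L. CA x \<and> X = cl x \<and> conv x L \<and> \<phi> X = L" if "X \<in> carrier UA" for X
    using that conv_ex \<phi> unfolding carrier_A by metis
  have hom: "star_hom UA B \<phi>"
    unfolding star_hom_def
  proof (intro conjI ballI allI ring_hom_memI)
    fix X assume "X \<in> carrier UA"
    then obtain x L where x: "CA x" "X = cl x" "conv x L" "\<phi> X = L" using rep by blast
    show "\<phi> X \<in> carrier B" using x by (simp add: conv_def)
    show "\<phi> (cscale UA c X) = cscale B c (\<phi> X)" for c
      using \<phi>[OF CA_scl[OF x(1)] conv_scl[OF x(3)]] x by (simp add: scale_cl)
    show "\<phi> (cadj UA X) = cadj B (\<phi> X)"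
      using \<phi>[OF CA_adj[OF x(1)] conv_adj[OF x(3)]] x by (simp add: adj_cl)
    fix Y assume "Y \<in> carrier UA"
    then obtain y M where y: "CA y" "Y = cl y" "conv y M" "\<phi> Y = M" using rep by blast
    show "\<phi> (X \<oplus>\<^bsub>UA\<^esub> Y) = \<phi> X \<oplus>\<^bsub>B\<^esub> \<phi> Y"
      using \<phi>[OF CA_add[OF x(1) y(1)] conv_add[OF x(3) y(3)]] x y by (simp add: add_cl)
    show "\<phi> (X \<otimes>\<^bsub>UA\<^esub> Y) = \<phi> X \<otimes>\<^bsub>B\<^esub> \<phi> Y"
      using \<phi>[OF CA_mult[OF x(1) y(1)] conv_mult[OF x(3) y(3) y(1)]] x y by (simp add: mult_cl)
  next
    show "\<phi> \<one>\<^bsub>UA\<^esub> = \<one>\<^bsub>B\<^esub>" unfolding one_cl using \<phi>[OF CA_const conv_const] by (simp add: ev)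
  qed
  moreover have "\<phi> (const_cl (gen x)) = f x" for x using \<phi>[OF CA_const conv_const] by (simp add: ev)
  ultimately show ?thesis by blast
qed

end

lemma (in bounded_relations) gen_rel_zero: "r \<in> R \<Longrightarrow> const_cl r = \<zero>\<^bsub>UA\<^esub>"
  unfolding zero_cl using N_rel[of r] by (subst cl_eq) (auto simp: eqv_def)

lemma isometry_bound:
  assumes "q \<in> seminorms R" "adj v * v - 1 \<in> R" shows "q v \<le> 1"
proof -
  interpret seminormed q using assms by (simp add: seminorms_def seminormed_def)
  have "q 1 * q 1 = q 1" using q_star[of 1] by (simp add: adj_one power2_eq_square)
  then have "q 1 \<le> 1" by (cases "q 1 = 0") auto
  moreover have "q (adj v * v - 1) = 0" using assms by (simp add: seminorms_def)
  ultimately have "(q v)\<^sup>2 \<le> 1" using q_tri[of "adj v * v - 1" 1] q_star[of v] by simp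
  then show ?thesis using power2_le_imp_le[of "q v" 1] by simp
qed

lemma projection_bound:
  assumes "q \<in> seminorms R" "e * e - e \<in> R" "adj e - e \<in> R" shows "q e \<le> 1"
proof -
  interpret seminormed q using assms by (simp add: seminorms_def seminormed_def)
  have 0: "q (e * e - e) = 0" "q (adj e - e) = 0" using assms by (auto simp: seminorms_def)
  have "adj e * e = (adj e - e) * e + ((e * e - e) + e)" by (simp add: algebra_simps)
  then have "q (adj e * e) \<le> q ((adj e - e) * e) + (q (e * e - e) + q e)"
    using q_tri[of "(adj e - e) * e" "(e * e - e) + e"] q_tri[of "e * e - e" e] by simp
  then have "q e * q e \<le> q e" using q_mult[of "adj e - e" e] 0 by (simp add: q_star power2_eq_square)
  then show ?thesis using q_ge0[of e] by (cases "q e = 0") (auto simp: mult_le_cancel_right1)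
qed

lemma outside_bound:
  assumes "q \<in> seminorms (all_relations X R)" "x \<notin> X" shows "q (gen x) \<le> 1"
proof -
  have "gen x \<in> all_relations X R" using assms(2) by (simp add: all_relations_def)
  then show ?thesis using assms(1) by (simp add: seminorms_def)
qed

lemma cnp_bounded: "bounded_relations (all_relations (cnp_letters G P) (cnp_relations G P \<theta>))"
proof
  fix x :: "('a, 'b) cnp_letter"
  let ?R = "all_relations (cnp_letters G P) (cnp_relations G P \<theta>)"
  have "q (gen x) \<le> 1" if q: "q \<in> seminorms ?R" for q
  proof (cases "x \<in> cnp_letters G P")
    case True
    then have "adj (gen x) * gen x - 1 \<in> ?R"
      by (auto simp: cnp_letters_def all_relations_def cnp_relations_def rep_relations_def)
    then show ?thesis by (rule isometry_bound[OF q])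
  qed (rule outside_bound[OF q])
  then show "\<exists>K. \<forall>q\<in>seminorms ?R. q (gen x) \<le> K" by blast
qed

lemma sg_bounded: "bounded_relations (all_relations (sg_letters S) (sg_relations S))"
proof
  fix x :: "'a sg_letter"
  let ?R = "all_relations (sg_letters S) (sg_relations S)"
  have "q (gen x) \<le> 1" if q: "q \<in> seminorms ?R" for q
  proof (cases "x \<in> sg_letters S")
    case True
    then consider s where "s \<in> carrier S" "x = LetterV s" | X where "X \<in> cideals S" "x = LetterE X"
      by (auto simp: sg_letters_def)
    then show ?thesis
    proof cases
      case 1
      then have "adj (gen x) * gen x - 1 \<in> ?R" by (auto simp: all_relations_def sg_relations_def)
      then show ?thesis by (rule isometry_bound[OF q])
    next
      case 2
      then have "gen x * gen x - gen x \<in> ?R" "adj (gen x) - gen x \<in> ?R"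
        by (auto simp: all_relations_def sg_relations_def)
      then show ?thesis by (rule projection_bound[OF q])
    qed
  qed (rule outside_bound[OF q])
  then show "\<exists>K. \<forall>q\<in>seminorms ?R. q (gen x) \<le> K" by blast
qed

theorem cstar_algebra_ads: "cstar_algebra \<O>[G, P, \<theta>]"
proof -
  interpret bounded_relations "all_relations (cnp_letters G P) (cnp_relations G P \<theta>)" by (rule cnp_bounded)
  show ?thesis unfolding ads_cstar_def univ_cstar_def by (rule cstar_algebra_completion)
qed

theorem cstar_algebra_sg: "cstar_algebra C\<^sup>*(S)"
proof -
  interpret bounded_relations "all_relations (sg_letters S) (sg_relations S)" by (rule sg_bounded)
  show ?thesis unfolding sg_cstar_def univ_cstar_def by (rule cstar_algebra_completion)
qed

end

(* Put S = G x P (semidirect product). The elements w(g,p) = u_g s_p of O[G,P,theta] and their range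
   projections satisfy the relations of C*(S): CNP 2 is the rule for v_s^* v_t in a right LCM semigroup.
   A foundation set F yields finitely many cosets g theta_p(G) that cover G; by B. H. Neumann's lemma those
   of finite index already cover G, so with CNP 3 at a common multiple m of the p's of finite index the
   product of the 1 - e_sS over F vanishes. Hence there is Psi : C*(S) -> O[G,P,theta] which kills the
   boundary ideal J.

   Conversely u_g = v_(g,1) and s_p = v_(1,p) satisfy CNP 1 and CNP 2 in C*(S), and the CNP 3 relations are
   products over foundation sets, hence lie in J. The ideal J has an approximate unit of projections from
   the diagonal, so the distance to J is a C*-seminorm. By maximality of the norm of O[G,P,theta] it is
   dominated by the norm of Psi(x), which shows that the kernel of Psi is J and that Psi is onto. *)

theory Submission
  imports Defs
begin

section \<open>Cosets of infinite index and exponents\<close>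

text \<open>The two directions are not symmetric. CNP 3 is known in C*(S) only modulo J, so what
  runs backwards is not a homomorphism but the evaluation \<open>E\<close> of the free *-algebra in
  C*(S), and what descends to O is a seminorm: the distance of \<open>E a\<close> from J competes in
  the supremum defining the norm of O. As \<open>\<Psi>\<close> after \<open>E\<close> is the
  canonical map, the comparison holds on the dense range of \<open>E\<close>, hence everywhere.

  For a distance to an ideal the C*-identity is the one axiom that is not formal; it rests on J
  being self-adjoint and having an approximate unit. Projections suffice because J is generated by
  products of commuting projections, and conjugation by v_t or v_t^* keeps them in the commutative
  diagonal: a projection x in J standing before v_t is absorbed by v_t^* x v_t behind it. So the
  elements on which these projections act as a right approximate unit form a closed two-sided ideal.

  In O the projection e_X is attached to an ideal, not to a generator of it; two generators differ
  by an element of G, which acts as a unitary.\<close>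

lemma (in group) inv_cancel_left [simp]:
  assumes "x \<in> carrier G" "y \<in> carrier G"
  shows "inv x \<otimes> (x \<otimes> y) = y" "x \<otimes> (inv x \<otimes> y) = y"
  using assms by (simp_all flip: m_assoc)

text \<open>B. H. Neumann's lemma, by induction on the set of subgroups: some coset of \<open>H\<close> is not listed, hence
  lies in the listed cosets of the other subgroups, and then so do the listed cosets of \<open>H\<close>, which are its translates.\<close>

lemma (in group) exists_outside_infinite_index_cosets:
  assumes "finite \<H>" "\<And>H. H \<in> \<H> \<Longrightarrow> subgroup H G"
    and "\<And>H T. H \<in> \<H> \<Longrightarrow> finite T \<Longrightarrow> T \<subseteq> carrier G \<Longrightarrow> \<not> carrier G \<subseteq> (\<Union>t\<in>T. t <# H)"
    and "finite C" "C \<subseteq> carrier G \<times> \<H>"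
  shows "\<exists>x\<in>carrier G. \<forall>(g, H)\<in>C. x \<notin> g <# H"
  using assms
proof (induction \<H> arbitrary: C rule: finite_induct)
  case empty
  then show ?case by (auto intro: one_closed)
next
  case (insert H \<H>)
  interpret H: subgroup H G using insert.prems by simp
  let ?T = "{g. (g, H) \<in> C}"
  have "?T \<subseteq> fst ` C" by force
  then have T: "finite ?T" "?T \<subseteq> carrier G"
    using insert.prems(3,4) by (auto intro: finite_subset[OF _ finite_imageI])
  obtain x where x: "x \<in> carrier G" "\<And>t. t \<in> ?T \<Longrightarrow> x \<notin> t <# H"
    using insert.prems(2)[of H ?T] T by blast
  let ?C' = "C \<inter> carrier G \<times> \<H>"
  \<comment> \<open>The element x t^-1 y lies in g K exactly when y lies in t x^-1 g K. So if y is
    outside \<open>?D\<close>, then y and each candidate x t^-1 y avoid the listed cosets of the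
    other subgroups.\<close>
  let ?D = "?C' \<union> (\<lambda>(t, g, K). (t \<otimes> inv x \<otimes> g, K)) ` (?T \<times> ?C')"
  have "\<exists>y\<in>carrier G. \<forall>(g, K)\<in>?D. y \<notin> g <# K"
  proof (rule insert.IH)
    show "?D \<subseteq> carrier G \<times> \<H>" using x(1) T(2) by auto
    show "finite ?D" using T(1) insert.prems(3) by (intro finite_UnI finite_imageI finite_cartesian_product finite_Int) auto
  qed (use insert.prems(1,2) in blast)+
  then obtain y where y: "y \<in> carrier G" and "\<forall>(g, K)\<in>?D. y \<notin> g <# K" by blast
  then have notin: "y \<notin> g <# K" if "(g, K) \<in> ?D" for g K using that by blast
  have "\<exists>z\<in>carrier G. \<forall>(g, K)\<in>C. z \<notin> g <# K"
  proof (cases "\<exists>t\<in>?T. y \<in> t <# H")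
    case False
    have "y \<notin> g <# K" if "(g, K) \<in> C" for g K
      using that notin[of g K] False insert.prems(4) by (cases "K = H") auto
    then show ?thesis using y by blast
  next
    case True
    then obtain t h where t: "(t, H) \<in> C" "h \<in> H" "y = t \<otimes> h" "t \<in> carrier G"
      using T by (auto simp: l_coset_def)
    \<comment> \<open>Since y = t h, this translate of y is x h. It stays in the coset x H, which is
      not listed.\<close>
    let ?z = "x \<otimes> inv t \<otimes> y"
    have z: "?z = x \<otimes> h" using t(3,4) x(1) H.mem_carrier[OF t(2)] by (simp add: m_assoc)
    have "?z \<notin> g <# K" if gK: "(g, K) \<in> C" for g K
    proof (cases "K = H")
      case True
      have "x \<in> g <# H" if xh: "x \<otimes> h \<in> g <# H"
      proof -
        obtain h' where h': "h' \<in> H" "x \<otimes> h = g \<otimes> h'" using xh unfolding l_coset_def by blast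
        have "g \<in> carrier G" using gK insert.prems(4) by auto
        moreover have "h \<in> carrier G" "h' \<in> carrier G" using t(2) h'(1) by auto
        ultimately have "x \<otimes> h \<otimes> inv h = x" "g \<otimes> h' \<otimes> inv h = g \<otimes> (h' \<otimes> inv h)"
          using x(1) by (simp_all add: m_assoc)
        then have "x = g \<otimes> (h' \<otimes> inv h)" using h'(2) by simp
        moreover have "h' \<otimes> inv h \<in> H" using h'(1) t(2) by blast
        ultimately show ?thesis unfolding l_coset_def by blast
      qed
      then show ?thesis using x(2)[of g] gK True unfolding z by auto
    next
      case False
      then have KC: "(g, K) \<in> ?C'" using gK insert.prems(4) by auto
      then have "(t \<otimes> inv x \<otimes> g, K) \<in> ?D" using t(1) by (intro UnI2 image_eqI[of _ _ "(t, g, K)"]) auto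
      then have n: "y \<notin> (t \<otimes> inv x \<otimes> g) <# K" by (rule notin)
      have K: "K \<subseteq> carrier G" "g \<in> carrier G" using KC insert.prems(1)[of K] subgroup.subset by auto
      show ?thesis
      proof
        assume "?z \<in> g <# K"
        then obtain k where k: "k \<in> K" "?z = g \<otimes> k" unfolding l_coset_def by blast
        have "y = t \<otimes> inv x \<otimes> ?z" using t(4) x(1) y by (simp add: m_assoc)
        also have "\<dots> = t \<otimes> inv x \<otimes> g \<otimes> k"
          unfolding k(2) using k(1) K t(4) x(1) by (simp add: m_assoc subsetD)
        finally have "y = t \<otimes> inv x \<otimes> g \<otimes> k" .
        then show False using n k by (auto simp: l_coset_def)
      qed
    qed
    moreover have "?z \<in> carrier G" using t(4) x(1) y by simp
    ultimately show ?thesis by blast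
  qed
  then show ?case .
qed

text \<open>Exponent functions turn multiplication into pointwise addition of naturals. The last
  property holds because a function below an exponent function still has finite support inside B; it
  supplies minima and differences of exponents.\<close>

lemma (in comm_monoid) free_abelian_exponents:
  assumes "free_abelian_monoid_on G B"
  obtains x :: "'a \<Rightarrow> 'a \<Rightarrow> nat" where
    "\<And>p q. p \<in> carrier G \<Longrightarrow> q \<in> carrier G \<Longrightarrow> x (p \<otimes> q) = (\<lambda>b. x p b + x q b)"
    "inj_on x (carrier G)"
    "\<And>p e. p \<in> carrier G \<Longrightarrow> (\<And>b. e b \<le> x p b) \<Longrightarrow> \<exists>q\<in>carrier G. x q = e"
proof -
  let ?supp = "\<lambda>e :: 'a \<Rightarrow> nat. {b. e b \<noteq> 0}"
  let ?val = "\<lambda>e :: 'a \<Rightarrow> nat. \<Otimes>b\<in>?supp e. b [^] e b"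
  let ?ok = "\<lambda>e. finite (?supp e) \<and> ?supp e \<subseteq> B"
  have B: "B \<subseteq> carrier G" and ex1: "\<And>p. p \<in> carrier G \<Longrightarrow> \<exists>!e. ?ok e \<and> p = ?val e"
    using assms unfolding free_abelian_monoid_on_def conj_assoc by blast+
  define x where "x p = (THE e. ?ok e \<and> p = ?val e)" for p
  have x: "?ok (x p) \<and> p = ?val (x p)" if "p \<in> carrier G" for p
    unfolding x_def by (rule theI'[OF ex1[OF that]])
  have pow: "(\<lambda>b. b [^] e b) \<in> A \<rightarrow> carrier G" if "A \<subseteq> B" for A and e :: "'a \<Rightarrow> nat"
    using B that by auto
  have val: "?val e \<in> carrier G" if "?ok e" for e using that by (intro finprod_closed pow) simp
  have xval: "x (?val e) = e" if "?ok e" for e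
    using ex1[OF val[OF that]] x[OF val[OF that]] that by blast
  \<comment> \<open>Zero exponents contribute the unit, so products over different supports can be
    compared on one finite set.\<close>
  have val_eq: "?val e = (\<Otimes>b\<in>K. b [^] e b)" if "finite K" "K \<subseteq> B" "?supp e \<subseteq> K" for e K
    by (rule finprod_mono_neutral_cong_left) (use that pow[of K e] in auto)
  have "x (p \<otimes> q) = (\<lambda>b. x p b + x q b)" if "p \<in> carrier G" "q \<in> carrier G" for p q
  proof -
    let ?K = "?supp (x p) \<union> ?supp (x q)"
    have K: "finite ?K" "?K \<subseteq> B" using x[OF that(1)] x[OF that(2)] by auto
    have ok: "?ok (\<lambda>b. x p b + x q b)" using K by (auto intro: finite_subset[OF _ K(1)])
    have "?val (\<lambda>b. x p b + x q b) = (\<Otimes>b\<in>?K. b [^] (x p b + x q b))"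
      by (rule val_eq[OF K]) auto
    also have "\<dots> = (\<Otimes>b\<in>?K. b [^] x p b \<otimes> b [^] x q b)"
      by (rule finprod_cong') (use B K(2) in \<open>auto simp: nat_pow_mult\<close>)
    also have "\<dots> = (\<Otimes>b\<in>?K. b [^] x p b) \<otimes> (\<Otimes>b\<in>?K. b [^] x q b)"
      by (rule finprod_multf[OF pow[OF K(2)] pow[OF K(2)]])
    also have "(\<Otimes>b\<in>?K. b [^] x p b) = ?val (x p)" by (rule val_eq[OF K, symmetric]) auto
    also have "(\<Otimes>b\<in>?K. b [^] x q b) = ?val (x q)" by (rule val_eq[OF K, symmetric]) auto
    also have "?val (x p) = p" using x[OF that(1)] by simp
    also have "?val (x q) = q" using x[OF that(2)] by simp
    finally show ?thesis using xval[OF ok] by simp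
  qed
  moreover have "inj_on x (carrier G)" 
  proof (rule inj_onI)
    fix p q assume pq: "p \<in> carrier G" "q \<in> carrier G" "x p = x q"
    have "p = ?val (x p)" using x[OF pq(1)] by blast
    also have "\<dots> = q" unfolding pq(3) using x[OF pq(2)] by simp
    finally show "p = q" .
  qed
  moreover have "\<exists>q\<in>carrier G. x q = e" if "p \<in> carrier G" "\<And>b. e b \<le> x p b" for p e
  proof -
    have "?supp e \<subseteq> ?supp (x p)"
    proof
      fix b assume "b \<in> ?supp e"
      then show "b \<in> ?supp (x p)" using that(2)[of b] by auto
    qed
    then have "?ok e" using x[OF that(1)] finite_subset by blast
    then show ?thesis using xval val by blast
  qed
  ultimately show ?thesis by (rule that)
qed

section \<open>Divisibility in P, read off from exponents\<close>

context irreversible_system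
begin

text \<open>Divisibility comes from subtraction: the pointwise difference lies below the exponents
  of the multiple, so it is the exponent function of a cofactor.\<close>

lemma P_exponents:
  obtains x :: "'p \<Rightarrow> 'p \<Rightarrow> nat" where
    "\<And>p q b. p \<in> carrier P \<Longrightarrow> q \<in> carrier P \<Longrightarrow> x (p \<otimes>\<^bsub>P\<^esub> q) b = x p b + x q b"
    "\<And>p q. p \<in> carrier P \<Longrightarrow> q \<in> carrier P \<Longrightarrow> (\<And>b. x p b = x q b) \<Longrightarrow> p = q"
    "\<And>b. x \<one>\<^bsub>P\<^esub> b = 0"
    "\<And>p e. p \<in> carrier P \<Longrightarrow> (\<And>b. e b \<le> x p b) \<Longrightarrow> \<exists>q\<in>carrier P. \<forall>b. x q b = e b"
    "\<And>p q. p \<in> carrier P \<Longrightarrow> q \<in> carrier P \<Longrightarrow> (\<And>b. x p b \<le> x q b) \<Longrightarrow> p divides\<^bsub>P\<^esub> q"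
proof -
  obtain B where B: "free_abelian_monoid_on P B" using P_free by blast
  show ?thesis
  proof (rule P.free_abelian_exponents[OF B])
    fix x :: "'p \<Rightarrow> 'p \<Rightarrow> nat"
    assume x: "\<And>p q. p \<in> carrier P \<Longrightarrow> q \<in> carrier P \<Longrightarrow> x (p \<otimes>\<^bsub>P\<^esub> q) = (\<lambda>b. x p b + x q b)"
      "inj_on x (carrier P)" "\<And>p e. p \<in> carrier P \<Longrightarrow> (\<And>b. e b \<le> x p b) \<Longrightarrow> \<exists>q\<in>carrier P. x q = e"
    have "a divides\<^bsub>P\<^esub> b"
      if ab: "a \<in> carrier P" "b \<in> carrier P" "\<And>y. x a y \<le> x b y" for a b
    proof -
      obtain c where c: "c \<in> carrier P" "x c = (\<lambda>y. x b y - x a y)"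
        using x(3)[of b "\<lambda>y. x b y - x a y"] ab by auto
      then have "x b = x (a \<otimes>\<^bsub>P\<^esub> c)" using ab by (simp add: x(1))
      then show ?thesis using x(2) ab c by (auto dest: inj_onD simp: factor_def)
    qed
    moreover have "x \<one>\<^bsub>P\<^esub> b = 0" for b using x(1)[of "\<one>\<^bsub>P\<^esub>" "\<one>\<^bsub>P\<^esub>"] by (auto simp: fun_eq_iff)
    moreover have "p = q" if "p \<in> carrier P" "q \<in> carrier P" "\<And>b. x p b = x q b" for p q
      using x(2) that by (auto simp: fun_eq_iff inj_on_def)
    moreover have "\<exists>q\<in>carrier P. \<forall>b. x q b = e b" if "p \<in> carrier P" "\<And>b. e b \<le> x p b" for p e
      using x(3)[OF that] by auto
    ultimately show ?thesis by (intro that[of x]) (simp_all add: x(1))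
  qed
qed

lemma P_cancel:
  assumes "p \<otimes>\<^bsub>P\<^esub> q = p \<otimes>\<^bsub>P\<^esub> r" "p \<in> carrier P" "q \<in> carrier P" "r \<in> carrier P"
  shows "q = r"
proof (rule P_exponents)
  fix x :: "'p \<Rightarrow> 'p \<Rightarrow> nat"
  assume x: "\<And>p q b. p \<in> carrier P \<Longrightarrow> q \<in> carrier P \<Longrightarrow> x (p \<otimes>\<^bsub>P\<^esub> q) b = x p b + x q b"
    and eq: "\<And>p q. p \<in> carrier P \<Longrightarrow> q \<in> carrier P \<Longrightarrow> (\<And>b. x p b = x q b) \<Longrightarrow> p = q"
  have "x q b = x r b" for b using x[OF assms(2,3), of b] x[OF assms(2,4), of b] assms(1) by simp
  then show ?thesis using eq assms by blast
qed

lemma P_unit: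
  assumes "p \<otimes>\<^bsub>P\<^esub> q = \<one>\<^bsub>P\<^esub>" "p \<in> carrier P" "q \<in> carrier P"
  shows "p = \<one>\<^bsub>P\<^esub>"
proof (rule P_exponents)
  fix x :: "'p \<Rightarrow> 'p \<Rightarrow> nat"
  assume x: "\<And>p q b. p \<in> carrier P \<Longrightarrow> q \<in> carrier P \<Longrightarrow> x (p \<otimes>\<^bsub>P\<^esub> q) b = x p b + x q b"
    and eq: "\<And>p q. p \<in> carrier P \<Longrightarrow> q \<in> carrier P \<Longrightarrow> (\<And>b. x p b = x q b) \<Longrightarrow> p = q"
    and 1: "\<And>b. x \<one>\<^bsub>P\<^esub> b = 0"
  have "x p b = x \<one>\<^bsub>P\<^esub> b" for b using x[OF assms(2,3), of b] assms(1) 1 by simp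
  then show ?thesis using eq assms by blast
qed

lemma ex_gcd:
  assumes pq: "p \<in> carrier P" "q \<in> carrier P"
  obtains d p' q' where "d \<in> carrier P" "p' \<in> carrier P" "q' \<in> carrier P"
    "d gcdof\<^bsub>P\<^esub> p q" "p = d \<otimes>\<^bsub>P\<^esub> p'" "q = d \<otimes>\<^bsub>P\<^esub> q'"
proof -
  have "\<exists>d\<in>carrier P. d gcdof\<^bsub>P\<^esub> p q"
  proof (rule P_exponents)
    fix x :: "'p \<Rightarrow> 'p \<Rightarrow> nat"
    assume x: "\<And>p q b. p \<in> carrier P \<Longrightarrow> q \<in> carrier P \<Longrightarrow> x (p \<otimes>\<^bsub>P\<^esub> q) b = x p b + x q b"
      and down: "\<And>p e. p \<in> carrier P \<Longrightarrow> (\<And>b. e b \<le> x p b) \<Longrightarrow> \<exists>q\<in>carrier P. \<forall>b. x q b = e b"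
      and dvd: "\<And>p q. p \<in> carrier P \<Longrightarrow> q \<in> carrier P \<Longrightarrow> (\<And>b. x p b \<le> x q b) \<Longrightarrow> p divides\<^bsub>P\<^esub> q"
    \<comment> \<open>The pointwise minimum lies below the exponents of p, so it belongs to an
      element of P.\<close>
    obtain d where d: "d \<in> carrier P" "\<And>b. x d b = min (x p b) (x q b)"
      using down[OF pq(1), of "\<lambda>b. min (x p b) (x q b)"] by auto
    have "y divides\<^bsub>P\<^esub> d" if "y \<in> carrier P" "y divides\<^bsub>P\<^esub> p" "y divides\<^bsub>P\<^esub> q" for y
    proof (rule dvd[OF that(1) d(1)])
      show "x y b \<le> x d b" for b
        using that pq x[OF that(1)] unfolding d(2) factor_def by auto
    qed
    then show ?thesis using dvd[OF d(1) pq(1)] dvd[OF d(1) pq(2)] d unfolding isgcd_def by auto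
  qed
  then obtain d where d: "d \<in> carrier P" "d gcdof\<^bsub>P\<^esub> p q" by blast
  then obtain p' q' where "p' \<in> carrier P" "p = d \<otimes>\<^bsub>P\<^esub> p'" "q' \<in> carrier P" "q = d \<otimes>\<^bsub>P\<^esub> q'"
    unfolding isgcd_def factor_def by blast
  then show ?thesis using that d by blast
qed

text \<open>A common divisor y of the cofactors makes d y a common divisor, so d y divides d and y
  is trivial. Hence the exponents of p' and q' have disjoint supports, and the second claim is
  Euclid's lemma.\<close>

lemma gcd_cofactors:
  assumes d: "d \<in> carrier P" "p' \<in> carrier P" "q' \<in> carrier P"
    "d gcdof\<^bsub>P\<^esub> (d \<otimes>\<^bsub>P\<^esub> p') (d \<otimes>\<^bsub>P\<^esub> q')"
  shows "\<one>\<^bsub>P\<^esub> gcdof\<^bsub>P\<^esub> p' q'"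
    and "\<lbrakk>r \<in> carrier P; r' \<in> carrier P; p' \<otimes>\<^bsub>P\<^esub> r = q' \<otimes>\<^bsub>P\<^esub> r'\<rbrakk> \<Longrightarrow> q' divides\<^bsub>P\<^esub> r"
proof -
  have common: "y = \<one>\<^bsub>P\<^esub>" if y: "y \<in> carrier P" "y divides\<^bsub>P\<^esub> p'" "y divides\<^bsub>P\<^esub> q'" for y
  proof -
    have "(d \<otimes>\<^bsub>P\<^esub> y) divides\<^bsub>P\<^esub> (d \<otimes>\<^bsub>P\<^esub> p')" "(d \<otimes>\<^bsub>P\<^esub> y) divides\<^bsub>P\<^esub> (d \<otimes>\<^bsub>P\<^esub> q')"
      using y d by (auto simp: factor_def P.m_assoc)
    then have "(d \<otimes>\<^bsub>P\<^esub> y) divides\<^bsub>P\<^esub> d" using d y by (simp add: isgcd_def)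
    then obtain c where c: "c \<in> carrier P" "d = d \<otimes>\<^bsub>P\<^esub> y \<otimes>\<^bsub>P\<^esub> c" by (auto simp: factor_def)
    then have "d \<otimes>\<^bsub>P\<^esub> (y \<otimes>\<^bsub>P\<^esub> c) = d \<otimes>\<^bsub>P\<^esub> \<one>\<^bsub>P\<^esub>" using d y by (simp add: P.m_assoc)
    then have "y \<otimes>\<^bsub>P\<^esub> c = \<one>\<^bsub>P\<^esub>" by (rule P_cancel) (use d y c in simp_all)
    then show ?thesis by (rule P_unit) (use y c in simp_all)
  qed
  show "\<one>\<^bsub>P\<^esub> gcdof\<^bsub>P\<^esub> p' q'"
    unfolding isgcd_def
  proof (intro conjI ballI impI)
    fix y assume "y \<in> carrier P" "y divides\<^bsub>P\<^esub> p' \<and> y divides\<^bsub>P\<^esub> q'"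
    then have "y = \<one>\<^bsub>P\<^esub>" using common by blast
    then show "y divides\<^bsub>P\<^esub> \<one>\<^bsub>P\<^esub>" by (simp add: factor_def)
  qed (use d in \<open>auto simp: factor_def\<close>)
  assume r: "r \<in> carrier P" "r' \<in> carrier P" "p' \<otimes>\<^bsub>P\<^esub> r = q' \<otimes>\<^bsub>P\<^esub> r'"
  show "q' divides\<^bsub>P\<^esub> r"
  proof (rule P_exponents)
    fix x :: "'p \<Rightarrow> 'p \<Rightarrow> nat"
    assume x: "\<And>p q b. p \<in> carrier P \<Longrightarrow> q \<in> carrier P \<Longrightarrow> x (p \<otimes>\<^bsub>P\<^esub> q) b = x p b + x q b"
      and 1: "\<And>b. x \<one>\<^bsub>P\<^esub> b = 0"
      and down: "\<And>p e. p \<in> carrier P \<Longrightarrow> (\<And>b. e b \<le> x p b) \<Longrightarrow> \<exists>q\<in>carrier P. \<forall>b. x q b = e b"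
      and dvd: "\<And>p q. p \<in> carrier P \<Longrightarrow> q \<in> carrier P \<Longrightarrow> (\<And>b. x p b \<le> x q b) \<Longrightarrow> p divides\<^bsub>P\<^esub> q"
    \<comment> \<open>The element with the minimal exponents is a common divisor, hence trivial: at
      every b one of the two exponents vanishes.\<close>
    obtain y where y: "y \<in> carrier P" "\<And>b. x y b = min (x p' b) (x q' b)"
      using down[OF d(2), of "\<lambda>b. min (x p' b) (x q' b)"] by auto
    have "y = \<one>\<^bsub>P\<^esub>" by (rule common) (use y d in \<open>auto intro: dvd\<close>)
    then have min0: "min (x p' b) (x q' b) = 0" for b using y(2)[of b] 1 by simp
    have "x q' b \<le> x r b" for b
    proof -
      have "x p' b + x r b = x q' b + x r' b"
        using x[OF d(2) r(1), of b] x[OF d(3) r(2), of b] r(3) by simp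
      then show ?thesis using min0[of b] by (auto simp: min_def split: if_splits)
    qed
    then show ?thesis using dvd d r by blast
  qed
qed

end

section \<open>The semigroup of an irreversible system\<close>

lemma (in group) l_coset_image: "x <# (f ` A) = (\<lambda>a. x \<otimes> f a) ` A"
  by (auto simp: l_coset_def)

context irreversible_system
begin

abbreviation "S \<equiv> semidirect G P \<theta>"

lemma \<theta>_group_hom: "p \<in> carrier P \<Longrightarrow> group_hom G G (\<theta> p)"
  by (simp add: group_hom_def group_hom_axioms_def G.is_group \<theta>_hom)

lemma \<theta>_simps [simp]:
  assumes "p \<in> carrier P"
  shows "g \<in> carrier G \<Longrightarrow> \<theta> p g \<in> carrier G"
    and "\<theta> p \<one>\<^bsub>G\<^esub> = \<one>\<^bsub>G\<^esub>"
    and "g \<in> carrier G \<Longrightarrow> h \<in> carrier G \<Longrightarrow> \<theta> p (g \<otimes>\<^bsub>G\<^esub> h) = \<theta> p g \<otimes>\<^bsub>G\<^esub> \<theta> p h"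
    and "g \<in> carrier G \<Longrightarrow> \<theta> p (inv\<^bsub>G\<^esub> g) = inv\<^bsub>G\<^esub> (\<theta> p g)"
proof -
  interpret group_hom G G "\<theta> p" by (rule \<theta>_group_hom[OF assms])
  show "g \<in> carrier G \<Longrightarrow> \<theta> p g \<in> carrier G" "\<theta> p \<one>\<^bsub>G\<^esub> = \<one>\<^bsub>G\<^esub>"
    "g \<in> carrier G \<Longrightarrow> h \<in> carrier G \<Longrightarrow> \<theta> p (g \<otimes>\<^bsub>G\<^esub> h) = \<theta> p g \<otimes>\<^bsub>G\<^esub> \<theta> p h"
    "g \<in> carrier G \<Longrightarrow> \<theta> p (inv\<^bsub>G\<^esub> g) = inv\<^bsub>G\<^esub> (\<theta> p g)"
    by simp_all
qed

lemma S_simps [simp]: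
  "carrier S = carrier G \<times> carrier P"
  "(g, p) \<otimes>\<^bsub>S\<^esub> (h, q) = (g \<otimes>\<^bsub>G\<^esub> \<theta> p h, p \<otimes>\<^bsub>P\<^esub> q)"
  "\<one>\<^bsub>S\<^esub> = (\<one>\<^bsub>G\<^esub>, \<one>\<^bsub>P\<^esub>)"
  by (simp_all add: semidirect_def)

lemma S_monoid: "monoid S"
  by (rule monoidI) (auto simp: \<theta>_one \<theta>_mult G.m_assoc P.m_assoc)

lemma mem_pideal:
  "x \<in> pideal S (g, p) \<longleftrightarrow> (\<exists>h\<in>carrier G. \<exists>r\<in>carrier P. x = (g \<otimes>\<^bsub>G\<^esub> \<theta> p h, p \<otimes>\<^bsub>P\<^esub> r))"
  by (auto simp: pideal_def l_coset_def)

lemma pideal_self: "s \<in> carrier S \<Longrightarrow> s \<in> pideal S s"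
  by (cases s) (auto simp: mem_pideal intro!: bexI[of _ "\<one>\<^bsub>G\<^esub>"] bexI[of _ "\<one>\<^bsub>P\<^esub>"])

lemma pideal_one: "pideal S \<one>\<^bsub>S\<^esub> = carrier S"
proof -
  interpret S: monoid S by (rule S_monoid)
  show ?thesis unfolding pideal_def l_coset_def by (auto simp: \<theta>_one)
qed

lemma l_coset_pideal:
  assumes "s \<in> carrier S" "t \<in> carrier S"
  shows "s <#\<^bsub>S\<^esub> pideal S t = pideal S (s \<otimes>\<^bsub>S\<^esub> t)"
proof -
  interpret S: monoid S by (rule S_monoid)
  show ?thesis unfolding pideal_def l_coset_def using assms by (auto simp: S.m_assoc simp del: S_simps)
qed

text \<open>A common element gives g theta_p(k) = h theta_q(l). Moving both translations to one side
  yields the factorization of g^-1 h that the zero case of CNP 2 excludes.\<close>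

lemma pideal_Int_disjoint:
  assumes "g \<in> carrier G" "h \<in> carrier G" "p \<in> carrier P" "q \<in> carrier P"
    and "\<not> (\<exists>k\<in>carrier G. \<exists>l\<in>carrier G. inv\<^bsub>G\<^esub> g \<otimes>\<^bsub>G\<^esub> h = \<theta> p k \<otimes>\<^bsub>G\<^esub> \<theta> q l)"
  shows "pideal S (g, p) \<inter> pideal S (h, q) = {}"
proof (rule ccontr)
  assume "pideal S (g, p) \<inter> pideal S (h, q) \<noteq> {}"
  then obtain k l where kl: "k \<in> carrier G" "l \<in> carrier G" "g \<otimes>\<^bsub>G\<^esub> \<theta> p k = h \<otimes>\<^bsub>G\<^esub> \<theta> q l"
    by (auto simp: mem_pideal)
  have "inv\<^bsub>G\<^esub> g \<otimes>\<^bsub>G\<^esub> (g \<otimes>\<^bsub>G\<^esub> \<theta> p k) \<otimes>\<^bsub>G\<^esub> inv\<^bsub>G\<^esub> (\<theta> q l) = inv\<^bsub>G\<^esub> g \<otimes>\<^bsub>G\<^esub> h"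
    unfolding kl(3) using assms kl by (simp add: G.m_assoc)
  moreover have "inv\<^bsub>G\<^esub> g \<otimes>\<^bsub>G\<^esub> (g \<otimes>\<^bsub>G\<^esub> \<theta> p k) = \<theta> p k" using assms(1,3) kl(1) by simp
  ultimately have "inv\<^bsub>G\<^esub> g \<otimes>\<^bsub>G\<^esub> h = \<theta> p k \<otimes>\<^bsub>G\<^esub> \<theta> q (inv\<^bsub>G\<^esub> l)" using assms(4) kl(2) by simp
  then show False using assms(5) kl by blast
qed

text \<open>Independence is available for relatively prime pairs. The common factor
  \<open>\<theta> d\<close> is injective, hence commutes with intersections, which reduces the claim
  to the cofactors.\<close>

lemma \<theta>_image_Int:
  assumes d: "d \<in> carrier P" "p' \<in> carrier P" "q' \<in> carrier P"
    "d gcdof\<^bsub>P\<^esub> (d \<otimes>\<^bsub>P\<^esub> p') (d \<otimes>\<^bsub>P\<^esub> q')"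
  shows "\<theta> (d \<otimes>\<^bsub>P\<^esub> p') ` carrier G \<inter> \<theta> (d \<otimes>\<^bsub>P\<^esub> q') ` carrier G = \<theta> (d \<otimes>\<^bsub>P\<^esub> p' \<otimes>\<^bsub>P\<^esub> q') ` carrier G"
proof -
  have im: "\<theta> (d \<otimes>\<^bsub>P\<^esub> r) ` carrier G = \<theta> d ` \<theta> r ` carrier G" if "r \<in> carrier P" for r
    using that d by (auto simp: \<theta>_mult image_image)
  have "\<theta> d ` \<theta> p' ` carrier G \<inter> \<theta> d ` \<theta> q' ` carrier G = \<theta> d ` (\<theta> p' ` carrier G \<inter> \<theta> q' ` carrier G)"
    by (rule inj_on_image_Int[OF \<theta>_inj[OF d(1)], symmetric]) (use d in auto)
  also have "\<theta> p' ` carrier G \<inter> \<theta> q' ` carrier G = \<theta> (p' \<otimes>\<^bsub>P\<^esub> q') ` carrier G"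
    using independent_iff gcd_cofactors(1)[OF d] d by blast
  finally show ?thesis using d by (simp add: im P.m_assoc)
qed

text \<open>The right LCM has P-component lcm(p, q) = d p' q', and the factorization provides the
  common G-component g theta_p(k) = h theta_q(l^-1). The witnesses (k, q') and (l^-1, p') are those
  on the right side of CNP 2, so the rule for v_s^* v_t becomes that relation.\<close>

lemma pideal_Int:
  assumes G: "g \<in> carrier G" "h \<in> carrier G" "k \<in> carrier G" "l \<in> carrier G"
    and P: "d \<in> carrier P" "p' \<in> carrier P" "q' \<in> carrier P"
    and pq: "p = d \<otimes>\<^bsub>P\<^esub> p'" "q = d \<otimes>\<^bsub>P\<^esub> q'" and gcd: "d gcdof\<^bsub>P\<^esub> p q"
    and kl: "inv\<^bsub>G\<^esub> g \<otimes>\<^bsub>G\<^esub> h = \<theta> p k \<otimes>\<^bsub>G\<^esub> \<theta> q l"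
  shows "(h, q) \<otimes>\<^bsub>S\<^esub> (inv\<^bsub>G\<^esub> l, p') = (g, p) \<otimes>\<^bsub>S\<^esub> (k, q')" (is ?eq)
    and "pideal S (g, p) \<inter> pideal S (h, q) = pideal S ((g, p) \<otimes>\<^bsub>S\<^esub> (k, q'))" (is ?int)
proof -
  interpret S: monoid S by (rule S_monoid)
  have h: "h = g \<otimes>\<^bsub>G\<^esub> \<theta> p k \<otimes>\<^bsub>G\<^esub> \<theta> q l"
  proof -
    have "h = g \<otimes>\<^bsub>G\<^esub> (inv\<^bsub>G\<^esub> g \<otimes>\<^bsub>G\<^esub> h)" using G by simp
    then show ?thesis unfolding kl using G P pq by (simp add: G.m_assoc)
  qed
  have pc: "p \<in> carrier P" "q \<in> carrier P" using P pq by simp_all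
  show eq: ?eq
    unfolding h using G P pc pq by (simp add: G.m_assoc P.m_ac)
  show ?int
  proof
    have sub: "pideal S (s \<otimes>\<^bsub>S\<^esub> a) \<subseteq> pideal S s" if "s \<in> carrier S" "a \<in> carrier S" for s a
      unfolding l_coset_pideal[OF that, symmetric] pideal_def
      using that by (fastforce simp: l_coset_def S.m_assoc simp del: S_simps)
    show "pideal S ((g, p) \<otimes>\<^bsub>S\<^esub> (k, q')) \<subseteq> pideal S (g, p) \<inter> pideal S (h, q)"
      using sub[of "(g, p)" "(k, q')"] sub[of "(h, q)" "(inv\<^bsub>G\<^esub> l, p')"] eq G P pc by simp
  next
    show "pideal S (g, p) \<inter> pideal S (h, q) \<subseteq> pideal S ((g, p) \<otimes>\<^bsub>S\<^esub> (k, q'))"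
    proof
      fix x assume "x \<in> pideal S (g, p) \<inter> pideal S (h, q)"
      then obtain a b r r' where x: "a \<in> carrier G" "b \<in> carrier G" "r \<in> carrier P" "r' \<in> carrier P"
        "x = (g \<otimes>\<^bsub>G\<^esub> \<theta> p a, p \<otimes>\<^bsub>P\<^esub> r)" "x = (h \<otimes>\<^bsub>G\<^esub> \<theta> q b, q \<otimes>\<^bsub>P\<^esub> r')"
        by (auto simp: mem_pideal)
      have "d \<otimes>\<^bsub>P\<^esub> (p' \<otimes>\<^bsub>P\<^esub> r) = d \<otimes>\<^bsub>P\<^esub> (q' \<otimes>\<^bsub>P\<^esub> r')"
        using x P pq by (simp flip: P.m_assoc)
      then have "p' \<otimes>\<^bsub>P\<^esub> r = q' \<otimes>\<^bsub>P\<^esub> r'" by (rule P_cancel) (use x P in simp_all)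
      then have "q' divides\<^bsub>P\<^esub> r" by (rule gcd_cofactors(2)[OF P gcd[unfolded pq] x(3,4)])
      then obtain n where n: "n \<in> carrier P" "r = q' \<otimes>\<^bsub>P\<^esub> n" by (auto simp: factor_def)
      have "g \<otimes>\<^bsub>G\<^esub> \<theta> p a = g \<otimes>\<^bsub>G\<^esub> (\<theta> p k \<otimes>\<^bsub>G\<^esub> \<theta> q l \<otimes>\<^bsub>G\<^esub> \<theta> q b)"
        using x(5,6) G P pc x(1,2) unfolding h by (simp add: G.m_assoc)
      then have a: "\<theta> p a = \<theta> p k \<otimes>\<^bsub>G\<^esub> \<theta> q l \<otimes>\<^bsub>G\<^esub> \<theta> q b" using G pc x(1,2) by simp
      \<comment> \<open>This element lies in both images, so by independence it is theta_(p q')(c).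
        The coordinate theta_p(a) therefore differs from theta_p(k) by theta_(p q')(c), which is
        membership in the ideal of the LCM.\<close>
      have "\<theta> p (inv\<^bsub>G\<^esub> k \<otimes>\<^bsub>G\<^esub> a) = \<theta> q (l \<otimes>\<^bsub>G\<^esub> b)" using G pc x(1,2) by (simp add: a G.m_assoc)
      moreover have "\<theta> p (inv\<^bsub>G\<^esub> k \<otimes>\<^bsub>G\<^esub> a) \<in> \<theta> p ` carrier G" "\<theta> q (l \<otimes>\<^bsub>G\<^esub> b) \<in> \<theta> q ` carrier G"
        using G x(1,2) by (auto simp del: \<theta>_simps)
      ultimately have "\<theta> p (inv\<^bsub>G\<^esub> k \<otimes>\<^bsub>G\<^esub> a) \<in> \<theta> p ` carrier G \<inter> \<theta> q ` carrier G" by simp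
      also have "\<dots> = \<theta> (p \<otimes>\<^bsub>P\<^esub> q') ` carrier G"
        using \<theta>_image_Int[OF P gcd[unfolded pq]] by (simp add: pq)
      finally obtain c where c: "c \<in> carrier G" "\<theta> p (inv\<^bsub>G\<^esub> k \<otimes>\<^bsub>G\<^esub> a) = \<theta> (p \<otimes>\<^bsub>P\<^esub> q') c" by blast
      have "\<theta> p a = \<theta> p k \<otimes>\<^bsub>G\<^esub> \<theta> p (inv\<^bsub>G\<^esub> k \<otimes>\<^bsub>G\<^esub> a)" using G pc x(1) by simp
      then have "x = (g \<otimes>\<^bsub>G\<^esub> \<theta> p k \<otimes>\<^bsub>G\<^esub> \<theta> (p \<otimes>\<^bsub>P\<^esub> q') c, p \<otimes>\<^bsub>P\<^esub> q' \<otimes>\<^bsub>P\<^esub> n)"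
        unfolding x(5) c(2) n(2) using G P pc c(1) n(1) by (simp add: G.m_assoc P.m_assoc)
      then show "x \<in> pideal S ((g, p) \<otimes>\<^bsub>S\<^esub> (k, q'))" unfolding S_simps mem_pideal using c(1) n(1) by blast
    qed
  qed
qed

lemma S_right_lcm:
  assumes "s \<in> carrier S" "t \<in> carrier S" "pideal S s \<inter> pideal S t \<noteq> {}"
  obtains a b where "a \<in> carrier S" "b \<in> carrier S" "s \<otimes>\<^bsub>S\<^esub> a = t \<otimes>\<^bsub>S\<^esub> b"
    "pideal S s \<inter> pideal S t = pideal S (s \<otimes>\<^bsub>S\<^esub> a)"
proof -
  obtain g p h q where st: "s = (g, p)" "t = (h, q)" by (cases s, cases t) 
  then have c: "g \<in> carrier G" "h \<in> carrier G" "p \<in> carrier P" "q \<in> carrier P" using assms by auto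
  obtain k l where kl: "k \<in> carrier G" "l \<in> carrier G" "inv\<^bsub>G\<^esub> g \<otimes>\<^bsub>G\<^esub> h = \<theta> p k \<otimes>\<^bsub>G\<^esub> \<theta> q l"
    using pideal_Int_disjoint[OF c] assms(3) unfolding st by blast
  obtain d p' q' where d: "d \<in> carrier P" "p' \<in> carrier P" "q' \<in> carrier P"
    "d gcdof\<^bsub>P\<^esub> p q" "p = d \<otimes>\<^bsub>P\<^esub> p'" "q = d \<otimes>\<^bsub>P\<^esub> q'"
    using c(3,4) by (rule ex_gcd)
  note meet = pideal_Int[OF c(1,2) kl(1,2) d(1-3) d(5,6,4) kl(3)]
  show ?thesis
    by (rule that[of "(k, q')" "(inv\<^bsub>G\<^esub> l, p')"]) (use meet kl d in \<open>simp_all add: st del: S_simps(2)\<close>)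
qed

text \<open>Mutual divisibility makes the P-components differ by a unit of P, and P has only the
  trivial one. So a principal ideal fixes p, and fixes g up to right multiplication by
  theta_p(G).\<close>

lemma pideal_eqD:
  assumes eq: "pideal S (g, p) = pideal S (h, q)"
    and c: "g \<in> carrier G" "h \<in> carrier G" "p \<in> carrier P" "q \<in> carrier P"
  shows "p = q" "\<exists>k\<in>carrier G. h = g \<otimes>\<^bsub>G\<^esub> \<theta> p k"
proof -
  have "(g, p) \<in> pideal S (h, q)" "(h, q) \<in> pideal S (g, p)"
    using pideal_self[of "(g, p)"] pideal_self[of "(h, q)"] eq c by simp_all
  then obtain k r r' where k: "k \<in> carrier G" "h = g \<otimes>\<^bsub>G\<^esub> \<theta> p k"
    and r: "r \<in> carrier P" "r' \<in> carrier P" "p = q \<otimes>\<^bsub>P\<^esub> r" "q = p \<otimes>\<^bsub>P\<^esub> r'"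
    unfolding mem_pideal by blast
  have "p \<otimes>\<^bsub>P\<^esub> (r' \<otimes>\<^bsub>P\<^esub> r) = p \<otimes>\<^bsub>P\<^esub> \<one>\<^bsub>P\<^esub>"
    using r(1,2) c by (simp flip: P.m_assoc r(3,4))
  then have "r' \<otimes>\<^bsub>P\<^esub> r = \<one>\<^bsub>P\<^esub>" by (rule P_cancel) (use r c in simp_all)
  then have "r' = \<one>\<^bsub>P\<^esub>" using r(2,1) by (rule P_unit)
  then show "p = q" using r(4) c by simp
  show "\<exists>k\<in>carrier G. h = g \<otimes>\<^bsub>G\<^esub> \<theta> p k" using k by blast
qed

text \<open>Phrased through covering translates because its negation is then literally the
  hypothesis of \<open>exists_outside_infinite_index_cosets\<close>.\<close>

definition finite_index :: "'p \<Rightarrow> bool" where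
  "finite_index p \<longleftrightarrow> (\<exists>T. finite T \<and> T \<subseteq> carrier G \<and> carrier G \<subseteq> (\<Union>t\<in>T. t <#\<^bsub>G\<^esub> (\<theta> p ` carrier G)))"

lemma finite_index_one: "finite_index \<one>\<^bsub>P\<^esub>"
  unfolding finite_index_def
  by (rule exI[of _ "{\<one>\<^bsub>G\<^esub>}"]) (auto simp: l_coset_def \<theta>_one)

text \<open>Representatives multiply: the products t theta_p(t') cover G by cosets of
  theta_p(theta_q(G)).\<close>

lemma finite_index_mult:
  assumes "finite_index p" "finite_index q" and c: "p \<in> carrier P" "q \<in> carrier P"
  shows "finite_index (p \<otimes>\<^bsub>P\<^esub> q)"
proof -
  obtain T T' where T: "finite T" "T \<subseteq> carrier G" "carrier G \<subseteq> (\<Union>t\<in>T. t <#\<^bsub>G\<^esub> (\<theta> p ` carrier G))"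
    and T': "finite T'" "T' \<subseteq> carrier G" "carrier G \<subseteq> (\<Union>t\<in>T'. t <#\<^bsub>G\<^esub> (\<theta> q ` carrier G))"
    using assms unfolding finite_index_def by blast
  let ?U = "(\<lambda>(t, t'). t \<otimes>\<^bsub>G\<^esub> \<theta> p t') ` (T \<times> T')"
  show ?thesis
    unfolding finite_index_def
  proof (intro exI[of _ ?U] conjI subsetI)
    show "finite ?U" using T T' by simp
    show "x \<in> carrier G" if "x \<in> ?U" for x using that subsetD[OF T(2)] subsetD[OF T'(2)] c by auto
    fix g assume "g \<in> carrier G"
    then obtain t x where t: "t \<in> T" "x \<in> carrier G" "g = t \<otimes>\<^bsub>G\<^esub> \<theta> p x"
      using T(3) by (auto simp: G.l_coset_image)
    then obtain t' y where t': "t' \<in> T'" "y \<in> carrier G" "x = t' \<otimes>\<^bsub>G\<^esub> \<theta> q y"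
      using T'(3) by (auto simp: G.l_coset_image)
    have tc: "t \<in> carrier G" "t' \<in> carrier G" using t(1) t'(1) T(2) T'(2) by auto
    have "g = (t \<otimes>\<^bsub>G\<^esub> \<theta> p t') \<otimes>\<^bsub>G\<^esub> \<theta> (p \<otimes>\<^bsub>P\<^esub> q) y"
      using t t' tc c by (simp add: \<theta>_mult G.m_assoc)
    then show "g \<in> (\<Union>t\<in>?U. t <#\<^bsub>G\<^esub> (\<theta> (p \<otimes>\<^bsub>P\<^esub> q) ` carrier G))"
      using t(1) t' by (auto simp: G.l_coset_image)
  qed
qed

lemma finite_index_lcosets:
  assumes "finite_index p" "p \<in> carrier P"
  shows "finite (lcosets\<^bsub>G\<^esub> (\<theta> p ` carrier G))"
proof -
  interpret group_hom G G "\<theta> p" by (rule \<theta>_group_hom[OF assms(2)])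
  have H: "subgroup (\<theta> p ` carrier G) G" by (rule img_is_subgroup)
  obtain T where T: "finite T" "T \<subseteq> carrier G" "carrier G \<subseteq> (\<Union>t\<in>T. t <#\<^bsub>G\<^esub> (\<theta> p ` carrier G))"
    using assms unfolding finite_index_def by blast
  have "lcosets\<^bsub>G\<^esub> (\<theta> p ` carrier G) \<subseteq> (\<lambda>t. t <#\<^bsub>G\<^esub> (\<theta> p ` carrier G)) ` T"
  proof
    fix X assume "X \<in> lcosets\<^bsub>G\<^esub> (\<theta> p ` carrier G)"
    then obtain g where g: "g \<in> carrier G" "X = g <#\<^bsub>G\<^esub> (\<theta> p ` carrier G)" by (auto simp: LCOSETS_def)
    then obtain t where t: "t \<in> T" "g \<in> t <#\<^bsub>G\<^esub> (\<theta> p ` carrier G)" using T(3) by blast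
    then have "t <#\<^bsub>G\<^esub> (\<theta> p ` carrier G) = X" unfolding g(2)
      using G.l_repr_independence[OF t(2) _ H] T(2) by blast
    then show "X \<in> (\<lambda>t. t <#\<^bsub>G\<^esub> (\<theta> p ` carrier G)) ` T" using t(1) by blast
  qed
  then show ?thesis using T(1) finite_surj by blast
qed

text \<open>The product of the members works, since finite index passes to products. Applied to all
  components of a foundation set it gives the level at which the set is tested; applied to those of
  finite index it gives m.\<close>

lemma common_multiple:
  assumes "finite A" "A \<subseteq> carrier P"
  shows "\<exists>r\<in>carrier P. (\<forall>p\<in>A. p divides\<^bsub>P\<^esub> r) \<and> ((\<forall>p\<in>A. finite_index p) \<longrightarrow> finite_index r)"
  using assms
proof (induction A rule: finite_induct)
  case empty
  then show ?case using finite_index_one by auto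
next
  case (insert p A)
  then obtain r where r: "r \<in> carrier P" "\<forall>p\<in>A. p divides\<^bsub>P\<^esub> r" "(\<forall>p\<in>A. finite_index p) \<longrightarrow> finite_index r"
    by auto
  have p: "p \<in> carrier P" using insert by simp
  have "q divides\<^bsub>P\<^esub> (p \<otimes>\<^bsub>P\<^esub> r)" if "q \<in> insert p A" for q
  proof (cases "q = p")
    case False
    then obtain c where "c \<in> carrier P" "r = q \<otimes>\<^bsub>P\<^esub> c"
      using \<open>q \<in> insert p A\<close> r(2) unfolding factor_def by blast
    moreover have "q \<in> carrier P" using that insert by auto
    ultimately have "p \<otimes>\<^bsub>P\<^esub> c \<in> carrier P" "p \<otimes>\<^bsub>P\<^esub> r = q \<otimes>\<^bsub>P\<^esub> (p \<otimes>\<^bsub>P\<^esub> c)"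
      using p by (simp_all add: P.m_lcomm)
    then show ?thesis by (auto simp: factor_def)
  qed (use r in \<open>auto simp: factor_def\<close>)
  then show ?case using r finite_index_mult[of p r] p by (intro bexI[of _ "p \<otimes>\<^bsub>P\<^esub> r"]) auto
qed

text \<open>Testing a foundation set against \<open>(g, r)\<close> with \<open>r\<close> a common multiple shows that the cosets
  \<open>h \<theta>\<^sub>p(G)\<close> cover \<open>G\<close>; Neumann's lemma allows to drop those of infinite index.\<close>

lemma foundation_set_refinement:
  assumes F: "foundation_set S F"
  shows "\<exists>m\<in>carrier P. finite_index m \<and> (\<forall>g\<in>carrier G. \<exists>s\<in>F. (g, m) \<in> pideal S s)"
proof -
  have fin: "finite F" and sub: "\<And>g p. (g, p) \<in> F \<Longrightarrow> g \<in> carrier G \<and> p \<in> carrier P"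
    using F by (auto simp: foundation_set_def)
  let ?H = "\<lambda>p. \<theta> p ` carrier G"
  have "finite (snd ` F)" "snd ` F \<subseteq> carrier P" using fin sub by force+
  from common_multiple[OF this]
  obtain r where r: "r \<in> carrier P" and "\<forall>p\<in>snd ` F. p divides\<^bsub>P\<^esub> r" by (elim bexE conjE)
  then have dvd_r: "p divides\<^bsub>P\<^esub> r" if "p \<in> snd ` F" for p using that by blast
  have image_dvd: "?H b \<subseteq> ?H a" if ab: "a divides\<^bsub>P\<^esub> b" "a \<in> carrier P" for a b
  proof -
    obtain c where "c \<in> carrier P" "b = a \<otimes>\<^bsub>P\<^esub> c" using ab(1) by (auto simp: factor_def)
    then show ?thesis using ab(2) by (auto simp: \<theta>_mult)
  qed
  have cover: "\<exists>(h, p)\<in>F. g \<in> h <#\<^bsub>G\<^esub> ?H p" if g: "g \<in> carrier G" for g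
  proof -
    have "\<exists>t\<in>F. pideal S (g, r) \<inter> pideal S t \<noteq> {}"
      using F g r by (auto simp: foundation_set_def)
    then obtain h p where hp: "(h, p) \<in> F" "pideal S (g, r) \<inter> pideal S (h, p) \<noteq> {}" by auto
    then obtain x y where xy: "x \<in> carrier G" "y \<in> carrier G" "g \<otimes>\<^bsub>G\<^esub> \<theta> r x = h \<otimes>\<^bsub>G\<^esub> \<theta> p y"
      by (auto simp: mem_pideal)
    have c: "h \<in> carrier G" "p \<in> carrier P" using sub hp by auto
    have "\<theta> r x \<in> ?H p" using image_dvd[OF dvd_r c(2)] hp(1) xy(1) c by (force simp: image_iff)
    then obtain z where z: "z \<in> carrier G" "\<theta> r x = \<theta> p z" by auto
    have "g = (g \<otimes>\<^bsub>G\<^esub> \<theta> r x) \<otimes>\<^bsub>G\<^esub> inv\<^bsub>G\<^esub> (\<theta> r x)" using g r xy(1) by (simp add: G.m_assoc)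
    also have "\<dots> = h \<otimes>\<^bsub>G\<^esub> \<theta> p (y \<otimes>\<^bsub>G\<^esub> inv\<^bsub>G\<^esub> z)" unfolding xy(3) unfolding z(2) using c xy z by (simp add: G.m_assoc)
    finally have "g \<in> h <#\<^bsub>G\<^esub> ?H p" using xy(2) z(1) by (auto simp: G.l_coset_image)
    then show ?thesis using hp(1) by blast
  qed
  let ?A = "{p \<in> snd ` F. finite_index p}"
  have "\<exists>r\<in>carrier P. (\<forall>p\<in>?A. p divides\<^bsub>P\<^esub> r) \<and> ((\<forall>p\<in>?A. finite_index p) \<longrightarrow> finite_index r)"
    by (rule common_multiple) (use fin sub in auto)
  then obtain m where m: "m \<in> carrier P" "finite_index m" "\<And>p. p \<in> ?A \<Longrightarrow> p divides\<^bsub>P\<^esub> m" by auto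
  have fin_cover: "\<exists>(h, p)\<in>F. finite_index p \<and> g \<in> h <#\<^bsub>G\<^esub> ?H p" if g: "g \<in> carrier G" for g
  proof (rule ccontr)
    assume no: "\<not> (\<exists>(h, p)\<in>F. finite_index p \<and> g \<in> h <#\<^bsub>G\<^esub> ?H p)"
    let ?I = "{(h, p) \<in> F. \<not> finite_index p}"
    obtain T where T: "finite T" "T \<subseteq> carrier G" "carrier G \<subseteq> (\<Union>t\<in>T. t <#\<^bsub>G\<^esub> ?H m)"
      using m(2) unfolding finite_index_def by blast
    \<comment> \<open>The coset g theta_m(G) misses every listed coset of finite index, because the
      p in question divide m; so \<open>cover\<close> puts it into the cosets of infinite index.
      Moving it by t g^-1 for t in \<open>T\<close> would then cover G by the cosets in
      \<open>?C\<close>.\<close>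
    let ?C = "(\<lambda>(t, h, p). (t \<otimes>\<^bsub>G\<^esub> inv\<^bsub>G\<^esub> g \<otimes>\<^bsub>G\<^esub> h, ?H p)) ` (T \<times> ?I)"
    have "\<exists>x\<in>carrier G. \<forall>(h, H)\<in>?C. x \<notin> h <#\<^bsub>G\<^esub> H"
    proof (rule G.exists_outside_infinite_index_cosets)
      have finI: "finite ?I" using fin by (rule rev_finite_subset) auto
      then show "finite (?H ` snd ` ?I)" "finite ?C" using T(1) by auto
      show "?C \<subseteq> carrier G \<times> ?H ` snd ` ?I"
      proof (rule image_subsetI)
        fix x assume "x \<in> T \<times> ?I"
        then obtain t h p where x: "x = (t, h, p)" "t \<in> T" "(h, p) \<in> ?I" by auto
        have "t \<in> carrier G" "h \<in> carrier G" "p \<in> snd ` ?I" using x T(2) sub[of h p] by force+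
        then show "(case x of (t, h, p) \<Rightarrow> (t \<otimes>\<^bsub>G\<^esub> inv\<^bsub>G\<^esub> g \<otimes>\<^bsub>G\<^esub> h, ?H p)) \<in> carrier G \<times> ?H ` snd ` ?I"
          using g unfolding x(1) prod.case by (intro SigmaI G.m_closed G.inv_closed imageI)
      qed
      fix H assume "H \<in> ?H ` snd ` ?I"
      then obtain h p where p: "(h, p) \<in> F" "\<not> finite_index p" "H = ?H p" by auto
      interpret group_hom G G "\<theta> p" using sub[OF p(1)] \<theta>_group_hom by blast
      show "subgroup H G" unfolding p(3) by (rule img_is_subgroup)
      show "\<not> carrier G \<subseteq> (\<Union>t\<in>U. t <#\<^bsub>G\<^esub> H)" if "finite U" "U \<subseteq> carrier G" for U
        using p that unfolding finite_index_def by blast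
    qed
    then obtain x where x: "x \<in> carrier G" "\<forall>(h, H)\<in>?C. x \<notin> h <#\<^bsub>G\<^esub> H" by blast
    then obtain t y where t: "t \<in> T" "y \<in> carrier G" "x = t \<otimes>\<^bsub>G\<^esub> \<theta> m y"
      using T(3) by (auto simp: G.l_coset_image)
    have tc: "t \<in> carrier G" using t T by blast
    let ?z = "g \<otimes>\<^bsub>G\<^esub> \<theta> m y"
    obtain h p where hp: "(h, p) \<in> F" "?z \<in> h <#\<^bsub>G\<^esub> ?H p" using cover[of ?z] g m(1) t(2) by auto
    have c: "h \<in> carrier G" "p \<in> carrier P" using sub hp by auto
    obtain w where w: "w \<in> carrier G" "?z = h \<otimes>\<^bsub>G\<^esub> \<theta> p w" using hp(2) by (auto simp: G.l_coset_image)
    show False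
    proof (cases "finite_index p")
      case True
      then have "\<theta> m y \<in> ?H p" using image_dvd[OF m(3) c(2)] hp(1) t(2) by (force simp: image_iff)
      then obtain v where v: "v \<in> carrier G" "\<theta> m y = \<theta> p v" by auto
      have "g = ?z \<otimes>\<^bsub>G\<^esub> inv\<^bsub>G\<^esub> (\<theta> m y)" using g m(1) t(2) by (simp add: G.m_assoc)
      also have "\<dots> = h \<otimes>\<^bsub>G\<^esub> \<theta> p (w \<otimes>\<^bsub>G\<^esub> inv\<^bsub>G\<^esub> v)" unfolding w(2) unfolding v(2) using c w v by (simp add: G.m_assoc)
      finally have "g \<in> h <#\<^bsub>G\<^esub> ?H p" using w(1) v(1) by (auto simp: G.l_coset_image)
      then show False using no hp(1) True by blast
    next
      case False
      have "x = t \<otimes>\<^bsub>G\<^esub> inv\<^bsub>G\<^esub> g \<otimes>\<^bsub>G\<^esub> ?z" using t(2,3) tc g m(1) by (simp add: G.m_assoc)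
      also have "\<dots> = t \<otimes>\<^bsub>G\<^esub> inv\<^bsub>G\<^esub> g \<otimes>\<^bsub>G\<^esub> h \<otimes>\<^bsub>G\<^esub> \<theta> p w" unfolding w(2) using tc g c w(1) by (simp add: G.m_assoc)
      finally have "x \<in> (t \<otimes>\<^bsub>G\<^esub> inv\<^bsub>G\<^esub> g \<otimes>\<^bsub>G\<^esub> h) <#\<^bsub>G\<^esub> ?H p" using w(1) by (auto simp: G.l_coset_image)
      moreover have "(t \<otimes>\<^bsub>G\<^esub> inv\<^bsub>G\<^esub> g \<otimes>\<^bsub>G\<^esub> h, ?H p) \<in> ?C"
        by (rule image_eqI[of _ _ "(t, h, p)"]) (use t(1) hp(1) False in auto)
      ultimately show False using x(2) by blast
    qed
  qed
  have "\<exists>s\<in>F. (g, m) \<in> pideal S s" if g: "g \<in> carrier G" for g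
  proof -
    obtain h p where hp: "(h, p) \<in> F" "finite_index p" "g \<in> h <#\<^bsub>G\<^esub> ?H p"
      using fin_cover[OF g] by blast
    then have "p divides\<^bsub>P\<^esub> m" using m(3)[of p] by force
    then have "(g, m) \<in> pideal S (h, p)" using hp(3) by (auto simp: mem_pideal factor_def G.l_coset_image)
    then show ?thesis using hp(1) by blast
  qed
  then show ?thesis using m by blast
qed

end

section \<open>Homomorphisms of completions and quotient seminorms\<close>

text \<open>Start of the substitution of elements of one free *-algebra for the generators of
  another. It is the analogue of \<open>eval_in\<close>, whose values lie in a C*-algebra, and acts
  on representatives before completion.\<close>

definition letter_hom :: "('y \<Rightarrow> 'x free_star) \<Rightarrow> 'y star_letter \<Rightarrow> 'x free_star" where
  "letter_hom f l = (case l of Plain x \<Rightarrow> f x | Starred x \<Rightarrow> adj (f x))"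

definition word_hom :: "('y \<Rightarrow> 'x free_star) \<Rightarrow> 'y star_word \<Rightarrow> 'x free_star" where
  "word_hom f w = prod_list (map (letter_hom f) (letters w))"

definition free_hom :: "('y \<Rightarrow> 'x free_star) \<Rightarrow> 'y free_star \<Rightarrow> 'x free_star" where
  "free_hom f a = (\<Sum>w\<in>Poly_Mapping.keys a. scl (Poly_Mapping.lookup a w) (word_hom f w))"

lemma word_hom_add: "word_hom f (v + w) = word_hom f v * word_hom f w"
  by (simp add: word_hom_def plus_star_word_def)

lemma word_hom_zero: "word_hom f 0 = 1"
  by (simp add: word_hom_def zero_star_word_def)

lemma word_hom_adj: "word_hom f (word_adj w) = adj (word_hom f w)"
proof (cases w)
  case (Word ls)
  have "letter_hom f (letter_adj l) = adj (letter_hom f l)" for l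
    by (cases l) (simp_all add: letter_hom_def adj_idem)
  then have "prod_list (map (letter_hom f) (rev (map letter_adj ls))) = adj (prod_list (map (letter_hom f) ls))"
    by (induction ls) (simp_all add: adj_one adj_mult_free)
  then show ?thesis by (simp add: word_hom_def word_adj_def Word)
qed

lemma free_hom_superset:
  assumes "finite K" "Poly_Mapping.keys a \<subseteq> K"
  shows "free_hom f a = (\<Sum>w\<in>K. scl (Poly_Mapping.lookup a w) (word_hom f w))"
  unfolding free_hom_def by (rule sum.mono_neutral_left) (use assms in \<open>auto simp: in_keys_iff scl_def\<close>)

lemma free_hom_single: "free_hom f (Poly_Mapping.single w c) = scl c (word_hom f w)"
  by (subst free_hom_superset[of "{w}"]) auto

lemma free_hom_add: "free_hom f (a + b) = free_hom f a + free_hom f b"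
proof -
  let ?K = "Poly_Mapping.keys a \<union> Poly_Mapping.keys b"
  have "free_hom f (a + b) = (\<Sum>w\<in>?K. scl (Poly_Mapping.lookup (a + b) w) (word_hom f w))"
    by (rule free_hom_superset) (auto simp: Poly_Mapping.keys_add)
  also have "\<dots> = (\<Sum>w\<in>?K. scl (Poly_Mapping.lookup a w) (word_hom f w)) + (\<Sum>w\<in>?K. scl (Poly_Mapping.lookup b w) (word_hom f w))"
    by (simp add: lookup_add scl_add_left sum.distrib)
  also have "\<dots> = free_hom f a + free_hom f b" by (simp add: free_hom_superset[of ?K])
  finally show ?thesis .
qed

lemma free_hom_single_mult: "free_hom f (Poly_Mapping.single w c * b) = free_hom f (Poly_Mapping.single w c) * free_hom f b"
proof (induction b rule: free_star_induct)
  case (single k v)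
  show ?case by (simp add: mult_single free_hom_single word_hom_add scl_mult_left scl_mult_right scl_scl mult.commute)
next
  case (sum g k v)
  then show ?case by (simp add: distrib_left free_hom_add)
qed

lemma free_hom_mult: "free_hom f (a * b) = free_hom f a * free_hom f b"
proof (induction a rule: free_star_induct)
  case (single k v)
  show ?case by (rule free_hom_single_mult)
next
  case (sum g k v)
  then show ?case by (simp add: distrib_right free_hom_add)
qed

lemma free_hom_one [simp]: "free_hom f 1 = 1"
  using free_hom_single[of f 0 1] by (simp add: word_hom_zero scl_one)

lemma free_hom_scl: "free_hom f (scl c a) = scl c (free_hom f a)"
  by (simp add: scl_def[of c a] free_hom_mult free_hom_single word_hom_zero scl_mult_left)

lemma free_hom_adj: "free_hom f (adj a) = adj (free_hom f a)"
proof (induction a rule: free_star_induct)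
  case (single k v)
  show ?case by (simp add: adj_single free_hom_single word_hom_adj adj_scl)
next
  case (sum g k v)
  then show ?case by (simp add: adj_add_free free_hom_add)
qed

lemma free_hom_gen [simp]: "free_hom f (gen x) = f x"
  by (simp add: gen_def free_hom_single word_hom_def letter_hom_def scl_one)

lemma free_hom_diff: "free_hom f (a - b) = free_hom f a - free_hom f b"
  using free_hom_add[of f "a - b" b] by (simp add: algebra_simps)

lemma cstar_seminorm_free_hom: "cstar_seminorm q \<Longrightarrow> cstar_seminorm (\<lambda>a. q (free_hom f a))"
  by (simp add: cstar_seminorm_def free_hom_add free_hom_mult free_hom_scl free_hom_adj)

text \<open>Theorem \<open>universal\<close> of the definitions yields a *-homomorphism without a norm bound; here the map is
  applied termwise to Cauchy sequences, which makes it contractive.\<close>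

theorem completion_hom:
  fixes R :: "'y free_star set" and R' :: "'x free_star set" and f :: "'y \<Rightarrow> 'x free_star"
  assumes "bounded_relations R" "bounded_relations R'"
    and rel: "\<And>r. r \<in> R \<Longrightarrow> univ_seminorm R' (free_hom f r) = 0"
  obtains \<Psi> where "star_hom (cstar_completion (univ_seminorm R)) (cstar_completion (univ_seminorm R')) \<Psi>"
    "\<And>X. X \<in> carrier (cstar_completion (univ_seminorm R)) \<Longrightarrow>
      cnorm (cstar_completion (univ_seminorm R')) (\<Psi> X) \<le> cnorm (cstar_completion (univ_seminorm R)) X"
    "\<And>a. \<Psi> (cauchy_class (univ_seminorm R) (\<lambda>n. a)) = cauchy_class (univ_seminorm R') (\<lambda>n. free_hom f a)"
proof -
  interpret A: bounded_relations R by fact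
  interpret B: bounded_relations R' by fact
  \<comment> \<open>The norm of the target pulls back to a C*-seminorm vanishing on
    \<open>R\<close>, so it lies below the universal one. Contractivity is this inequality.\<close>
  have "(\<lambda>a. B.N (free_hom f a)) \<in> seminorms R"
    by (simp add: seminorms_def cstar_seminorm_free_hom B.N_seminorm rel)
  then have le: "B.N (free_hom f a) \<le> A.N a" for a by (rule A.le_N)
  have CA: "B.CA (\<lambda>n. free_hom f (x n))" if "A.CA x" for x
    using that le unfolding cauchy_in_def free_hom_diff[symmetric] by (meson order_le_less_trans)
  have eqv: "B.eqv (\<lambda>n. free_hom f (x n)) (\<lambda>n. free_hom f (y n))" if "A.eqv x y" for x y
    unfolding B.eqv_def free_hom_diff[symmetric]
    by (rule null_comparison[OF _ that[unfolded A.eqv_def]]) (simp add: le)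
  define \<Psi> where "\<Psi> X = B.cl (\<lambda>n. free_hom f (repr X n))" for X
  have \<Psi>: "\<Psi> (A.cl x) = B.cl (\<lambda>n. free_hom f (x n))" if "A.CA x" for x
    unfolding \<Psi>_def using A.repr_cl[OF that] CA that
    by (subst B.cl_eq) (auto intro!: eqv intro: A.eqv_sym)
  have rep: "\<exists>x. A.CA x \<and> X = A.cl x" if "X \<in> carrier A.UA" for X using that by (simp add: A.carrier_A)
  show thesis
  proof
    show "star_hom A.UA B.UA \<Psi>"
      unfolding star_hom_def
    proof (intro conjI ballI allI ring_hom_memI)
      fix X assume "X \<in> carrier A.UA"
      then obtain x where x: "A.CA x" "X = A.cl x" using rep by blast
      show "\<Psi> X \<in> carrier B.UA" using x CA by (simp add: \<Psi> B.cl_in)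
      show "\<Psi> (cscale A.UA c X) = cscale B.UA c (\<Psi> X)" for c
        using x CA by (simp add: A.scale_cl A.CA_scl \<Psi> B.scale_cl free_hom_scl)
      show "\<Psi> (cadj A.UA X) = cadj B.UA (\<Psi> X)"
        using x CA by (simp add: A.adj_cl A.CA_adj \<Psi> B.adj_cl free_hom_adj)
      fix Y assume "Y \<in> carrier A.UA"
      then obtain y where y: "A.CA y" "Y = A.cl y" using rep by blast
      show "\<Psi> (X \<oplus>\<^bsub>A.UA\<^esub> Y) = \<Psi> X \<oplus>\<^bsub>B.UA\<^esub> \<Psi> Y"
        using x y CA by (simp add: A.add_cl A.CA_add \<Psi> B.add_cl free_hom_add)
      show "\<Psi> (X \<otimes>\<^bsub>A.UA\<^esub> Y) = \<Psi> X \<otimes>\<^bsub>B.UA\<^esub> \<Psi> Y"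
        using x y CA by (simp add: A.mult_cl A.CA_mult \<Psi> B.mult_cl free_hom_mult)
    next
      show "\<Psi> \<one>\<^bsub>A.UA\<^esub> = \<one>\<^bsub>B.UA\<^esub>" by (simp add: A.one_cl B.one_cl \<Psi>)
    qed
    show "cnorm B.UA (\<Psi> X) \<le> cnorm A.UA X" if X: "X \<in> carrier A.UA" for X
    proof -
      obtain x where x: "A.CA x" "X = A.cl x" using rep X by blast
      show ?thesis unfolding x(2) \<Psi>[OF x(1)]
        by (rule LIMSEQ_le[OF B.norm_cl_tendsto[OF CA[OF x(1)]] A.norm_cl_tendsto[OF x(1)]]) (simp add: le)
    qed
    show "\<Psi> (A.const_cl a) = B.const_cl (free_hom f a)" for a by (simp add: \<Psi>)
  qed
qed

section \<open>Norm, adjoint and closed sets in a C*-algebra\<close>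

context cstar_algebra begin

lemma norm_zero [simp]: "cnorm A \<zero> = 0"
  using norm_eq_zero by simp

lemma uminus_eq_scale: assumes "x \<in> carrier A" shows "\<ominus> x = cscale A (-1) x"
proof -
  have "cscale A (-1) x \<oplus> x = \<zero>"
    using scale_add_left[OF assms, of "-1" 1] assms by (simp add: scale_one scale_zero)
  then show ?thesis using assms by (simp add: minus_equality scale_closed)
qed

lemma norm_uminus: "x \<in> carrier A \<Longrightarrow> cnorm A (\<ominus> x) = cnorm A x"
  by (simp add: uminus_eq_scale norm_scale)

lemma norm_diff_commute: 
  assumes "x \<in> carrier A" "y \<in> carrier A" shows "cnorm A (x \<ominus> y) = cnorm A (y \<ominus> x)"
proof -
  have "\<ominus> (x \<ominus> y) = y \<ominus> x" using assms by (simp add: a_minus_def minus_add a_comm)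
  then show ?thesis using assms norm_uminus[of "x \<ominus> y"] by simp
qed

lemma norm_diff_triangle:
  assumes "x \<in> carrier A" "y \<in> carrier A" "z \<in> carrier A"
  shows "cnorm A (x \<ominus> z) \<le> cnorm A (x \<ominus> y) + cnorm A (y \<ominus> z)"
proof -
  have "x \<ominus> z = (x \<ominus> y) \<oplus> (y \<ominus> z)" using assms by algebra
  then show ?thesis using norm_triangle[of "x \<ominus> y" "y \<ominus> z"] assms by simp
qed

lemma norm_triangle_diff:
  assumes "x \<in> carrier A" "y \<in> carrier A" shows "cnorm A x \<le> cnorm A (x \<ominus> y) + cnorm A y"
proof -
  have "x = (x \<ominus> y) \<oplus> y" using assms by algebra
  then show ?thesis using norm_triangle[of "x \<ominus> y" y] assms by simp
qed

lemma norm_adj: assumes "x \<in> carrier A" shows "cnorm A (cadj A x) = cnorm A x"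
proof -
  have le: "cnorm A y \<le> cnorm A (cadj A y)" if y: "y \<in> carrier A" for y
  proof (cases "cnorm A y = 0")
    case False
    have "cnorm A y * cnorm A y \<le> cnorm A (cadj A y) * cnorm A y"
      using norm_cstar[OF y] norm_mult[OF adj_closed[OF y] y] by (simp add: power2_eq_square)
    then show ?thesis using False norm_nonneg[OF y] by (simp add: mult_le_cancel_right)
  qed (use norm_nonneg[OF adj_closed[OF y]] in simp)
  show ?thesis using le[OF assms] le[OF adj_closed[OF assms]] assms by (simp add: adj_adj)
qed

lemma adj_uminus: "x \<in> carrier A \<Longrightarrow> cadj A (\<ominus> x) = \<ominus> cadj A x"
  by (simp add: uminus_eq_scale adj_closed adj_scale)

lemma adj_diff: "x \<in> carrier A \<Longrightarrow> y \<in> carrier A \<Longrightarrow> cadj A (x \<ominus> y) = cadj A x \<ominus> cadj A y"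
  by (simp add: a_minus_def adj_add adj_uminus adj_closed)

lemma adj_zero [simp]: "cadj A \<zero> = \<zero>"
  using adj_diff[of \<zero> \<zero>] adj_closed[of \<zero>] by (simp add: a_minus_def r_neg)

lemma projection_norm:
  assumes "e \<in> carrier A" "e \<otimes> e = e" "cadj A e = e" shows "cnorm A e \<le> 1"
proof -
  have "cnorm A e * cnorm A e = cnorm A e" using norm_cstar[OF assms(1)] assms by (simp add: power2_eq_square)
  then show ?thesis by (cases "cnorm A e = 0") auto
qed

lemma compl_projection:
  assumes "e \<in> carrier A" "e \<otimes> e = e" "cadj A e = e"
  shows "(\<one> \<ominus> e) \<otimes> (\<one> \<ominus> e) = \<one> \<ominus> e" "cadj A (\<one> \<ominus> e) = \<one> \<ominus> e" "cnorm A (\<one> \<ominus> e) \<le> 1"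
proof -
  show 1: "(\<one> \<ominus> e) \<otimes> (\<one> \<ominus> e) = \<one> \<ominus> e"
    using assms(1,2) by (simp add: a_minus_def l_distr r_distr l_minus r_minus a_assoc r_neg)
  show 2: "cadj A (\<one> \<ominus> e) = \<one> \<ominus> e" using assms by (simp add: adj_diff adj_one_A)
  show "cnorm A (\<one> \<ominus> e) \<le> 1" by (rule projection_norm[OF _ 1 2]) (use assms in simp)
qed

text \<open>The definition of \<open>norm_closed\<close> quantifies over sequences; this and
  \<open>norm_closedD\<close> replace it by approximation within epsilon.\<close>

lemma norm_closedI:
  assumes "\<And>x. x \<in> carrier A \<Longrightarrow> (\<And>\<epsilon>. \<epsilon> > 0 \<Longrightarrow> \<exists>y\<in>I. cnorm A (x \<ominus> y) < \<epsilon>) \<Longrightarrow> x \<in> I" "I \<subseteq> carrier A"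
  shows "norm_closed A I"
  unfolding norm_closed_def
proof (intro allI ballI impI)
  fix X :: "nat \<Rightarrow> 'a" and x assume x: "x \<in> carrier A" "(\<forall>n. X n \<in> I) \<and> (\<lambda>n. cnorm A (X n \<ominus> x)) \<longlonglongrightarrow> 0"
  show "x \<in> I"
  proof (rule assms(1)[OF x(1)])
    fix \<epsilon> :: real assume "\<epsilon> > 0"
    then obtain n where "cnorm A (X n \<ominus> x) < \<epsilon>"
      using x(2) order_tendstoD(2)[of _ 0 sequentially \<epsilon>] eventually_happens'[OF sequentially_bot] by blast
    then show "\<exists>y\<in>I. cnorm A (x \<ominus> y) < \<epsilon>"
      using x assms(2) norm_diff_commute[of x "X n"] by (intro bexI[of _ "X n"]) (auto simp: subset_iff)
  qed
qed

lemma norm_closedD: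
  assumes "norm_closed A I" "I \<subseteq> carrier A" "x \<in> carrier A" "\<And>\<epsilon>. \<epsilon> > 0 \<Longrightarrow> \<exists>y\<in>I. cnorm A (x \<ominus> y) < \<epsilon>"
  shows "x \<in> I"
proof -
  have "\<exists>y\<in>I. cnorm A (x \<ominus> y) < 1 / real (Suc n)" for n by (rule assms(4)) simp
  then obtain X where X: "\<And>n. X n \<in> I" "\<And>n. cnorm A (x \<ominus> X n) < 1 / real (Suc n)" by metis
  have "(\<lambda>n. cnorm A (X n \<ominus> x)) \<longlonglongrightarrow> 0"
  proof (rule null_comparison[OF _ LIMSEQ_inverse_real_of_nat])
    fix n
    have "X n \<in> carrier A" using X assms(2) by blast
    then show "norm (cnorm A (X n \<ominus> x)) \<le> inverse (real (Suc n))"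
      using X(2)[of n] norm_diff_commute[of x "X n"] assms(3) norm_nonneg[of "X n \<ominus> x"]
      by (simp add: field_simps)
  qed
  then show ?thesis using assms(1,3) X(1) unfolding norm_closed_def by blast
qed

end

text \<open>The norm of a coset in \<open>cstar_quot\<close>, taken as a function on the algebra
  itself so that it can be composed with \<open>eval_in\<close> and compared with seminorms on the
  free *-algebra.\<close>

definition quot_norm :: "('a, 'm) cstar_scheme \<Rightarrow> 'a set \<Rightarrow> 'a \<Rightarrow> real" where
  "quot_norm A J x = (INF j\<in>J. cnorm A (x \<oplus>\<^bsub>A\<^esub> j))"

section \<open>The quotient seminorm of a closed ideal\<close>

locale cstar_ideal = cstar_algebra A + ideal J A for A :: "('a, 'b) cstar_scheme" (structure) and J +
  assumes closed: "norm_closed A J"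
begin

lemma J_carrier [simp]: "j \<in> J \<Longrightarrow> j \<in> carrier A"
  using a_subset by blast

lemma quot_norm_le: "x \<in> carrier A \<Longrightarrow> j \<in> J \<Longrightarrow> quot_norm A J x \<le> cnorm A (x \<oplus> j)"
  unfolding quot_norm_def by (rule cINF_lower[OF bdd_belowI2[of _ 0]]) (auto intro: norm_nonneg)

lemma quot_norm_ge: "(\<And>j. j \<in> J \<Longrightarrow> c \<le> cnorm A (x \<oplus> j)) \<Longrightarrow> c \<le> quot_norm A J x"
proof -
  assume le: "\<And>j. j \<in> J \<Longrightarrow> c \<le> cnorm A (x \<oplus> j)"
  have "J \<noteq> {}" using additive_subgroup.zero_closed[OF ideal.axioms(1)[OF ideal_axioms]] by blast
  then show ?thesis unfolding quot_norm_def using le by (rule cINF_greatest)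
qed

lemma quot_norm_less: "quot_norm A J x < c \<Longrightarrow> \<exists>j\<in>J. cnorm A (x \<oplus> j) < c"
  using quot_norm_ge[of c x] by (meson not_le)

lemma quot_norm_nonneg: "x \<in> carrier A \<Longrightarrow> 0 \<le> quot_norm A J x"
  by (rule quot_norm_ge) (simp add: norm_nonneg)

lemma quot_norm_le_norm: "x \<in> carrier A \<Longrightarrow> quot_norm A J x \<le> cnorm A x"
  using quot_norm_le[of x \<zero>] by simp

lemma quot_norm_ideal: "x \<in> J \<Longrightarrow> quot_norm A J x = 0"
  using quot_norm_le[of x "\<ominus> x"] quot_norm_nonneg[of x] by (simp add: r_neg)

lemma quot_norm_zeroD:
  assumes "x \<in> carrier A" "quot_norm A J x = 0" shows "x \<in> J"
proof (rule norm_closedD[OF closed a_subset assms(1)])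
  fix \<epsilon> :: real assume "\<epsilon> > 0"
  then obtain j where "j \<in> J" "cnorm A (x \<oplus> j) < \<epsilon>" using quot_norm_less[of x \<epsilon>] assms by auto
  then show "\<exists>y\<in>J. cnorm A (x \<ominus> y) < \<epsilon>"
    using assms(1) by (intro bexI[of _ "\<ominus> j"]) (simp_all add: a_minus_def)
qed

lemma quot_norm_triangle:
  assumes x: "x \<in> carrier A" "y \<in> carrier A"
  shows "quot_norm A J (x \<oplus> y) \<le> quot_norm A J x + quot_norm A J y"
proof (rule field_le_epsilon)
  fix \<epsilon> :: real assume "\<epsilon> > 0"
  then obtain j k where jk: "j \<in> J" "cnorm A (x \<oplus> j) < quot_norm A J x + \<epsilon> / 2"
    "k \<in> J" "cnorm A (y \<oplus> k) < quot_norm A J y + \<epsilon> / 2"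
    using quot_norm_less[of x "quot_norm A J x + \<epsilon> / 2"] quot_norm_less[of y "quot_norm A J y + \<epsilon> / 2"] by auto
  have "(x \<oplus> y) \<oplus> (j \<oplus> k) = (x \<oplus> j) \<oplus> (y \<oplus> k)" using x jk(1,3) by (simp add: a_ac)
  then have "quot_norm A J (x \<oplus> y) \<le> cnorm A ((x \<oplus> j) \<oplus> (y \<oplus> k))"
    using quot_norm_le[of "x \<oplus> y" "j \<oplus> k"] x jk(1,3) by simp
  also have "\<dots> \<le> cnorm A (x \<oplus> j) + cnorm A (y \<oplus> k)" using x jk(1,3) by (intro norm_triangle) simp_all
  finally show "quot_norm A J (x \<oplus> y) \<le> quot_norm A J x + quot_norm A J y + \<epsilon>" using jk(2,4) by simp
qed

lemma scale_ideal: "j \<in> J \<Longrightarrow> cscale A c j \<in> J"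
  using I_l_closed[of j "cscale A c \<one>"] scale_mult_left[of \<one> j c] by (simp add: scale_closed)

lemma quot_norm_scale:
  assumes x: "x \<in> carrier A" shows "quot_norm A J (cscale A c x) = cmod c * quot_norm A J x"
proof -
  have le: "quot_norm A J (cscale A c x) \<le> cmod c * quot_norm A J x" if x: "x \<in> carrier A" for c x
  proof (cases "c = 0")
    case True
    then show ?thesis using x quot_norm_ideal[of \<zero>] by (simp add: scale_zero)
  next
    case False
    have "quot_norm A J (cscale A c x) / cmod c \<le> quot_norm A J x"
    proof (rule quot_norm_ge)
      fix j assume j: "j \<in> J"
      have "quot_norm A J (cscale A c x) \<le> cnorm A (cscale A c (x \<oplus> j))"
        using quot_norm_le[OF scale_closed[OF x] scale_ideal[OF j], of c c] x j by (simp add: scale_add_right)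
      then show "quot_norm A J (cscale A c x) / cmod c \<le> cnorm A (x \<oplus> j)"
        using False x j by (simp add: norm_scale field_simps)
    qed
    then show ?thesis using False by (simp add: field_simps)
  qed
  show ?thesis
  proof (cases "c = 0")
    case True
    then show ?thesis using le[OF x, of 0] quot_norm_nonneg[OF scale_closed[OF x], of 0] by simp
  next
    case False
    then have "quot_norm A J x \<le> cmod (1 / c) * quot_norm A J (cscale A c x)"
      using le[OF scale_closed[OF x, of c], of "1 / c"] x by (simp add: scale_scale scale_one)
    then show ?thesis using le[OF x, of c] False by (simp add: norm_divide field_simps)
  qed
qed

lemma quot_norm_mult:
  assumes x: "x \<in> carrier A" "y \<in> carrier A"
  shows "quot_norm A J (x \<otimes> y) \<le> quot_norm A J x * quot_norm A J y"
proof -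
  have *: "quot_norm A J (x \<otimes> y) \<le> cnorm A (x \<oplus> j) * cnorm A (y \<oplus> k)" if jk: "j \<in> J" "k \<in> J" for j k
  proof -
    have "(x \<oplus> j) \<otimes> (y \<oplus> k) = (x \<otimes> y) \<oplus> (x \<otimes> k \<oplus> (j \<otimes> y \<oplus> j \<otimes> k))"
      using x jk by (simp add: l_distr r_distr a_ac)
    moreover have "x \<otimes> k \<oplus> (j \<otimes> y \<oplus> j \<otimes> k) \<in> J" using x jk by (simp add: I_l_closed I_r_closed)
    ultimately have "quot_norm A J (x \<otimes> y) \<le> cnorm A ((x \<oplus> j) \<otimes> (y \<oplus> k))"
      using quot_norm_le[of "x \<otimes> y"] x by simp
    also have "\<dots> \<le> cnorm A (x \<oplus> j) * cnorm A (y \<oplus> k)" using x jk by (intro norm_mult) simp_all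
    finally show ?thesis .
  qed
  let ?p = "quot_norm A J x" and ?q = "quot_norm A J y"
  \<comment> \<open>Both infima are approached with the same error, and the limit from the right
    also covers the case that one of them is zero.\<close>
  have "((\<lambda>\<epsilon>. (?p + \<epsilon>) * (?q + \<epsilon>)) \<longlongrightarrow> (?p + 0) * (?q + 0)) (at_right 0)" by (intro tendsto_intros)
  moreover have "\<forall>\<^sub>F \<epsilon> in at_right 0. quot_norm A J (x \<otimes> y) \<le> (?p + \<epsilon>) * (?q + \<epsilon>)"
    unfolding eventually_at_right_field
  proof (intro exI[of _ 1] conjI allI impI)
    fix \<epsilon> :: real assume "0 < \<epsilon>"
    then obtain j k where jk: "j \<in> J" "cnorm A (x \<oplus> j) < ?p + \<epsilon>" "k \<in> J" "cnorm A (y \<oplus> k) < ?q + \<epsilon>"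
      using quot_norm_less[of x "?p + \<epsilon>"] quot_norm_less[of y "?q + \<epsilon>"] by auto
    have "cnorm A (x \<oplus> j) * cnorm A (y \<oplus> k) \<le> (?p + \<epsilon>) * (?q + \<epsilon>)"
      by (rule mult_mono) (use jk x norm_nonneg \<open>0 < \<epsilon>\<close> quot_norm_nonneg in \<open>auto intro: less_imp_le add_nonneg_nonneg\<close>)
    then show "quot_norm A J (x \<otimes> y) \<le> (?p + \<epsilon>) * (?q + \<epsilon>)" using *[OF jk(1,3)] by linarith
  qed simp
  ultimately show ?thesis using tendsto_lowerbound[of _ _ "at_right (0::real)"] by auto
qed

end

text \<open>With an approximate unit of projections in \<open>J\<close>, the C*-identity of the quotient seminorm follows from
  \<open>\<parallel>x (1 - e)\<parallel>\<^sup>2 \<le> \<parallel>x\<^sup>* x (1 - e)\<parallel>\<close>, without functional calculus.\<close>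

locale cstar_ideal_unit = cstar_ideal +
  assumes unit: "x \<in> J \<Longrightarrow> \<epsilon> > 0 \<Longrightarrow>
    \<exists>e\<in>J. e \<otimes> e = e \<and> cadj A e = e \<and> cnorm A (x \<otimes> (\<one> \<ominus> e)) < \<epsilon>"
begin

lemma mult_compl: "x \<in> carrier A \<Longrightarrow> e \<in> carrier A \<Longrightarrow> x \<otimes> (\<one> \<ominus> e) = x \<ominus> x \<otimes> e"
  by (simp add: a_minus_def r_distr r_minus)

text \<open>The adjoint of x (1 - e) is x^* - e x^*, of equally small norm, and e x^* lies in J if e
  does. So x^* is a limit of elements of J.\<close>

lemma adj_ideal: assumes x: "x \<in> J" shows "cadj A x \<in> J"
proof (rule norm_closedD[OF closed a_subset adj_closed])
  fix \<epsilon> :: real assume "\<epsilon> > 0"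
  then obtain e where e: "e \<in> J" "cadj A e = e" "cnorm A (x \<otimes> (\<one> \<ominus> e)) < \<epsilon>" using unit x by blast
  have "cadj A (x \<otimes> (\<one> \<ominus> e)) = cadj A x \<ominus> e \<otimes> cadj A x"
    using x e(1,2) by (simp add: mult_compl adj_diff adj_mult)
  then have "cnorm A (cadj A x \<ominus> e \<otimes> cadj A x) < \<epsilon>" using e x norm_adj[of "x \<otimes> (\<one> \<ominus> e)"] by simp
  moreover have "e \<otimes> cadj A x \<in> J" using e x by (simp add: I_r_closed adj_closed)
  ultimately show "\<exists>y\<in>J. cnorm A (cadj A x \<ominus> y) < \<epsilon>" by blast
qed (use x in simp)

lemma quot_norm_cstar:
  assumes x: "x \<in> carrier A"
  shows "quot_norm A J (cadj A x \<otimes> x) = (quot_norm A J x)\<^sup>2"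
proof (rule antisym)
  have "sqrt (quot_norm A J (cadj A x \<otimes> x)) \<le> quot_norm A J x"
  proof (rule quot_norm_ge)
    fix j assume j: "j \<in> J"
    \<comment> \<open>Self-adjointness of J enters here: it keeps the terms with j^* in J, so this
      product represents the coset of x^* x.\<close>
    have "cadj A (x \<oplus> j) \<otimes> (x \<oplus> j) = cadj A x \<otimes> x \<oplus> (cadj A x \<otimes> j \<oplus> (cadj A j \<otimes> x \<oplus> cadj A j \<otimes> j))"
      using x j by (simp add: adj_add adj_closed l_distr r_distr a_ac)
    moreover have "cadj A x \<otimes> j \<oplus> (cadj A j \<otimes> x \<oplus> cadj A j \<otimes> j) \<in> J"
      using x j adj_ideal[OF j] by (simp add: I_l_closed I_r_closed adj_closed)
    ultimately have "quot_norm A J (cadj A x \<otimes> x) \<le> cnorm A (cadj A (x \<oplus> j) \<otimes> (x \<oplus> j))"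
      using quot_norm_le[of "cadj A x \<otimes> x"] x by (simp add: adj_closed)
    then have "quot_norm A J (cadj A x \<otimes> x) \<le> (cnorm A (x \<oplus> j))\<^sup>2" using x j by (simp add: norm_cstar)
    then show "sqrt (quot_norm A J (cadj A x \<otimes> x)) \<le> cnorm A (x \<oplus> j)"
      using real_le_lsqrt norm_nonneg x j by simp
  qed
  then show "quot_norm A J (cadj A x \<otimes> x) \<le> (quot_norm A J x)\<^sup>2"
    by (rule sqrt_le_D)
next
  show "(quot_norm A J x)\<^sup>2 \<le> quot_norm A J (cadj A x \<otimes> x)"
  proof (rule quot_norm_ge)
    fix j assume j: "j \<in> J"
    show "(quot_norm A J x)\<^sup>2 \<le> cnorm A (cadj A x \<otimes> x \<oplus> j)"
    proof (rule field_le_epsilon)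
      fix \<epsilon> :: real assume "\<epsilon> > 0"
      then obtain e where e: "e \<in> J" "e \<otimes> e = e" "cadj A e = e" "cnorm A (j \<otimes> (\<one> \<ominus> e)) < \<epsilon>"
        using unit j by blast
      \<comment> \<open>Here e is adapted to j, not to x: x (1 - e) represents the coset of x for
        every e in J, and passing from x^* x to x^* x + j costs only the norm of j (1 - e).\<close>
      let ?d = "\<one> \<ominus> e" and ?y = "cadj A x \<otimes> x"
      have d: "?d \<in> carrier A" "cadj A ?d = ?d" "cnorm A ?d \<le> 1"
        using compl_projection[of e] e by simp_all
      have y: "?y \<in> carrier A" using x by (simp add: adj_closed)
      have "x \<otimes> ?d = x \<oplus> \<ominus> (x \<otimes> e)" 
        using mult_compl[of x e] x e(1) by (simp only: a_minus_def J_carrier)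
      moreover have "\<ominus> (x \<otimes> e) \<in> J" using e(1) x by (simp add: I_l_closed)
      ultimately have "quot_norm A J x \<le> cnorm A (x \<otimes> ?d)" using quot_norm_le x by simp
      then have "(quot_norm A J x)\<^sup>2 \<le> (cnorm A (x \<otimes> ?d))\<^sup>2"
        by (rule power_mono[OF _ quot_norm_nonneg[OF x]])
      also have "\<dots> = cnorm A (?d \<otimes> (?y \<otimes> ?d))"
        using norm_cstar[of "x \<otimes> ?d"] x d by (simp add: adj_mult adj_closed m_assoc)
      also have "\<dots> \<le> cnorm A ?d * cnorm A (?y \<otimes> ?d)" using d y by (intro norm_mult) simp_all
      also have "\<dots> \<le> cnorm A (?y \<otimes> ?d)"
        using d y norm_nonneg[of "?y \<otimes> ?d"] norm_nonneg[of ?d] mult_right_mono[of "cnorm A ?d" 1 "cnorm A (?y \<otimes> ?d)"] by simp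
      also have "?y \<otimes> ?d = (?y \<oplus> j) \<otimes> ?d \<ominus> j \<otimes> ?d"
        using y d j by (simp add: l_distr a_minus_def a_assoc r_neg)
      also have "cnorm A \<dots> \<le> cnorm A ((?y \<oplus> j) \<otimes> ?d) + cnorm A (j \<otimes> ?d)"
        using norm_triangle[of "(?y \<oplus> j) \<otimes> ?d" "\<ominus> (j \<otimes> ?d)"] y d j by (simp add: norm_uminus a_minus_def)
      also have "cnorm A ((?y \<oplus> j) \<otimes> ?d) \<le> cnorm A (?y \<oplus> j) * cnorm A ?d" using y d j by (intro norm_mult) simp_all
      also have "\<dots> \<le> cnorm A (?y \<oplus> j)"
        using d y j norm_nonneg[of "?y \<oplus> j"] mult_left_mono[of "cnorm A ?d" 1 "cnorm A (?y \<oplus> j)"] by simp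
      finally show "(quot_norm A J x)\<^sup>2 \<le> cnorm A (?y \<oplus> j) + \<epsilon>" using e(4) by simp
    qed
  qed
qed

lemma quot_norm_seminorm:
  assumes f: "\<And>x. f x \<in> carrier A"
  shows "cstar_seminorm (\<lambda>a. quot_norm A J (eval_in A f a))"
  by (simp add: cstar_seminorm_def ev_add[OF f] ev_mult[OF f] ev_scl[OF f] ev_adj[OF f] ev_closed[OF f]
      quot_norm_nonneg quot_norm_triangle quot_norm_scale quot_norm_mult quot_norm_cstar)

end

section \<open>Kernel and range of a contractive homomorphism\<close>

lemma (in ring) diff_eq_zero_iff:
  assumes "x \<in> carrier R" "y \<in> carrier R" shows "x \<ominus> y = \<zero> \<longleftrightarrow> x = y"
proof
  assume "x \<ominus> y = \<zero>"
  moreover have "x = (x \<ominus> y) \<oplus> y" using assms by algebra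
  ultimately show "x = y" using assms by simp
qed (use assms in \<open>simp add: a_minus_def r_neg\<close>)

locale cstar_hom = A: cstar_algebra A + B: cstar_algebra B
  for A :: "('a, 'm) cstar_scheme" and B :: "('b, 'n) cstar_scheme" +
  fixes \<Psi> :: "'a \<Rightarrow> 'b"
  assumes hom: "star_hom A B \<Psi>"
    and contractive: "x \<in> carrier A \<Longrightarrow> cnorm B (\<Psi> x) \<le> cnorm A x"
begin

sublocale ring_hom_ring A B \<Psi>
proof (rule ring_hom_ringI2[OF A.ring_axioms B.ring_axioms])
  show "\<Psi> \<in> ring_hom A B" using hom unfolding star_hom_def by (rule conjunct1)
qed

abbreviation "K \<equiv> a_kernel A B \<Psi>"

lemma mem_kernel: "x \<in> K \<longleftrightarrow> x \<in> carrier A \<and> \<Psi> x = \<zero>\<^bsub>B\<^esub>"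
  unfolding a_kernel_def' by simp

lemma hom_diff: "x \<in> carrier A \<Longrightarrow> y \<in> carrier A \<Longrightarrow> \<Psi> (x \<ominus>\<^bsub>A\<^esub> y) = \<Psi> x \<ominus>\<^bsub>B\<^esub> \<Psi> y"
  by (simp add: a_minus_def)

lemma hom_scale: "x \<in> carrier A \<Longrightarrow> \<Psi> (cscale A c x) = cscale B c (\<Psi> x)"
  and hom_adj: "x \<in> carrier A \<Longrightarrow> \<Psi> (cadj A x) = cadj B (\<Psi> x)"
  using hom by (simp_all add: star_hom_def)

lemma kernel_closed: "norm_closed A K"
proof (rule A.norm_closedI)
  fix x assume x: "x \<in> carrier A" and *: "\<And>\<epsilon>. \<epsilon> > 0 \<Longrightarrow> \<exists>y\<in>K. cnorm A (x \<ominus>\<^bsub>A\<^esub> y) < \<epsilon>"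
  have "cnorm B (\<Psi> x) \<le> 0"
  proof (rule field_le_epsilon)
    fix \<epsilon> :: real assume "\<epsilon> > 0"
    then obtain y where y: "y \<in> K" "cnorm A (x \<ominus>\<^bsub>A\<^esub> y) < \<epsilon>" using * by blast
    then have "y \<in> carrier A" "\<Psi> (x \<ominus>\<^bsub>A\<^esub> y) = \<Psi> x" using x by (simp_all add: mem_kernel hom_diff a_minus_def)
    then show "cnorm B (\<Psi> x) \<le> 0 + \<epsilon>" using contractive[of "x \<ominus>\<^bsub>A\<^esub> y"] x y by simp
  qed
  then show "x \<in> K" using x B.norm_nonneg[of "\<Psi> x"] B.norm_eq_zero[of "\<Psi> x"] by (simp add: mem_kernel)
qed (auto simp: mem_kernel)

lemma mem_coset:
  assumes "x \<in> carrier A"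
  shows "y \<in> K +>\<^bsub>A\<^esub> x \<longleftrightarrow> y \<in> carrier A \<and> \<Psi> y = \<Psi> x"
proof -
  show ?thesis
  proof
    assume "y \<in> K +>\<^bsub>A\<^esub> x"
    then obtain k where "k \<in> K" "y = k \<oplus>\<^bsub>A\<^esub> x" by (auto simp: a_r_coset_def')
    then show "y \<in> carrier A \<and> \<Psi> y = \<Psi> x" using assms by (simp add: mem_kernel)
  next
    assume y: "y \<in> carrier A \<and> \<Psi> y = \<Psi> x"
    then have "y \<ominus>\<^bsub>A\<^esub> x \<in> K" "y = (y \<ominus>\<^bsub>A\<^esub> x) \<oplus>\<^bsub>A\<^esub> x"
      using assms by (simp_all add: mem_kernel hom_diff a_minus_def A.a_assoc A.l_neg B.r_neg)
    then show "y \<in> K +>\<^bsub>A\<^esub> x" unfolding a_r_coset_def' by blast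
  qed
qed

lemma coset_eq_iff:
  assumes "x \<in> carrier A" "y \<in> carrier A"
  shows "K +>\<^bsub>A\<^esub> x = K +>\<^bsub>A\<^esub> y \<longleftrightarrow> \<Psi> x = \<Psi> y"
  using mem_coset[OF assms(1)] mem_coset[OF assms(2)] assms(1) by (auto simp: set_eq_iff)

text \<open>The inverse of the map induced on the quotient. A preimage is chosen for each element of
  \<open>B\<close>; by \<open>coset_eq_iff\<close> its coset does not depend on the choice, and
  equal cosets force equal images.\<close>

lemma quotient_iso:
  assumes onto: "\<Psi> ` carrier A = carrier B"
  shows "\<exists>\<phi>. star_iso B (cstar_quot A K) \<phi> \<and> (\<forall>x\<in>carrier A. \<phi> (\<Psi> x) = K +>\<^bsub>A\<^esub> x)"
proof -
  interpret K: ideal K A by (rule kernel_is_ideal)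
  let ?Q = "cstar_quot A K"
  have carrier_Q: "carrier ?Q = (\<lambda>x. K +>\<^bsub>A\<^esub> x) ` carrier A"
    by (auto simp: cstar_quot_def FactRing_def A_RCOSETS_def')
  define \<phi> where "\<phi> y = K +>\<^bsub>A\<^esub> (SOME x. x \<in> carrier A \<and> \<Psi> x = y)" for y
  have \<phi>: "\<phi> (\<Psi> x) = K +>\<^bsub>A\<^esub> x" if x: "x \<in> carrier A" for x
  proof -
    have "(SOME x'. x' \<in> carrier A \<and> \<Psi> x' = \<Psi> x) \<in> carrier A \<and> \<Psi> (SOME x'. x' \<in> carrier A \<and> \<Psi> x' = \<Psi> x) = \<Psi> x"
      by (rule someI[of _ x]) (simp add: x)
    then show ?thesis unfolding \<phi>_def using coset_eq_iff x by simp
  qed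
  have lift: "\<exists>x\<in>carrier A. y = \<Psi> x" if "y \<in> carrier B" for y using that onto by blast
  \<comment> \<open>In \<open>cstar_quot\<close> the scalar action and the adjoint are unions over
    all representatives; for a map compatible with \<open>\<Psi>\<close> all these cosets
    coincide.\<close>
  have UN_coset: "(\<Union>z\<in>K +>\<^bsub>A\<^esub> x. K +>\<^bsub>A\<^esub> f z) = K +>\<^bsub>A\<^esub> f x"
    if "x \<in> carrier A" "\<And>z. z \<in> carrier A \<Longrightarrow> f z \<in> carrier A" "\<And>z. z \<in> carrier A \<Longrightarrow> \<Psi> (f z) = g (\<Psi> z)" for x f g
  proof -
    have "K +>\<^bsub>A\<^esub> f z = K +>\<^bsub>A\<^esub> f x" if "z \<in> K +>\<^bsub>A\<^esub> x" for z
      using that \<open>x \<in> carrier A\<close> mem_coset[of x z] coset_eq_iff[of "f z" "f x"] \<open>\<And>z. z \<in> carrier A \<Longrightarrow> f z \<in> carrier A\<close>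
        \<open>\<And>z. z \<in> carrier A \<Longrightarrow> \<Psi> (f z) = g (\<Psi> z)\<close> by simp
    moreover have "x \<in> K +>\<^bsub>A\<^esub> x" using mem_coset that by simp
    ultimately show ?thesis by blast
  qed
  have "star_hom B ?Q \<phi>"
    unfolding star_hom_def
  proof (intro conjI ballI allI ring_hom_memI)
    fix y assume "y \<in> carrier B"
    then obtain x where x: "x \<in> carrier A" "y = \<Psi> x" using lift by blast
    show "\<phi> y \<in> carrier ?Q" using x by (simp add: \<phi> carrier_Q)
    show "\<phi> (cscale B c y) = cscale ?Q c (\<phi> y)" for c
    proof -
      have "\<phi> (cscale B c y) = K +>\<^bsub>A\<^esub> cscale A c x"
        using x \<phi>[of "cscale A c x"] by (simp add: hom_scale A.scale_closed)
      then show ?thesis using UN_coset[of x "cscale A c" "cscale B c"] x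
        by (simp add: \<phi> cstar_quot_def hom_scale A.scale_closed)
    qed
    show "\<phi> (cadj B y) = cadj ?Q (\<phi> y)"
    proof -
      have "\<phi> (cadj B y) = K +>\<^bsub>A\<^esub> cadj A x"
        using x \<phi>[of "cadj A x"] by (simp add: hom_adj A.adj_closed)
      then show ?thesis using UN_coset[of x "cadj A" "cadj B"] x
        by (simp add: \<phi> cstar_quot_def hom_adj A.adj_closed)
    qed
    fix y' assume "y' \<in> carrier B"
    then obtain x' where x': "x' \<in> carrier A" "y' = \<Psi> x'" using lift by blast
    show "\<phi> (y \<otimes>\<^bsub>B\<^esub> y') = \<phi> y \<otimes>\<^bsub>?Q\<^esub> \<phi> y'"
      using x x' \<phi>[of "x \<otimes>\<^bsub>A\<^esub> x'"] by (simp add: \<phi> cstar_quot_def FactRing_def K.rcoset_mult_add)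
    show "\<phi> (y \<oplus>\<^bsub>B\<^esub> y') = \<phi> y \<oplus>\<^bsub>?Q\<^esub> \<phi> y'"
      using x x' \<phi>[of "x \<oplus>\<^bsub>A\<^esub> x'"] by (simp add: \<phi> cstar_quot_def FactRing_def K.a_rcos_sum)
  next
    show "\<phi> \<one>\<^bsub>B\<^esub> = \<one>\<^bsub>?Q\<^esub>" using \<phi>[of "\<one>\<^bsub>A\<^esub>"] by (simp add: cstar_quot_def FactRing_def)
  qed
  moreover have "bij_betw \<phi> (carrier B) (carrier ?Q)"
  proof (rule bij_betw_imageI)
    show "inj_on \<phi> (carrier B)"
    proof (rule inj_onI)
      fix y y' assume "y \<in> carrier B" "y' \<in> carrier B" and eq: "\<phi> y = \<phi> y'"
      then obtain x x' where "x \<in> carrier A" "y = \<Psi> x" "x' \<in> carrier A" "y' = \<Psi> x'" using lift by meson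
      then show "y = y'" using eq by (simp add: \<phi> coset_eq_iff)
    qed
    show "\<phi> ` carrier B = carrier ?Q" unfolding carrier_Q onto[symmetric] image_image using \<phi> by simp
  qed
  ultimately show ?thesis using \<phi> unfolding star_iso_def by blast
qed

text \<open>Surjectivity: an element of \<open>B\<close> is approximated by images of \<open>X\<^sub>n\<close>, and the bound on the quotient
  seminorm permits to correct \<open>X\<^sub>n\<^sub>+\<^sub>1\<close> by an element of \<open>J\<close> so that the sequence becomes Cauchy.\<close>

lemma kernel_and_range:
  assumes J: "cstar_ideal A J" "J \<subseteq> K"
    and M: "M \<subseteq> carrier A"
    and dense_A: "\<And>x \<epsilon>. x \<in> carrier A \<Longrightarrow> \<epsilon> > 0 \<Longrightarrow> \<exists>y\<in>M. cnorm A (x \<ominus>\<^bsub>A\<^esub> y) < \<epsilon>"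
    and dense_B: "\<And>z \<epsilon>. z \<in> carrier B \<Longrightarrow> \<epsilon> > 0 \<Longrightarrow> \<exists>y\<in>M. cnorm B (z \<ominus>\<^bsub>B\<^esub> \<Psi> y) < \<epsilon>"
    and bound: "\<And>y. y \<in> M \<Longrightarrow> quot_norm A J y \<le> cnorm B (\<Psi> y)"
  shows "K = J" "\<Psi> ` carrier A = carrier B"
proof -
  interpret J: cstar_ideal A J by (rule J)
  \<comment> \<open>Both sides are continuous on \<open>A\<close>, so the bound extends from the
    dense set \<open>M\<close>. The distance from x to y is paid twice, once in the quotient
    seminorm and once under \<open>\<Psi>\<close>, hence epsilon / 2.\<close>
  have bd: "quot_norm A J x \<le> cnorm B (\<Psi> x)" if x: "x \<in> carrier A" for x
  proof (rule field_le_epsilon)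
    fix \<epsilon> :: real assume "\<epsilon> > 0"
    then obtain y where y: "y \<in> M" "cnorm A (x \<ominus>\<^bsub>A\<^esub> y) < \<epsilon> / 2" using dense_A[OF x, of "\<epsilon> / 2"] by auto
    have yc: "y \<in> carrier A" using M y by blast
    have "x = (x \<ominus>\<^bsub>A\<^esub> y) \<oplus>\<^bsub>A\<^esub> y" using x yc by algebra
    then have "quot_norm A J x \<le> quot_norm A J (x \<ominus>\<^bsub>A\<^esub> y) + quot_norm A J y"
      using J.quot_norm_triangle[of "x \<ominus>\<^bsub>A\<^esub> y" y] x yc by simp
    also have "\<dots> \<le> cnorm A (x \<ominus>\<^bsub>A\<^esub> y) + cnorm B (\<Psi> y)"
      using J.quot_norm_le_norm[of "x \<ominus>\<^bsub>A\<^esub> y"] bound[OF y(1)] x yc by simp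
    also have "cnorm B (\<Psi> y) \<le> cnorm B (\<Psi> y \<ominus>\<^bsub>B\<^esub> \<Psi> x) + cnorm B (\<Psi> x)"
      using x yc by (intro B.norm_triangle_diff) simp_all
    also have "cnorm B (\<Psi> y \<ominus>\<^bsub>B\<^esub> \<Psi> x) \<le> cnorm A (x \<ominus>\<^bsub>A\<^esub> y)"
      using contractive[of "y \<ominus>\<^bsub>A\<^esub> x"] x yc by (simp add: hom_diff A.norm_diff_commute[of x y])
    finally show "quot_norm A J x \<le> cnorm B (\<Psi> x) + \<epsilon>" using y(2) by simp
  qed
  show "K = J"
  proof
    show "K \<subseteq> J"
    proof
      fix x assume "x \<in> K"
      then have x: "x \<in> carrier A" "\<Psi> x = \<zero>\<^bsub>B\<^esub>" by (auto simp: mem_kernel)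
      then have "quot_norm A J x \<le> 0" using bd[OF x(1)] by simp
      then show "x \<in> J" using J.quot_norm_nonneg[OF x(1)] by (intro J.quot_norm_zeroD[OF x(1)]) linarith
    qed
  qed fact
  show "\<Psi> ` carrier A = carrier B"
  proof
    show "carrier B \<subseteq> \<Psi> ` carrier A"
    proof
      fix z assume z: "z \<in> carrier B"
      \<comment> \<open>The images of successive terms are less than (1/2)^(n+1) + (1/2)^n apart,
        hence less than 2 (1/2)^n. By \<open>bd\<close> the same bound is reached in
        \<open>A\<close> after adding an element of \<open>J\<close>, which leaves the image
        unchanged.\<close>
      have "\<exists>X. \<forall>n. (X n \<in> carrier A \<and> cnorm B (z \<ominus>\<^bsub>B\<^esub> \<Psi> (X n)) < (1/2) ^ n) \<and> cnorm A (X (Suc n) \<ominus>\<^bsub>A\<^esub> X n) < 2 * (1/2) ^ n"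
      proof (rule dependent_nat_choice)
        show "\<exists>x. x \<in> carrier A \<and> cnorm B (z \<ominus>\<^bsub>B\<^esub> \<Psi> x) < (1/2) ^ 0"
          using dense_B[OF z, of 1] M by auto
        fix x n assume x: "x \<in> carrier A \<and> cnorm B (z \<ominus>\<^bsub>B\<^esub> \<Psi> x) < (1/2) ^ n"
        obtain y where y: "y \<in> M" "cnorm B (z \<ominus>\<^bsub>B\<^esub> \<Psi> y) < (1/2) ^ Suc n" using dense_B[OF z, of "(1/2) ^ Suc n"] by auto
        have yc: "y \<in> carrier A" using M y by blast
        have "cnorm B (\<Psi> (y \<ominus>\<^bsub>A\<^esub> x)) \<le> cnorm B (\<Psi> y \<ominus>\<^bsub>B\<^esub> z) + cnorm B (z \<ominus>\<^bsub>B\<^esub> \<Psi> x)"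
          using x yc z by (simp add: hom_diff B.norm_diff_triangle)
        also have "\<dots> < 2 * (1/2) ^ n"
        proof -
          have "cnorm B (\<Psi> y \<ominus>\<^bsub>B\<^esub> z) < (1/2) ^ Suc n"
            using y(2) B.norm_diff_commute[of "\<Psi> y" z] yc z by simp
          also have "\<dots> \<le> (1/2) ^ n" by simp
          finally show ?thesis using x by linarith
        qed
        finally have "quot_norm A J (y \<ominus>\<^bsub>A\<^esub> x) < 2 * (1/2) ^ n" using bd[of "y \<ominus>\<^bsub>A\<^esub> x"] x yc by simp
        then obtain j where j: "j \<in> J" "cnorm A ((y \<ominus>\<^bsub>A\<^esub> x) \<oplus>\<^bsub>A\<^esub> j) < 2 * (1/2) ^ n" using J.quot_norm_less by blast
        have jc: "j \<in> carrier A" "\<Psi> j = \<zero>\<^bsub>B\<^esub>" using j J(2) by (auto simp: mem_kernel)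
        have "(y \<oplus>\<^bsub>A\<^esub> j) \<ominus>\<^bsub>A\<^esub> x = (y \<ominus>\<^bsub>A\<^esub> x) \<oplus>\<^bsub>A\<^esub> j" using x yc jc(1) by (simp add: a_minus_def A.a_ac)
        moreover have "\<Psi> (y \<oplus>\<^bsub>A\<^esub> j) = \<Psi> y" using yc jc by simp
        ultimately show "\<exists>x'. (x' \<in> carrier A \<and> cnorm B (z \<ominus>\<^bsub>B\<^esub> \<Psi> x') < (1/2) ^ Suc n) \<and> cnorm A (x' \<ominus>\<^bsub>A\<^esub> x) < 2 * (1/2) ^ n"
          using j(2) y(2) yc jc(1) by (intro exI[of _ "y \<oplus>\<^bsub>A\<^esub> j"]) simp
      qed
      then obtain X where X: "\<And>n. X n \<in> carrier A" "\<And>n. cnorm B (z \<ominus>\<^bsub>B\<^esub> \<Psi> (X n)) < (1/2) ^ n"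
        "\<And>n. cnorm A (X (Suc n) \<ominus>\<^bsub>A\<^esub> X n) < 2 * (1/2) ^ n" by auto
      \<comment> \<open>The right side is the exact partial sum of the geometric series; keeping the
        subtracted term lets the induction close.\<close>
      have tail: "cnorm A (X (n + k) \<ominus>\<^bsub>A\<^esub> X n) \<le> 4 * (1/2) ^ n - 4 * (1/2) ^ (n + k)" for n k
      proof (induction k)
        case 0
        then show ?case using X(1)[of n] by (simp add: a_minus_def A.r_neg)
      next
        case (Suc k)
        have "cnorm A (X (n + Suc k) \<ominus>\<^bsub>A\<^esub> X n) \<le> cnorm A (X (Suc (n + k)) \<ominus>\<^bsub>A\<^esub> X (n + k)) + cnorm A (X (n + k) \<ominus>\<^bsub>A\<^esub> X n)"
          using X(1) by (simp add: A.norm_diff_triangle)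
        then show ?case using Suc X(3)[of "n + k"] by simp
      qed
      have "\<exists>L\<in>carrier A. (\<lambda>n. cnorm A (X n \<ominus>\<^bsub>A\<^esub> L)) \<longlonglongrightarrow> 0"
      proof (rule A.norm_complete[OF X(1)])
        fix \<epsilon> :: real assume "\<epsilon> > 0"
        then obtain N where N: "(1/2) ^ N < \<epsilon> / 4" using real_arch_pow_inv[of "\<epsilon> / 4" "1/2"] by auto
        have half: "cnorm A (X m \<ominus>\<^bsub>A\<^esub> X n) < \<epsilon>" if "m \<ge> n" "n \<ge> N" for m n
        proof -
          have "cnorm A (X m \<ominus>\<^bsub>A\<^esub> X n) \<le> 4 * (1/2) ^ n" 
            using tail[of n "m - n"] that by (smt (verit) le_add_diff_inverse zero_le_power half_gt_zero_iff)
          also have "\<dots> \<le> 4 * (1/2) ^ N" using that power_decreasing[of N n "1/2::real"] by simp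
          finally show ?thesis using N by simp
        qed
        show "\<exists>M. \<forall>m\<ge>M. \<forall>n\<ge>M. cnorm A (X m \<ominus>\<^bsub>A\<^esub> X n) < \<epsilon>"
        proof (intro exI[of _ N] allI impI)
          fix m n assume "m \<ge> N" "n \<ge> N"
          then show "cnorm A (X m \<ominus>\<^bsub>A\<^esub> X n) < \<epsilon>"
            using half[of m n] half[of n m] A.norm_diff_commute[OF X(1) X(1), of m n] by (cases "m \<ge> n") auto
        qed
      qed
      then obtain L where L: "L \<in> carrier A" "(\<lambda>n. cnorm A (X n \<ominus>\<^bsub>A\<^esub> L)) \<longlonglongrightarrow> 0" by blast
      have "(\<lambda>n. (1/2) ^ n + cnorm A (X n \<ominus>\<^bsub>A\<^esub> L)) \<longlonglongrightarrow> 0"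
        using L(2) by (intro tendsto_add_zero LIMSEQ_power_zero) simp_all
      moreover have "cnorm B (z \<ominus>\<^bsub>B\<^esub> \<Psi> L) \<le> (1/2) ^ n + cnorm A (X n \<ominus>\<^bsub>A\<^esub> L)" for n
      proof -
        have "cnorm B (z \<ominus>\<^bsub>B\<^esub> \<Psi> L) \<le> cnorm B (z \<ominus>\<^bsub>B\<^esub> \<Psi> (X n)) + cnorm B (\<Psi> (X n) \<ominus>\<^bsub>B\<^esub> \<Psi> L)"
          using z L(1) X(1) by (intro B.norm_diff_triangle) simp_all
        then show ?thesis
          using contractive[of "X n \<ominus>\<^bsub>A\<^esub> L"] X(1)[of n] X(2)[of n] L(1) by (simp add: hom_diff)
      qed
      ultimately have "cnorm B (z \<ominus>\<^bsub>B\<^esub> \<Psi> L) \<le> 0" by (intro LIMSEQ_le_const) auto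
      then have "z \<ominus>\<^bsub>B\<^esub> \<Psi> L = \<zero>\<^bsub>B\<^esub>"
        using B.norm_nonneg[of "z \<ominus>\<^bsub>B\<^esub> \<Psi> L"] B.norm_eq_zero[of "z \<ominus>\<^bsub>B\<^esub> \<Psi> L"] z L(1) by simp
      then have "z = \<Psi> L" using z L(1) by (simp add: B.diff_eq_zero_iff)
      then show "z \<in> \<Psi> ` carrier A" using L(1) by blast
    qed
  qed auto
qed

end

text \<open>Constants are built from words in the generators and are dense. The adjoints of
  generators are a separate hypothesis because \<open>M\<close> may fail to be self-adjoint: in
  \<open>junit_mult_closed\<close> it consists of right multipliers.\<close>

lemma (in bounded_relations) completion_induct:
  assumes M: "M \<subseteq> carrier UA" "norm_closed UA M"
    and add: "\<And>x y. x \<in> M \<Longrightarrow> y \<in> M \<Longrightarrow> x \<oplus>\<^bsub>UA\<^esub> y \<in> M"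
    and mult: "\<And>x y. x \<in> M \<Longrightarrow> y \<in> M \<Longrightarrow> x \<otimes>\<^bsub>UA\<^esub> y \<in> M"
    and scale: "\<And>x c. x \<in> M \<Longrightarrow> cscale UA c x \<in> M"
    and one: "\<one>\<^bsub>UA\<^esub> \<in> M"
    and gen: "\<And>x. const_cl (gen x) \<in> M" "\<And>x. cadj UA (const_cl (gen x)) \<in> M"
  shows "M = carrier UA"
proof -
  interpret UA: cstar_algebra UA by (rule cstar_algebra_completion)
  have word: "const_cl (Poly_Mapping.single (Word ls) 1) \<in> M" for ls
  proof (induction ls)
    case Nil
    have "Poly_Mapping.single (Word []) 1 = (1 :: 'x free_star)" by (simp flip: zero_star_word_def)
    then show ?case using one by (simp add: one_cl)
  next
    case (Cons l ls)
    have "const_cl (Poly_Mapping.single (Word [l]) 1) \<in> M"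
      using gen by (cases l) (simp_all add: gen_def adj_cl adj_single word_adj_def)
    moreover have "Poly_Mapping.single (Word (l # ls)) 1 = (Poly_Mapping.single (Word [l]) 1 * Poly_Mapping.single (Word ls) 1 :: 'x free_star)"
      by (simp add: mult_single plus_star_word_def)
    ultimately show ?case using mult[OF _ Cons, of "const_cl (Poly_Mapping.single (Word [l]) 1)"] by (simp add: mult_cl)
  qed
  have single_mem: "const_cl (Poly_Mapping.single w c) \<in> M" for w c
  proof -
    have "Poly_Mapping.single w c = scl c (Poly_Mapping.single (Word (letters w)) 1)" by (simp add: scl_def mult_single)
    then show ?thesis using scale[OF word, of c "letters w"] by (simp add: scale_cl)
  qed
  have const: "const_cl a \<in> M" for a
  proof (induction a rule: free_star_induct)
    case (single w c)
    show ?case by (rule single_mem)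
  next
    case (sum f k v)
    then show ?case using add[of "const_cl f" "const_cl (Poly_Mapping.single k v)"] by (simp add: add_cl)
  qed
  have "X \<in> M" if "X \<in> carrier UA" for X
  proof (rule UA.norm_closedD[OF M(2,1) that])
    fix \<epsilon> :: real assume "\<epsilon> > 0"
    then show "\<exists>y\<in>M. cnorm UA (X \<ominus>\<^bsub>UA\<^esub> y) < \<epsilon>" using approx const that unfolding carrier_A by blast
  qed
  then show ?thesis using M(1) by blast
qed

section \<open>Approximate units of the boundary ideal\<close>

lemma (in ring) mult_lcomm:
  assumes "x \<otimes> y = y \<otimes> x" "x \<in> carrier R" "y \<in> carrier R" "z \<in> carrier R"
  shows "x \<otimes> (y \<otimes> z) = y \<otimes> (x \<otimes> z)"
  using assms by (simp flip: m_assoc)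

lemma (in ring) mult_lidem:
  assumes "x \<otimes> x = x" "x \<in> carrier R" "y \<in> carrier R"
  shows "x \<otimes> (x \<otimes> y) = x \<otimes> y"
  using assms by (simp flip: m_assoc)

lemma (in cstar_algebra) closed_ideal_gen_ideal:
  assumes "X \<subseteq> carrier A"
  shows "ideal (closed_ideal_gen A X) A" "norm_closed A (closed_ideal_gen A X)" "X \<subseteq> closed_ideal_gen A X"
proof -
  let ?\<I> = "{I. ideal I A \<and> norm_closed A I \<and> X \<subseteq> I}"
  have "carrier A \<in> ?\<I>" using assms by (simp add: oneideal norm_closed_def)
  then show "ideal (closed_ideal_gen A X) A" unfolding closed_ideal_gen_def by (intro i_Intersect) auto
  show "norm_closed A (closed_ideal_gen A X)"
    unfolding norm_closed_def
  proof (intro allI ballI impI)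
    fix Y :: "nat \<Rightarrow> 'a" and x
    assume x: "x \<in> carrier A" "(\<forall>n. Y n \<in> closed_ideal_gen A X) \<and> (\<lambda>n. cnorm A (Y n \<ominus> x)) \<longlonglongrightarrow> 0"
    have "x \<in> I" if I: "ideal I A" "norm_closed A I" "X \<subseteq> I" for I
    proof -
      have "Y n \<in> I" for n using x(2) I unfolding closed_ideal_gen_def by blast
      then show ?thesis using x I(2) unfolding norm_closed_def by blast
    qed
    then show "x \<in> closed_ideal_gen A X" unfolding closed_ideal_gen_def by blast
  qed
  show "X \<subseteq> closed_ideal_gen A X" unfolding closed_ideal_gen_def by blast
qed

text \<open>The relations of C*(S) in an arbitrary C*-algebra. There are two instances, C*(S) itself
  and O with the elements \<open>w\<close> and \<open>proj\<close>, so that one calculus of the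
  diagonal serves both.\<close>

locale lcm_rep = cstar_algebra A + S: monoid S
  for A :: "('a, 'b) cstar_scheme" (structure) and S :: "'s monoid" +
  fixes v :: "'s \<Rightarrow> 'a" and e :: "'s set \<Rightarrow> 'a"
  assumes right_lcm: "\<And>s t. \<lbrakk>s \<in> carrier S; t \<in> carrier S; pideal S s \<inter> pideal S t \<noteq> {}\<rbrakk> \<Longrightarrow>
      \<exists>a\<in>carrier S. \<exists>b\<in>carrier S. s \<otimes>\<^bsub>S\<^esub> a = t \<otimes>\<^bsub>S\<^esub> b \<and> pideal S s \<inter> pideal S t = pideal S (s \<otimes>\<^bsub>S\<^esub> a)"
    and v_closed [simp]: "\<And>s. s \<in> carrier S \<Longrightarrow> v s \<in> carrier A"
    and e_closed [simp]: "\<And>X. X \<in> cideals S \<Longrightarrow> e X \<in> carrier A"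
    and v_isometry: "\<And>s. s \<in> carrier S \<Longrightarrow> cadj A (v s) \<otimes> v s = \<one>"
    and e_adj: "\<And>X. X \<in> cideals S \<Longrightarrow> cadj A (e X) = e X"
    and v_mult: "\<And>s t. s \<in> carrier S \<Longrightarrow> t \<in> carrier S \<Longrightarrow> v s \<otimes> v t = v (s \<otimes>\<^bsub>S\<^esub> t)"
    and v_e: "\<And>s X. s \<in> carrier S \<Longrightarrow> X \<in> cideals S \<Longrightarrow> v s \<otimes> e X \<otimes> cadj A (v s) = e (s <#\<^bsub>S\<^esub> X)"
    and e_carrier: "e (carrier S) = \<one>"
    and e_empty: "e {} = \<zero>"
    and e_mult: "\<And>X Y. X \<in> cideals S \<Longrightarrow> Y \<in> cideals S \<Longrightarrow> e X \<otimes> e Y = e (X \<inter> Y)"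
begin

lemma adj_v_closed [simp]: "s \<in> carrier S \<Longrightarrow> cadj A (v s) \<in> carrier A"
  by (simp add: adj_closed)

lemma v_isometry' [simp]:
  assumes "s \<in> carrier S" "x \<in> carrier A" shows "cadj A (v s) \<otimes> (v s \<otimes> x) = x"
  using assms by (simp add: v_isometry flip: m_assoc)

lemma pideal_one_S: "pideal S \<one>\<^bsub>S\<^esub> = carrier S"
  by (auto simp: pideal_def l_coset_def)

lemma pideal_cideal [simp]: "s \<in> carrier S \<Longrightarrow> pideal S s \<in> cideals S"
  by (simp add: cideals_def)

lemma carrier_cideal: "carrier S \<in> cideals S"
  using pideal_cideal[OF S.one_closed] by (simp add: pideal_one_S)

lemma v_one: "v \<one>\<^bsub>S\<^esub> = \<one>"
  using v_isometry'[of "\<one>\<^bsub>S\<^esub>" "v \<one>\<^bsub>S\<^esub>"] v_isometry[of "\<one>\<^bsub>S\<^esub>"] v_mult[of "\<one>\<^bsub>S\<^esub>" "\<one>\<^bsub>S\<^esub>"] by simp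

lemma e_pideal: "s \<in> carrier S \<Longrightarrow> e (pideal S s) = v s \<otimes> cadj A (v s)"
  using v_e[of s "carrier S"] carrier_cideal by (simp add: e_carrier pideal_def)

lemma cideal_cases:
  assumes "X \<in> cideals S"
  obtains "X = {}" | s where "s \<in> carrier S" "X = pideal S s"
  using assms by (auto simp: cideals_def)

lemma cideal_coset:
  assumes "t \<in> carrier S" "X \<in> cideals S" shows "t <#\<^bsub>S\<^esub> X \<in> cideals S"
proof -
  have "t <#\<^bsub>S\<^esub> pideal S s = pideal S (t \<otimes>\<^bsub>S\<^esub> s)" if "s \<in> carrier S" for s
    using that assms(1) by (auto simp: pideal_def l_coset_def S.m_assoc)
  then show ?thesis using assms by (auto simp: cideals_def l_coset_def[of _ _ "{}"])
qed

lemma cideal_Int: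
  assumes "X \<in> cideals S" "Y \<in> cideals S" shows "X \<inter> Y \<in> cideals S"
proof (cases "X \<inter> Y = {}")
  case False
  then obtain s t where "s \<in> carrier S" "X = pideal S s" "t \<in> carrier S" "Y = pideal S t"
    using assms unfolding cideals_def by blast
  then show ?thesis using right_lcm False by (metis S.m_closed pideal_cideal)
qed (simp add: cideals_def)

lemma e_idem: "X \<in> cideals S \<Longrightarrow> e X \<otimes> e X = e X"
  using e_mult[of X X] by simp

lemma e_commute: "X \<in> cideals S \<Longrightarrow> Y \<in> cideals S \<Longrightarrow> e X \<otimes> e Y = e Y \<otimes> e X"
  by (simp add: e_mult Int_commute)

text \<open>Inserting the range projections v_s v_s^* and v_t v_t^* between the factors changes
  nothing, and their product is the projection of the intersection. Hence v_s^* v_t is governed by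
  the LCM of s and t.\<close>

lemma adj_v_v:
  assumes "s \<in> carrier S" "t \<in> carrier S"
  shows "cadj A (v s) \<otimes> v t = cadj A (v s) \<otimes> e (pideal S s \<inter> pideal S t) \<otimes> v t"
proof -
  have "cadj A (v s) \<otimes> (v s \<otimes> cadj A (v s) \<otimes> (v t \<otimes> cadj A (v t))) \<otimes> v t = cadj A (v s) \<otimes> v t"
    using assms by (simp add: m_assoc v_isometry)
  then show ?thesis using assms by (simp flip: e_pideal e_mult)
qed

lemma adj_v_v_disjoint:
  assumes "s \<in> carrier S" "t \<in> carrier S" "pideal S s \<inter> pideal S t = {}"
  shows "cadj A (v s) \<otimes> v t = \<zero>"
  using adj_v_v[OF assms(1,2)] assms by (simp add: e_empty)

lemma adj_v_v_lcm:
  assumes c: "s \<in> carrier S" "t \<in> carrier S" "a \<in> carrier S" "b \<in> carrier S"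
    and eq: "s \<otimes>\<^bsub>S\<^esub> a = t \<otimes>\<^bsub>S\<^esub> b" and int: "pideal S s \<inter> pideal S t = pideal S (s \<otimes>\<^bsub>S\<^esub> a)"
  shows "cadj A (v s) \<otimes> v t = v a \<otimes> cadj A (v b)"
proof -
  have "e (pideal S s \<inter> pideal S t) = v s \<otimes> v a \<otimes> cadj A (v t \<otimes> v b)"
    unfolding int using c eq by (simp add: e_pideal v_mult)
  then show ?thesis unfolding adj_v_v[OF c(1,2)] using c by (simp add: adj_mult m_assoc v_isometry)
qed

text \<open>The ring generated by the commuting projections \<open>e\<^sub>X\<close>. It is invariant under conjugation by \<open>v\<^sub>t\<close> and \<open>v\<^sub>t\<^sup>*\<close>, and
  so is its intersection with any ideal; this makes the idempotents in the intersection an approximate unit.\<close>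

inductive_set diagonal :: "'a set" where
  diagonal_e: "X \<in> cideals S \<Longrightarrow> e X \<in> diagonal"
| diagonal_add: "x \<in> diagonal \<Longrightarrow> y \<in> diagonal \<Longrightarrow> x \<oplus> y \<in> diagonal"
| diagonal_uminus: "x \<in> diagonal \<Longrightarrow> \<ominus> x \<in> diagonal"
| diagonal_mult: "x \<in> diagonal \<Longrightarrow> y \<in> diagonal \<Longrightarrow> x \<otimes> y \<in> diagonal"

lemma diagonal_closed [simp]: "x \<in> diagonal \<Longrightarrow> x \<in> carrier A"
  by (induction rule: diagonal.induct) auto

lemma diagonal_one: "\<one> \<in> diagonal" and diagonal_zero: "\<zero> \<in> diagonal"
  using diagonal_e[OF carrier_cideal] diagonal_e[of "{}"] by (simp_all add: e_carrier e_empty cideals_def)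

lemma diagonal_compl: "x \<in> diagonal \<Longrightarrow> \<one> \<ominus> x \<in> diagonal"
  unfolding a_minus_def by (intro diagonal_one diagonal_add diagonal_uminus)

lemma diagonal_commute_e: "x \<in> diagonal \<Longrightarrow> X \<in> cideals S \<Longrightarrow> x \<otimes> e X = e X \<otimes> x"
proof (induction rule: diagonal.induct)
  case (diagonal_mult x y)
  then show ?case using mult_lcomm[of x "e X" y] by (simp add: m_assoc)
qed (simp_all add: e_commute l_distr r_distr l_minus r_minus)

lemma diagonal_commute: "x \<in> diagonal \<Longrightarrow> y \<in> diagonal \<Longrightarrow> x \<otimes> y = y \<otimes> x"
proof (induction rule: diagonal.induct)
  case (diagonal_mult x z)
  then show ?case using mult_lcomm[of x y z] by (simp add: m_assoc)
qed (simp_all add: diagonal_commute_e l_distr r_distr l_minus r_minus)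

lemma diagonal_adj: "x \<in> diagonal \<Longrightarrow> cadj A x = x"
proof (induction rule: diagonal.induct)
  case (diagonal_mult x y)
  then show ?case using diagonal_commute[of x y] by (simp add: adj_mult)
qed (simp_all add: e_adj adj_add adj_uminus)

lemma diagonal_conj:
  assumes t: "t \<in> carrier S" and x: "x \<in> diagonal"
  shows "v t \<otimes> x \<otimes> cadj A (v t) \<in> diagonal"
  using x
proof (induction rule: diagonal.induct)
  case (diagonal_e X)
  then show ?case using t cideal_coset[OF t] by (simp add: v_e diagonal.diagonal_e)
next
  case (diagonal_add x y)
  then show ?case using t diagonal.diagonal_add[OF diagonal_add.IH] by (simp add: l_distr r_distr)
next
  case (diagonal_uminus x)
  then show ?case using t diagonal.diagonal_uminus[OF diagonal_uminus.IH] by (simp add: l_minus r_minus)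
next
  case (diagonal_mult x y)
  have "v t \<otimes> x \<otimes> cadj A (v t) \<otimes> (v t \<otimes> y \<otimes> cadj A (v t)) = v t \<otimes> (x \<otimes> y) \<otimes> cadj A (v t)"
    using t diagonal_mult by (simp add: m_assoc)
  then show ?case using diagonal.diagonal_mult[OF diagonal_mult.IH] by simp
qed

text \<open>The range projection v_t v_t^* fixes v_t and commutes with the diagonal element x. This
  does duty for v_t v_t^* = 1 and makes conjugation by v_t^* multiplicative on the diagonal.\<close>

lemma diagonal_v_swap:
  assumes t: "t \<in> carrier S" and x: "x \<in> diagonal"
  shows "x \<otimes> v t = v t \<otimes> (cadj A (v t) \<otimes> x \<otimes> v t)"
proof -
  have "x \<otimes> v t = x \<otimes> e (pideal S t) \<otimes> v t" using t x by (simp add: e_pideal m_assoc v_isometry)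
  also have "\<dots> = v t \<otimes> (cadj A (v t) \<otimes> x \<otimes> v t)"
    using t x diagonal_commute_e[of x "pideal S t"] by (simp add: e_pideal m_assoc)
  finally show ?thesis .
qed

lemma diagonal_v_swap':
  "t \<in> carrier S \<Longrightarrow> x \<in> diagonal \<Longrightarrow> v t \<otimes> (cadj A (v t) \<otimes> (x \<otimes> v t)) = x \<otimes> v t"
  using diagonal_v_swap[of t x] by (simp add: m_assoc)

text \<open>If the ideals of t and s meet in the ideal of t a = s b, the conjugate of the projection
  of s is y y^* with y = v_t^* v_s = v_a v_b^*, that is, the projection of a. Products are handled
  by \<open>diagonal_v_swap'\<close>.\<close>

lemma diagonal_adj_conj:
  assumes t: "t \<in> carrier S" and x: "x \<in> diagonal"
  shows "cadj A (v t) \<otimes> x \<otimes> v t \<in> diagonal"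
  using x
proof (induction rule: diagonal.induct)
  case (diagonal_e X)
  then show ?case
  proof (cases rule: cideal_cases)
    case 1
    then show ?thesis using t diagonal_zero by (simp add: e_empty)
  next
    case s: (2 s)
    have *: "cadj A (v t) \<otimes> e X \<otimes> v t = (cadj A (v t) \<otimes> v s) \<otimes> cadj A (cadj A (v t) \<otimes> v s)"
      using s t by (simp add: e_pideal adj_mult adj_adj m_assoc)
    show ?thesis
    proof (cases "pideal S t \<inter> pideal S s = {}")
      case True
      then show ?thesis unfolding * using s t diagonal_zero by (simp add: adj_v_v_disjoint)
    next
      case False
      then obtain a b where ab: "a \<in> carrier S" "b \<in> carrier S" "t \<otimes>\<^bsub>S\<^esub> a = s \<otimes>\<^bsub>S\<^esub> b"
        "pideal S t \<inter> pideal S s = pideal S (t \<otimes>\<^bsub>S\<^esub> a)" using right_lcm s t by meson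
      have "cadj A (v t) \<otimes> e X \<otimes> v t = e (pideal S a)"
        unfolding * adj_v_v_lcm[OF t s(1) ab] using ab by (simp add: adj_mult adj_adj e_pideal m_assoc)
      then show ?thesis using ab by (simp add: diagonal.diagonal_e)
    qed
  qed
next
  case (diagonal_add x y)
  then show ?case using t diagonal.diagonal_add[OF diagonal_add.IH] by (simp add: l_distr r_distr)
next
  case (diagonal_uminus x)
  then show ?case using t diagonal.diagonal_uminus[OF diagonal_uminus.IH] by (simp add: l_minus r_minus)
next
  case (diagonal_mult x y)
  have "cadj A (v t) \<otimes> x \<otimes> v t \<otimes> (cadj A (v t) \<otimes> y \<otimes> v t) = cadj A (v t) \<otimes> x \<otimes> (v t \<otimes> (cadj A (v t) \<otimes> y \<otimes> v t))"
    using t diagonal_mult by (simp add: m_assoc)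
  also have "\<dots> = cadj A (v t) \<otimes> (x \<otimes> y) \<otimes> v t"
    using t diagonal_mult by (simp add: m_assoc diagonal_v_swap')
  finally show ?case using diagonal.diagonal_mult[OF diagonal_mult.IH] by simp
qed

text \<open>The products of \<open>boundary_elements\<close> for an arbitrary representation: in
  C*(S) they generate the boundary ideal, in O they have to vanish.\<close>

definition bprod :: "'s list \<Rightarrow> 'a" where
  "bprod ss = foldr (\<lambda>s x. (\<one> \<ominus> e (pideal S s)) \<otimes> x) ss \<one>"

definition belements :: "'a set" where
  "belements = {bprod ss | ss. distinct ss \<and> foundation_set S (set ss)}"

lemma bprod_simps [simp]: "bprod [] = \<one>" "bprod (s # ss) = (\<one> \<ominus> e (pideal S s)) \<otimes> bprod ss"
  by (simp_all add: bprod_def)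

lemma bprod_diagonal: "set ss \<subseteq> carrier S \<Longrightarrow> bprod ss \<in> diagonal"
  by (induction ss) (auto intro!: diagonal_one diagonal_mult diagonal_compl diagonal_e)

lemma diagonal_idem_mult:
  assumes "x \<in> diagonal" "y \<in> diagonal" "x \<otimes> x = x" "y \<otimes> y = y"
  shows "x \<otimes> y \<otimes> (x \<otimes> y) = x \<otimes> y"
  using assms diagonal_commute[of y x] mult_lcomm[of y x y] mult_lidem[of x y] by (simp add: m_assoc)

lemma idem_compl: "x \<in> carrier A \<Longrightarrow> x \<otimes> x = x \<Longrightarrow> (\<one> \<ominus> x) \<otimes> (\<one> \<ominus> x) = \<one> \<ominus> x"
  by (simp add: a_minus_def l_distr r_distr l_minus r_minus a_assoc r_neg)

lemma bprod_idem: "set ss \<subseteq> carrier S \<Longrightarrow> bprod ss \<otimes> bprod ss = bprod ss"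
  by (induction ss) (auto intro!: diagonal_idem_mult diagonal_compl diagonal_e bprod_diagonal idem_compl simp: e_idem)

lemma belements_diagonal: "belements \<subseteq> diagonal"
  by (auto simp: belements_def foundation_set_def intro!: bprod_diagonal)

abbreviation "J \<equiv> closed_ideal_gen A belements"

lemma J_ideal: "ideal J A" and J_closed: "norm_closed A J" and belements_J: "belements \<subseteq> J"
proof -
  have "belements \<subseteq> carrier A" using belements_diagonal by auto
  from closed_ideal_gen_ideal[OF this] show "ideal J A" "norm_closed A J" "belements \<subseteq> J" .
qed

sublocale J: cstar_ideal A J
  by (simp add: cstar_ideal_def cstar_ideal_axioms_def J_ideal J_closed cstar_algebra_axioms)

text \<open>Candidates for an approximate unit of \<open>J\<close>: self-adjoint as elements of the
  diagonal, directed by \<open>jproj_join\<close>, and stable under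
  \<open>jproj_conj\<close>.\<close>

definition jproj :: "'a set" where
  "jproj = {x \<in> diagonal \<inter> J. x \<otimes> x = x}"

lemma jproj_compl:
  assumes "x \<in> jproj"
  shows "x \<in> carrier A" "cnorm A (\<one> \<ominus> x) \<le> 1" "(\<one> \<ominus> x) \<otimes> (\<one> \<ominus> x) = \<one> \<ominus> x"
  using assms compl_projection[of x] by (simp_all add: jproj_def diagonal_adj)

text \<open>The join is x + y - x y. Its complement is the product (1 - x)(1 - y) of commuting
  projections, which shows idempotence and absorption, while the expanded form shows that it lies in
  \<open>J\<close>.\<close>

lemma jproj_join:
  assumes x: "x \<in> jproj" and y: "y \<in> jproj"
  shows "\<exists>z\<in>jproj. (\<one> \<ominus> x) \<otimes> (\<one> \<ominus> z) = \<one> \<ominus> z \<and> (\<one> \<ominus> y) \<otimes> (\<one> \<ominus> z) = \<one> \<ominus> z"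
proof
  let ?a = "\<one> \<ominus> x" and ?b = "\<one> \<ominus> y"
  let ?z = "\<one> \<ominus> ?a \<otimes> ?b"
  have d: "?a \<in> diagonal" "?b \<in> diagonal" and c: "x \<in> carrier A" "y \<in> carrier A"
    and i: "?a \<otimes> ?a = ?a" "?b \<otimes> ?b = ?b"
    using x y jproj_compl by (auto simp: jproj_def intro: diagonal_compl)
  have ab: "?a \<otimes> ?b \<in> diagonal" by (rule diagonal_mult[OF d])
  have "\<one> \<ominus> ?z = ?a \<otimes> ?b" using diagonal_closed[OF ab] by (simp add: a_minus_def minus_add r_neg r_neg1)
  moreover have "?a \<otimes> (?a \<otimes> ?b) = ?a \<otimes> ?b" using i c by (simp flip: m_assoc)
  moreover have "?b \<otimes> (?a \<otimes> ?b) = ?a \<otimes> ?b"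
    using i c diagonal_commute[OF d] mult_lidem[of ?b ?a] by simp
  ultimately show "?a \<otimes> (\<one> \<ominus> ?z) = \<one> \<ominus> ?z \<and> ?b \<otimes> (\<one> \<ominus> ?z) = \<one> \<ominus> ?z" by simp
  have "?z = x \<oplus> (y \<ominus> x \<otimes> y)" using c by (simp add: a_minus_def l_distr r_distr l_minus r_minus minus_add a_ac r_neg1 r_neg2)
  moreover have "x \<oplus> (y \<ominus> x \<otimes> y) \<in> J"
    using x y c by (auto simp: jproj_def a_minus_def intro!: J.a_closed J.a_inv_closed J.I_l_closed)
  moreover have "?z \<otimes> ?z = ?z" by (rule idem_compl) (use diagonal_idem_mult[OF d i] c in auto)
  ultimately show "?z \<in> jproj" using diagonal_compl[OF ab] by (simp add: jproj_def)
qed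

lemma jproj_conj:
  assumes x: "x \<in> jproj" and t: "t \<in> carrier S"
  shows "v t \<otimes> x \<otimes> cadj A (v t) \<in> jproj" "cadj A (v t) \<otimes> x \<otimes> v t \<in> jproj"
proof -
  have d: "x \<in> diagonal" "x \<in> J" "x \<otimes> x = x" using x by (auto simp: jproj_def)
  have "v t \<otimes> x \<otimes> cadj A (v t) \<otimes> (v t \<otimes> x \<otimes> cadj A (v t)) = v t \<otimes> (x \<otimes> x) \<otimes> cadj A (v t)"
    using t d(1) by (simp add: m_assoc)
  then show "v t \<otimes> x \<otimes> cadj A (v t) \<in> jproj"
    using d t diagonal_conj[OF t d(1)] by (simp add: jproj_def J.I_l_closed J.I_r_closed)
  have "cadj A (v t) \<otimes> x \<otimes> v t \<otimes> (cadj A (v t) \<otimes> x \<otimes> v t) = cadj A (v t) \<otimes> x \<otimes> (v t \<otimes> (cadj A (v t) \<otimes> x \<otimes> v t))"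
    using t d(1) by (simp add: m_assoc)
  also have "\<dots> = cadj A (v t) \<otimes> (x \<otimes> x) \<otimes> v t"
    using t d(1) by (simp add: m_assoc diagonal_v_swap')
  finally show "cadj A (v t) \<otimes> x \<otimes> v t \<in> jproj"
    using d t diagonal_adj_conj[OF t d(1)] by (simp add: jproj_def J.I_l_closed J.I_r_closed)
qed

text \<open>With y = v_t^* x v_t the swap gives x v_t y = x x v_t. The form x a = x a y, weaker than
  commutation, is what right multiplication in \<open>junit_r_mult\<close> uses.\<close>

lemma jproj_v:
  assumes x: "x \<in> jproj" and t: "t \<in> carrier S"
  shows "\<exists>y\<in>jproj. x \<otimes> v t = x \<otimes> v t \<otimes> y"
proof (rule bexI[OF _ jproj_conj(2)[OF x t]])
  have d: "x \<in> diagonal" "x \<otimes> x = x" using x by (auto simp: jproj_def)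
  have "x \<otimes> v t \<otimes> (cadj A (v t) \<otimes> x \<otimes> v t) = x \<otimes> (v t \<otimes> (cadj A (v t) \<otimes> x \<otimes> v t))"
    using t d(1) by (simp add: m_assoc)
  also have "\<dots> = x \<otimes> x \<otimes> v t" using t d(1) by (simp add: m_assoc diagonal_v_swap')
  finally show "x \<otimes> v t = x \<otimes> v t \<otimes> (cadj A (v t) \<otimes> x \<otimes> v t)" using d by simp
qed

lemma jproj_adj_v:
  assumes x: "x \<in> jproj" and t: "t \<in> carrier S"
  shows "\<exists>y\<in>jproj. x \<otimes> cadj A (v t) = x \<otimes> cadj A (v t) \<otimes> y"
proof (rule bexI[OF _ jproj_conj(1)[OF x t]])
  have d: "x \<in> diagonal" "x \<otimes> x = x" using x by (auto simp: jproj_def)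
  have "x \<otimes> cadj A (v t) \<otimes> (v t \<otimes> x \<otimes> cadj A (v t)) = x \<otimes> x \<otimes> cadj A (v t)"
    using t d(1) by (simp add: m_assoc)
  then show "x \<otimes> cadj A (v t) = x \<otimes> cadj A (v t) \<otimes> (v t \<otimes> x \<otimes> cadj A (v t))" using d by simp
qed

lemma jproj_e:
  assumes x: "x \<in> jproj" and X: "X \<in> cideals S"
  shows "\<exists>y\<in>jproj. x \<otimes> e X = x \<otimes> e X \<otimes> y"
proof (rule bexI[OF _ x])
  have d: "x \<in> diagonal" "x \<otimes> x = x" using x by (auto simp: jproj_def)
  have "x \<otimes> e X \<otimes> x = x \<otimes> x \<otimes> e X" using X d(1) diagonal_commute_e[OF d(1) X] mult_lcomm[of x "e X" x] by (simp add: m_assoc)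
  then show "x \<otimes> e X = x \<otimes> e X \<otimes> x" using d by simp
qed

text \<open>The elements on which \<open>jproj\<close> acts as a right approximate unit. In a
  generated algebra this is a closed ideal containing \<open>belements\<close>, so it contains
  \<open>J\<close>, the smallest such ideal.\<close>

definition junit :: "'a set" where
  "junit = {x \<in> carrier A. \<forall>\<epsilon>>0. \<exists>y\<in>jproj. cnorm A (x \<otimes> (\<one> \<ominus> y)) < \<epsilon>}"

lemma zero_jproj: "\<zero> \<in> jproj"
  using diagonal_zero additive_subgroup.zero_closed[OF ideal.axioms(1)[OF J_ideal]] by (simp add: jproj_def)

lemma junit_closed: "norm_closed A junit"
proof (rule norm_closedI)
  fix x assume x: "x \<in> carrier A" and *: "\<And>\<epsilon>. \<epsilon> > 0 \<Longrightarrow> \<exists>y\<in>junit. cnorm A (x \<ominus> y) < \<epsilon>"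
  have "\<exists>y\<in>jproj. cnorm A (x \<otimes> (\<one> \<ominus> y)) < \<epsilon>" if "\<epsilon> > 0" for \<epsilon>
  proof -
    have e2: "\<epsilon> / 2 > 0" using that by simp
    obtain z where z: "z \<in> junit" "cnorm A (x \<ominus> z) < \<epsilon> / 2" using *[OF e2] by blast
    obtain y where y: "y \<in> jproj" "cnorm A (z \<otimes> (\<one> \<ominus> y)) < \<epsilon> / 2" using z(1) e2 unfolding junit_def by blast
    have c: "z \<in> carrier A" "y \<in> carrier A" "cnorm A (\<one> \<ominus> y) \<le> 1" using z y jproj_compl by (auto simp: junit_def)
    have "x \<otimes> (\<one> \<ominus> y) = (x \<ominus> z) \<otimes> (\<one> \<ominus> y) \<oplus> z \<otimes> (\<one> \<ominus> y)" using x c by algebra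
    then have "cnorm A (x \<otimes> (\<one> \<ominus> y)) \<le> cnorm A ((x \<ominus> z) \<otimes> (\<one> \<ominus> y)) + cnorm A (z \<otimes> (\<one> \<ominus> y))"
      using norm_triangle[of "(x \<ominus> z) \<otimes> (\<one> \<ominus> y)" "z \<otimes> (\<one> \<ominus> y)"] x c by simp
    also have "cnorm A ((x \<ominus> z) \<otimes> (\<one> \<ominus> y)) \<le> cnorm A (x \<ominus> z) * cnorm A (\<one> \<ominus> y)"
      using x c by (intro norm_mult) simp_all
    also have "\<dots> \<le> cnorm A (x \<ominus> z)"
      using c x norm_nonneg[of "x \<ominus> z"] mult_left_mono[of "cnorm A (\<one> \<ominus> y)" 1 "cnorm A (x \<ominus> z)"] by simp
    finally show ?thesis using y z by (intro bexI[of _ y]) auto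
  qed
  then show "x \<in> junit" using x by (simp add: junit_def)
qed (auto simp: junit_def)

lemma junit_add:
  assumes x: "x \<in> junit" and y: "y \<in> junit" shows "x \<oplus> y \<in> junit"
proof -
  have c: "x \<in> carrier A" "y \<in> carrier A" using x y by (auto simp: junit_def)
  have "\<exists>p\<in>jproj. cnorm A ((x \<oplus> y) \<otimes> (\<one> \<ominus> p)) < \<epsilon>" if "\<epsilon> > 0" for \<epsilon>
  proof -
    have e2: "\<epsilon> / 2 > 0" using that by simp
    obtain p q where p: "p \<in> jproj" "cnorm A (x \<otimes> (\<one> \<ominus> p)) < \<epsilon> / 2"
      and q: "q \<in> jproj" "cnorm A (y \<otimes> (\<one> \<ominus> q)) < \<epsilon> / 2" using x y e2 unfolding junit_def by blast
    obtain z where z: "z \<in> jproj" "(\<one> \<ominus> p) \<otimes> (\<one> \<ominus> z) = \<one> \<ominus> z" "(\<one> \<ominus> q) \<otimes> (\<one> \<ominus> z) = \<one> \<ominus> z"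
      using jproj_join[OF p(1) q(1)] by blast
    \<comment> \<open>Passing from r to the larger projection z only multiplies by 1 - z on the
      right, a contraction.\<close>
    have le: "cnorm A (w \<otimes> (\<one> \<ominus> z)) \<le> cnorm A (w \<otimes> (\<one> \<ominus> r))"
      if "w \<in> carrier A" "r \<in> jproj" "(\<one> \<ominus> r) \<otimes> (\<one> \<ominus> z) = \<one> \<ominus> z" for w r
    proof -
      have rc: "r \<in> carrier A" "z \<in> carrier A" "cnorm A (\<one> \<ominus> z) \<le> 1" using that z jproj_compl by auto
      have "w \<otimes> (\<one> \<ominus> z) = w \<otimes> (\<one> \<ominus> r) \<otimes> (\<one> \<ominus> z)" using that rc by (simp add: m_assoc)
      also have "cnorm A \<dots> \<le> cnorm A (w \<otimes> (\<one> \<ominus> r)) * cnorm A (\<one> \<ominus> z)" using that rc by (intro norm_mult) simp_all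
      also have "\<dots> \<le> cnorm A (w \<otimes> (\<one> \<ominus> r))"
        using rc that norm_nonneg[of "w \<otimes> (\<one> \<ominus> r)"] mult_left_mono[of "cnorm A (\<one> \<ominus> z)" 1 "cnorm A (w \<otimes> (\<one> \<ominus> r))"] by simp
      finally show ?thesis .
    qed
    have "cnorm A ((x \<oplus> y) \<otimes> (\<one> \<ominus> z)) \<le> cnorm A (x \<otimes> (\<one> \<ominus> z)) + cnorm A (y \<otimes> (\<one> \<ominus> z))"
      using c z(1) jproj_compl norm_triangle[of "x \<otimes> (\<one> \<ominus> z)" "y \<otimes> (\<one> \<ominus> z)"] by (simp add: l_distr)
    then show ?thesis using le[OF c(1) p(1) z(2)] le[OF c(2) q(1) z(3)] p q z(1) by (intro bexI[of _ z]) auto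
  qed
  then show ?thesis using c by (simp add: junit_def)
qed

lemma junit_l_mult:
  assumes x: "x \<in> junit" and a: "a \<in> carrier A" shows "a \<otimes> x \<in> junit"
proof -
  have c: "x \<in> carrier A" using x by (auto simp: junit_def)
  have "\<exists>p\<in>jproj. cnorm A (a \<otimes> x \<otimes> (\<one> \<ominus> p)) < \<epsilon>" if "\<epsilon> > 0" for \<epsilon>
  proof -
    \<comment> \<open>The added 1 keeps the divisor positive when a = 0.\<close>
    have n: "0 < cnorm A a + 1" using norm_nonneg[OF a] by simp
    then have "\<epsilon> / (cnorm A a + 1) > 0" using that by simp
    then obtain p where p: "p \<in> jproj" "cnorm A (x \<otimes> (\<one> \<ominus> p)) < \<epsilon> / (cnorm A a + 1)" using x unfolding junit_def by blast
    have pc: "p \<in> carrier A" using p jproj_compl by blast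
    have "cnorm A (a \<otimes> x \<otimes> (\<one> \<ominus> p)) \<le> cnorm A a * cnorm A (x \<otimes> (\<one> \<ominus> p))"
      using norm_mult[of a "x \<otimes> (\<one> \<ominus> p)"] a c pc by (simp add: m_assoc)
    also have "\<dots> \<le> (cnorm A a + 1) * cnorm A (x \<otimes> (\<one> \<ominus> p))"
      using norm_nonneg[of "x \<otimes> (\<one> \<ominus> p)"] c pc by (intro mult_right_mono) simp_all
    also have "\<dots> < \<epsilon>" using p(2) n by (simp add: field_simps)
    finally show ?thesis using p(1) by blast
  qed
  then show ?thesis using a c by (simp add: junit_def)
qed

text \<open>The element x a (1 - q) splits into x (1 - p) a (1 - q) and x p a (1 - q). The first
  part is small by the choice of p; the second vanishes once q absorbs p a on the right.\<close>

lemma junit_r_mult: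
  assumes x: "x \<in> junit" and a: "a \<in> carrier A"
    and swap: "\<And>p. p \<in> jproj \<Longrightarrow> \<exists>q\<in>jproj. p \<otimes> a = p \<otimes> a \<otimes> q"
  shows "x \<otimes> a \<in> junit"
proof -
  have c: "x \<in> carrier A" using x by (auto simp: junit_def)
  have "\<exists>p\<in>jproj. cnorm A (x \<otimes> a \<otimes> (\<one> \<ominus> p)) < \<epsilon>" if "\<epsilon> > 0" for \<epsilon>
  proof -
    have n: "0 < cnorm A a + 1" using norm_nonneg[OF a] by simp
    then have "\<epsilon> / (cnorm A a + 1) > 0" using that by simp
    then obtain p where p: "p \<in> jproj" "cnorm A (x \<otimes> (\<one> \<ominus> p)) < \<epsilon> / (cnorm A a + 1)" using x unfolding junit_def by blast
    obtain q where q: "q \<in> jproj" "p \<otimes> a = p \<otimes> a \<otimes> q" using swap[OF p(1)] by blast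
    have pc: "p \<in> carrier A" "q \<in> carrier A" "cnorm A (\<one> \<ominus> q) \<le> 1" using p q jproj_compl by blast+
    have "p \<otimes> a \<otimes> (\<one> \<ominus> q) = \<zero>"
      using pc a arg_cong[OF q(2), of "\<lambda>z. z \<ominus> p \<otimes> a \<otimes> q"] by (simp add: a_minus_def r_distr r_minus r_neg)
    moreover have "x \<otimes> a \<otimes> (\<one> \<ominus> q) = x \<otimes> (\<one> \<ominus> p) \<otimes> (a \<otimes> (\<one> \<ominus> q)) \<oplus> x \<otimes> (p \<otimes> a \<otimes> (\<one> \<ominus> q))"
      using c a pc by algebra
    ultimately have "cnorm A (x \<otimes> a \<otimes> (\<one> \<ominus> q)) = cnorm A (x \<otimes> (\<one> \<ominus> p) \<otimes> (a \<otimes> (\<one> \<ominus> q)))"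
      using c a pc by simp
    also have "\<dots> \<le> cnorm A (x \<otimes> (\<one> \<ominus> p)) * cnorm A (a \<otimes> (\<one> \<ominus> q))" using c a pc by (intro norm_mult) simp_all
    also have "\<dots> \<le> cnorm A (x \<otimes> (\<one> \<ominus> p)) * (cnorm A a + 1)"
    proof (rule mult_left_mono)
      have "cnorm A (a \<otimes> (\<one> \<ominus> q)) \<le> cnorm A a * cnorm A (\<one> \<ominus> q)" using a pc by (intro norm_mult) simp_all
      also have "\<dots> \<le> cnorm A a" using pc norm_nonneg[OF a] mult_left_mono[of "cnorm A (\<one> \<ominus> q)" 1 "cnorm A a"] by simp
      finally show "cnorm A (a \<otimes> (\<one> \<ominus> q)) \<le> cnorm A a + 1" by simp
    qed (use norm_nonneg c pc in simp)
    also have "\<dots> < \<epsilon>" using p(2) n by (simp add: field_simps)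
    finally show ?thesis using q(1) by blast
  qed
  then show ?thesis using a c by (simp add: junit_def)
qed

lemma junit_belements: "belements \<subseteq> junit"
proof
  fix x assume x: "x \<in> belements"
  then have "x \<otimes> x = x" by (auto simp: belements_def foundation_set_def bprod_idem)
  then have p: "x \<in> jproj" using x belements_diagonal belements_J by (auto simp: jproj_def)
  then have "x \<otimes> (\<one> \<ominus> x) = \<zero>" using jproj_compl(1)[OF p] \<open>x \<otimes> x = x\<close> by (simp add: a_minus_def r_distr r_minus r_neg)
  then show "x \<in> junit" using p jproj_compl(1)[OF p] by (auto simp: junit_def intro!: bexI[of _ x])
qed

end

text \<open>Generation is stated as an induction principle for closed unital subalgebras, the form
  in which the right multipliers of \<open>junit\<close> are shown to be the whole algebra.\<close>

locale generating_lcm_rep = lcm_rep +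
  assumes generates: "\<And>M. \<lbrakk>M \<subseteq> carrier A; norm_closed A M; \<one> \<in> M;
      \<And>x y. x \<in> M \<Longrightarrow> y \<in> M \<Longrightarrow> x \<oplus> y \<in> M; \<And>x y. x \<in> M \<Longrightarrow> y \<in> M \<Longrightarrow> x \<otimes> y \<in> M;
      \<And>x c. x \<in> M \<Longrightarrow> cscale A c x \<in> M;
      \<And>s. s \<in> carrier S \<Longrightarrow> v s \<in> M; \<And>s. s \<in> carrier S \<Longrightarrow> cadj A (v s) \<in> M;
      \<And>X. X \<in> cideals S \<Longrightarrow> e X \<in> M\<rbrakk> \<Longrightarrow> M = carrier A"
begin

text \<open>The right multipliers of \<open>junit\<close> form a closed unital subalgebra, and the
  generators belong to it by the absorption lemmas \<open>jproj_v\<close>,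
  \<open>jproj_adj_v\<close> and \<open>jproj_e\<close>.\<close>

lemma junit_mult_closed:
  assumes x: "x \<in> junit" and a: "a \<in> carrier A" shows "x \<otimes> a \<in> junit"
proof -
  let ?M = "{a \<in> carrier A. \<forall>x\<in>junit. x \<otimes> a \<in> junit}"
  have c: "x \<in> carrier A" if "x \<in> junit" for x using that by (simp add: junit_def)
  have "?M = carrier A"
  proof (rule generates)
    show "norm_closed A ?M"
    proof (rule norm_closedI)
      fix b assume b: "b \<in> carrier A" and *: "\<And>\<epsilon>. \<epsilon> > 0 \<Longrightarrow> \<exists>y\<in>?M. cnorm A (b \<ominus> y) < \<epsilon>"
      have "x \<otimes> b \<in> junit" if x: "x \<in> junit" for x
      proof (rule norm_closedD[OF junit_closed])
        fix \<epsilon> :: real assume \<epsilon>: "\<epsilon> > 0"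
        have n: "0 < cnorm A x + 1" using norm_nonneg[OF c[OF x]] by simp
        then have "\<epsilon> / (cnorm A x + 1) > 0" using \<epsilon> by simp
        then obtain y where y: "y \<in> ?M" "cnorm A (b \<ominus> y) < \<epsilon> / (cnorm A x + 1)" using * by meson
        have yc: "y \<in> carrier A" using y by simp
        have "x \<otimes> b \<ominus> x \<otimes> y = x \<otimes> (b \<ominus> y)" using b yc c[OF x] by (simp add: a_minus_def r_distr r_minus)
        then have "cnorm A (x \<otimes> b \<ominus> x \<otimes> y) \<le> cnorm A x * cnorm A (b \<ominus> y)"
          using norm_mult[of x "b \<ominus> y"] b yc c[OF x] by simp
        also have "\<dots> \<le> (cnorm A x + 1) * cnorm A (b \<ominus> y)"
          using norm_nonneg[of "b \<ominus> y"] b yc by (intro mult_right_mono) simp_all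
        also have "\<dots> < \<epsilon>" using y(2) n by (simp add: field_simps)
        finally show "\<exists>z\<in>junit. cnorm A (x \<otimes> b \<ominus> z) < \<epsilon>" using y(1) x by blast
      qed (use b c[OF x] in \<open>auto simp: junit_def\<close>)
      then show "b \<in> ?M" using b by simp
    qed auto
    show "cscale A k y \<in> ?M" if "y \<in> ?M" for y k
    proof -
      have "x \<otimes> cscale A k y \<in> junit" if x: "x \<in> junit" for x
      proof -
        \<comment> \<open>The scalar is moved to the left factor, where \<open>junit_l_mult\<close>
          applies.\<close>
        have "cscale A k \<one> \<otimes> (x \<otimes> y) \<in> junit"
          by (rule junit_l_mult) (use x \<open>y \<in> ?M\<close> in \<open>auto intro: scale_closed\<close>)
        then show ?thesis using c[OF x] \<open>y \<in> ?M\<close> by (simp add: scale_mult_left scale_mult_right)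
      qed
      then show ?thesis using that by (simp add: scale_closed)
    qed
    show "v s \<in> ?M" "cadj A (v s) \<in> ?M" if "s \<in> carrier S" for s
      using that by (auto intro!: junit_r_mult jproj_v jproj_adj_v)
    show "e X \<in> ?M" if "X \<in> cideals S" for X using that by (auto intro!: junit_r_mult jproj_e)
  qed (auto simp: c r_distr junit_add simp flip: m_assoc)
  then show ?thesis using x a by blast
qed

lemma junit_ideal: "ideal junit A"
proof (rule idealI)
  show "subgroup junit (add_monoid A)"
  proof (rule add.subgroupI)
    have "\<zero> \<in> junit" using zero_jproj by (auto simp: junit_def intro!: bexI[of _ \<zero>])
    then show "junit \<noteq> {}" by blast
    show "\<ominus> x \<in> junit" if "x \<in> junit" for x
      using junit_l_mult[OF that, of "\<ominus> \<one>"] that by (simp add: junit_def l_minus)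
  qed (auto simp: junit_add, simp add: junit_def)
qed (auto simp: junit_l_mult junit_mult_closed ring_axioms)

sublocale J: cstar_ideal_unit A J
proof
  fix x and \<epsilon> :: real assume x: "x \<in> J" "\<epsilon> > 0"
  have "x \<in> junit"
    using x(1) junit_ideal junit_closed junit_belements unfolding closed_ideal_gen_def by blast
  then obtain y where "y \<in> jproj" "cnorm A (x \<otimes> (\<one> \<ominus> y)) < \<epsilon>" using x(2) unfolding junit_def by blast
  then show "\<exists>y\<in>J. y \<otimes> y = y \<and> cadj A y = y \<and> cnorm A (x \<otimes> (\<one> \<ominus> y)) < \<epsilon>"
    by (intro bexI[of _ y]) (auto simp: jproj_def diagonal_adj)
qed

end

section \<open>From the semigroup to the dynamical system\<close>

lemma (in cstar_algebra) ev_diff: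
  fixes f :: "'x \<Rightarrow> 'a" and a b :: "'x free_star"
  assumes f: "\<And>x. f x \<in> carrier A"
  shows "eval_in A f (a - b) = eval_in A f a \<ominus> eval_in A f b"
proof -
  have "eval_in A f (a - b) \<oplus> eval_in A f b = eval_in A f a" 
    using ev_add[where f = f and a = "a - b" and b = b, OF f] by simp
  then have "eval_in A f a \<ominus> eval_in A f b = eval_in A f (a - b) \<oplus> eval_in A f b \<ominus> eval_in A f b" by simp
  also have "\<dots> = eval_in A f (a - b)"
    using ev_closed[where f = f, OF f] by (simp add: a_minus_def a_assoc r_neg)
  finally show ?thesis ..
qed

text \<open>Disjoint ideals have orthogonal projections, so each factor 1 - e_t fixes e_s. In
  \<open>E_CNP3\<close> this turns the sum over a transversal into a product over a foundation
  set.\<close>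

lemma (in lcm_rep) e_bprod_orthogonal:
  assumes "s \<in> carrier S" "set ss \<subseteq> carrier S" "\<And>t. t \<in> set ss \<Longrightarrow> pideal S s \<inter> pideal S t = {}"
  shows "e (pideal S s) \<otimes> bprod ss = e (pideal S s)"
  using assms(2,3)
proof (induction ss)
  case (Cons t ss)
  have c: "t \<in> carrier S" "e (pideal S t) \<in> carrier A" "e (pideal S s) \<in> carrier A" "bprod ss \<in> carrier A"
    using Cons.prems(1) assms(1) bprod_diagonal[of ss] by auto
  have "e (pideal S s) \<otimes> (\<one> \<ominus> e (pideal S t)) = e (pideal S s)"
    using Cons.prems(2)[of t] c assms(1) by (simp add: a_minus_def r_distr r_minus e_mult e_empty)
  then have "e (pideal S s) \<otimes> bprod (t # ss) = e (pideal S s) \<otimes> bprod ss" using c by (simp flip: m_assoc)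
  then show ?case using Cons by simp
qed (use assms(1) in simp)

text \<open>The factor 1 - e_t kills x wherever it stands in the list, since the diagonal is
  commutative.\<close>

lemma (in lcm_rep) bprod_mult_zero:
  assumes "t \<in> set ss" "set ss \<subseteq> carrier S" "x \<in> diagonal" "e (pideal S t) \<otimes> x = x"
  shows "bprod ss \<otimes> x = \<zero>"
  using assms(1,2)
proof (induction ss)
  case (Cons s ss)
  have c: "s \<in> carrier S" "bprod ss \<in> diagonal" using Cons.prems bprod_diagonal[of ss] by auto
  have d: "\<one> \<ominus> e (pideal S s) \<in> diagonal" using c by (intro diagonal_compl diagonal_e) simp
  show ?case
  proof (cases "s = t")
    case True
    have "bprod (s # ss) \<otimes> x = bprod ss \<otimes> ((\<one> \<ominus> e (pideal S s)) \<otimes> x)"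
      using diagonal_commute[OF d c(2)] diagonal_closed[OF d] diagonal_closed[OF c(2)] assms(3) by (simp add: m_assoc)
    also have "(\<one> \<ominus> e (pideal S s)) \<otimes> x = \<zero>" using assms(3,4) c True by (simp add: a_minus_def l_distr l_minus r_neg)
    finally show ?thesis using c by simp
  next
    case False
    then show ?thesis using Cons diagonal_closed[OF d] diagonal_closed[OF c(2)] assms(3) by (simp add: m_assoc)
  qed
qed simp

locale system_rep = irreversible_system G P \<theta> + R?: lcm_rep A "semidirect G P \<theta>" v e
  for G :: "'g monoid" and P :: "'p monoid" and \<theta> and A :: "('a, 'm) cstar_scheme" and v e
begin

text \<open>Letters outside the presentation go to zero, as \<open>all_relations\<close>
  demands.\<close>

definition letter_map :: "('g, 'p) cnp_letter \<Rightarrow> 'a" where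
  "letter_map x = (case x of
     LetterU g \<Rightarrow> if g \<in> carrier G then v (g, \<one>\<^bsub>P\<^esub>) else \<zero>\<^bsub>A\<^esub>
   | LetterS p \<Rightarrow> if p \<in> carrier P then v (\<one>\<^bsub>G\<^esub>, p) else \<zero>\<^bsub>A\<^esub>)"

lemma letter_map_closed: "letter_map x \<in> carrier A"
  by (simp add: letter_map_def split: cnp_letter.split)

abbreviation "E \<equiv> eval_in A letter_map"

lemmas E_scl = ev_scl[where f = letter_map, OF letter_map_closed]

lemmas E_simps = ev_add[where f = letter_map, OF letter_map_closed] ev_diff[where f = letter_map, OF letter_map_closed] ev_mult[where f = letter_map, OF letter_map_closed]
  ev_adj[where f = letter_map, OF letter_map_closed] ev_one[where f = letter_map, OF letter_map_closed] ev_zero[where f = letter_map, OF letter_map_closed]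

lemma E_closed [simp]: "E a \<in> carrier A"
  by (rule ev_closed[where f = letter_map, OF letter_map_closed])

lemma E_gen: "g \<in> carrier G \<Longrightarrow> E (\<u> g) = v (g, \<one>\<^bsub>P\<^esub>)" "p \<in> carrier P \<Longrightarrow> E (\<s> p) = v (\<one>\<^bsub>G\<^esub>, p)"
  by (simp_all add: ev_gen[where f = letter_map, OF letter_map_closed]) (simp_all add: letter_map_def)

lemma E_outside: "x \<notin> cnp_letters G P \<Longrightarrow> E (gen x) = \<zero>\<^bsub>A\<^esub>"
  by (cases x) (auto simp: ev_gen[where f = letter_map, OF letter_map_closed] cnp_letters_def letter_map_def)

lemma v_split: "g \<in> carrier G \<Longrightarrow> p \<in> carrier P \<Longrightarrow> v (g, \<one>\<^bsub>P\<^esub>) \<otimes>\<^bsub>A\<^esub> v (\<one>\<^bsub>G\<^esub>, p) = v (g, p)"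
  by (simp add: v_mult)

lemma v_unitary:
  assumes g: "g \<in> carrier G"
  shows "cadj A (v (g, \<one>\<^bsub>P\<^esub>)) = v (inv\<^bsub>G\<^esub> g, \<one>\<^bsub>P\<^esub>)"
proof -
  have "v (g, \<one>\<^bsub>P\<^esub>) \<otimes>\<^bsub>A\<^esub> v (inv\<^bsub>G\<^esub> g, \<one>\<^bsub>P\<^esub>) = \<one>\<^bsub>A\<^esub>"
    using g v_one by (simp add: v_mult \<theta>_one)
  then show ?thesis using v_isometry'[of "(g, \<one>\<^bsub>P\<^esub>)" "v (inv\<^bsub>G\<^esub> g, \<one>\<^bsub>P\<^esub>)"] g by simp
qed

text \<open>These relations hold exactly, not merely modulo \<open>J\<close>. CNP 1 is the product
  of the semigroup; CNP 2 is the rule for v_s^* v_t at s = (1, p) and t = (g, q), whose LCM comes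
  from \<open>pideal_Int\<close>.\<close>

lemma E_rep:
  assumes "r \<in> rep_relations G P \<union> CNP1 G P \<theta> \<union> CNP2 G P \<theta>"
  shows "E r = \<zero>\<^bsub>A\<^esub>"
proof -
  have 1: "x = y \<Longrightarrow> y \<in> carrier A \<Longrightarrow> x \<ominus>\<^bsub>A\<^esub> y = \<zero>\<^bsub>A\<^esub>" for x y by (simp add: diff_eq_zero_iff)
  have "E r = \<zero>\<^bsub>A\<^esub>" if "r \<in> rep_relations G P"
    using that v_one unfolding rep_relations_def
    by (auto simp: E_simps E_gen v_isometry v_unitary v_mult \<theta>_one intro!: 1)
  moreover have "E r = \<zero>\<^bsub>A\<^esub>" if "r \<in> CNP1 G P \<theta>"
    using that unfolding CNP1_def by (auto simp: E_simps E_gen v_mult \<theta>_one intro!: 1)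
  moreover have "E r = \<zero>\<^bsub>A\<^esub>" if "r \<in> CNP2 G P \<theta>"
  proof -
    have lhs: "cadj A (v (\<one>\<^bsub>G\<^esub>, p)) \<otimes>\<^bsub>A\<^esub> v (g, \<one>\<^bsub>P\<^esub>) \<otimes>\<^bsub>A\<^esub> v (\<one>\<^bsub>G\<^esub>, q) = cadj A (v (\<one>\<^bsub>G\<^esub>, p)) \<otimes>\<^bsub>A\<^esub> v (g, q)"
      if "p \<in> carrier P" "q \<in> carrier P" "g \<in> carrier G" for p q g
      using that by (simp add: m_assoc v_split)
    from \<open>r \<in> CNP2 G P \<theta>\<close> consider
      (fac) p q g k l d p' q' where "r = adj (\<s> p) * \<u> g * \<s> q - \<u> k * \<s> q' * adj (\<s> p') * \<u> l"
        "p \<in> carrier P" "q \<in> carrier P" "g \<in> carrier G" "k \<in> carrier G" "l \<in> carrier G"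
        "g = \<theta> p k \<otimes>\<^bsub>G\<^esub> \<theta> q l" "d \<in> carrier P" "d gcdof\<^bsub>P\<^esub> p q" "p' \<in> carrier P" "q' \<in> carrier P"
        "p = d \<otimes>\<^bsub>P\<^esub> p'" "q = d \<otimes>\<^bsub>P\<^esub> q'"
    | (nofac) p q g where "r = adj (\<s> p) * \<u> g * \<s> q" "p \<in> carrier P" "q \<in> carrier P" "g \<in> carrier G"
        "\<not> (\<exists>k\<in>carrier G. \<exists>l\<in>carrier G. g = \<theta> p k \<otimes>\<^bsub>G\<^esub> \<theta> q l)"
      unfolding CNP2_def by blast
    then show ?thesis
    proof cases
      case fac
      have kl: "inv\<^bsub>G\<^esub> \<one>\<^bsub>G\<^esub> \<otimes>\<^bsub>G\<^esub> g = \<theta> p k \<otimes>\<^bsub>G\<^esub> \<theta> q l" using fac(4,7) by simp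
      note meet = pideal_Int[OF G.one_closed fac(4,5,6,8,10,11,12,13,9) kl]
      have c: "(\<one>\<^bsub>G\<^esub>, p) \<in> carrier S" "(g, q) \<in> carrier S" "(k, q') \<in> carrier S" "(inv\<^bsub>G\<^esub> l, p') \<in> carrier S"
        using fac(2-6,10,11) by simp_all
      have "cadj A (v (\<one>\<^bsub>G\<^esub>, p)) \<otimes>\<^bsub>A\<^esub> v (g, q) = v (k, q') \<otimes>\<^bsub>A\<^esub> cadj A (v (inv\<^bsub>G\<^esub> l, p'))"
        by (rule adj_v_v_lcm[OF c meet(1)[symmetric] meet(2)])
      also have "v (k, q') = v (k, \<one>\<^bsub>P\<^esub>) \<otimes>\<^bsub>A\<^esub> v (\<one>\<^bsub>G\<^esub>, q')" using fac(5,11) by (simp add: v_split)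
      also have "cadj A (v (inv\<^bsub>G\<^esub> l, p')) = cadj A (v (\<one>\<^bsub>G\<^esub>, p')) \<otimes>\<^bsub>A\<^esub> v (l, \<one>\<^bsub>P\<^esub>)"
        using fac(6,10) v_split[of "inv\<^bsub>G\<^esub> l" p'] adj_mult[of "v (inv\<^bsub>G\<^esub> l, \<one>\<^bsub>P\<^esub>)" "v (\<one>\<^bsub>G\<^esub>, p')"]
        by (simp add: v_unitary)
      finally show ?thesis using fac(2-6,10,11) unfolding fac(1)
        by (simp add: E_simps E_gen m_assoc v_split diff_eq_zero_iff)
    next
      case nofac
      have "pideal S (\<one>\<^bsub>G\<^esub>, p) \<inter> pideal S (g, q) = {}"
        by (rule pideal_Int_disjoint) (use nofac in simp_all)
      then have "cadj A (v (\<one>\<^bsub>G\<^esub>, p)) \<otimes>\<^bsub>A\<^esub> v (g, q) = \<zero>\<^bsub>A\<^esub>"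
        by (intro adj_v_v_disjoint) (use nofac in simp_all)
      then show ?thesis using nofac(2-4) unfolding nofac(1) by (simp add: E_simps E_gen lhs)
    qed
  qed
  ultimately show ?thesis using assms by blast
qed

text \<open>For g in a transversal the elements (g, p) generate pairwise disjoint ideals, because
  distinct cosets are disjoint, and form a foundation set, because the cosets exhaust G. For
  orthogonal projections the product of the complements is 1 minus the sum.\<close>

lemma E_CNP3:
  assumes "r \<in> CNP3 G P \<theta>"
  shows "E r \<in> belements"
proof -
  obtain p T where r: "r = 1 - (\<Sum>g\<in>T. \<u> g * \<s> p * adj (\<s> p) * adj (\<u> g))"
    and p: "p \<in> carrier P" and fin: "finite (lcosets\<^bsub>G\<^esub> (\<theta> p ` carrier G))" and T: "T \<subseteq> carrier G"
    and bij: "bij_betw (\<lambda>g. g <#\<^bsub>G\<^esub> (\<theta> p ` carrier G)) T (lcosets\<^bsub>G\<^esub> (\<theta> p ` carrier G))"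
    using assms unfolding CNP3_def by blast
  have "finite T" using fin bij bij_betw_finite by blast
  then obtain gs where gs: "set gs = T" "distinct gs" using finite_distinct_list by blast
  interpret \<theta>: group_hom G G "\<theta> p" by (rule \<theta>_group_hom[OF p])
  have H: "subgroup (\<theta> p ` carrier G) G" by (rule \<theta>.img_is_subgroup)
  have disj: "pideal S (g, p) \<inter> pideal S (h, p) = {}" if gh: "g \<in> T" "h \<in> T" "g \<noteq> h" for g h
  proof (rule ccontr)
    assume "pideal S (g, p) \<inter> pideal S (h, p) \<noteq> {}"
    then obtain x y where xy: "x \<in> carrier G" "y \<in> carrier G" "g \<otimes>\<^bsub>G\<^esub> \<theta> p x = h \<otimes>\<^bsub>G\<^esub> \<theta> p y"
      by (auto simp: mem_pideal) metis
    have gc: "g \<in> carrier G" "h \<in> carrier G" using gh T by auto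
    have "g \<otimes>\<^bsub>G\<^esub> \<theta> p x \<in> g <#\<^bsub>G\<^esub> (\<theta> p ` carrier G)" using xy(1) by (auto simp: G.l_coset_image)
    moreover have "g \<otimes>\<^bsub>G\<^esub> \<theta> p x \<in> h <#\<^bsub>G\<^esub> (\<theta> p ` carrier G)" unfolding xy(3) using xy(2) by (auto simp: G.l_coset_image)
    ultimately have "g <#\<^bsub>G\<^esub> (\<theta> p ` carrier G) = h <#\<^bsub>G\<^esub> (\<theta> p ` carrier G)"
      using G.l_repr_independence[OF _ gc(1) H] G.l_repr_independence[OF _ gc(2) H] by metis
    then show False using bij gh unfolding bij_betw_def by (meson inj_onD)
  qed
  have "set hs \<subseteq> T \<Longrightarrow> distinct hs \<Longrightarrow>
      E (1 - (\<Sum>g\<in>set hs. \<u> g * \<s> p * adj (\<s> p) * adj (\<u> g))) = bprod (map (\<lambda>g. (g, p)) hs)" for hs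
  proof (induction hs)
    case Nil
    then show ?case by (simp add: E_simps)
  next
    case (Cons g hs)
    let ?h = "\<lambda>g. \<u> g * \<s> p * adj (\<s> p) * adj (\<u> g)"
    let ?b = "bprod (map (\<lambda>g. (g, p)) hs)"
    have g: "g \<in> carrier G" and gp: "(g, p) \<in> carrier S" using Cons.prems T p by auto
    have sub: "set (map (\<lambda>g. (g, p)) hs) \<subseteq> carrier S" using Cons.prems T p by auto
    have b: "?b \<in> carrier A" using bprod_diagonal[OF sub] by simp
    have IH: "E (1 - sum ?h (set hs)) = ?b" using Cons by simp
    have Eh: "E (?h g) = e (pideal S (g, p))"
      unfolding e_pideal[OF gp] v_split[OF g p, symmetric] using g p by (simp add: E_simps E_gen adj_mult m_assoc)
    have "1 - sum ?h (set (g # hs)) = (1 - sum ?h (set hs)) - ?h g" using Cons.prems by simp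
    then have "E (1 - sum ?h (set (g # hs))) = ?b \<ominus>\<^bsub>A\<^esub> e (pideal S (g, p))"
      using ev_diff[where f = letter_map and a = "1 - sum ?h (set hs)" and b = "?h g", OF letter_map_closed]
      by (simp only: IH Eh)
    also have "e (pideal S (g, p)) = e (pideal S (g, p)) \<otimes>\<^bsub>A\<^esub> ?b"
    proof (rule e_bprod_orthogonal[OF gp sub, symmetric])
      fix t assume "t \<in> set (map (\<lambda>g. (g, p)) hs)"
      then obtain h where "h \<in> set hs" "t = (h, p)" by auto
      then show "pideal S (g, p) \<inter> pideal S t = {}" using Cons.prems disj[of g h] by auto
    qed
    also have "?b \<ominus>\<^bsub>A\<^esub> e (pideal S (g, p)) \<otimes>\<^bsub>A\<^esub> ?b = bprod (map (\<lambda>g. (g, p)) (g # hs))"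
      using b gp by (simp add: a_minus_def R.l_distr R.l_minus del: S_simps)
    finally show ?case .
  qed
  from this[of gs] have Er: "E r = bprod (map (\<lambda>g. (g, p)) gs)" using gs r by simp
  have "distinct (map (\<lambda>g. (g, p)) gs)" using gs by (simp add: distinct_map inj_on_def)
  moreover have "foundation_set S (set (map (\<lambda>g. (g, p)) gs))"
    unfolding foundation_set_def
  proof (intro conjI ballI)
    fix s assume "s \<in> carrier S"
    then obtain h q where s: "s = (h, q)" "h \<in> carrier G" "q \<in> carrier P" by auto
    have "h <#\<^bsub>G\<^esub> (\<theta> p ` carrier G) \<in> lcosets\<^bsub>G\<^esub> (\<theta> p ` carrier G)" using s by (auto simp: LCOSETS_def)
    then obtain g where g: "g \<in> T" "h <#\<^bsub>G\<^esub> (\<theta> p ` carrier G) = g <#\<^bsub>G\<^esub> (\<theta> p ` carrier G)"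
      using bij unfolding bij_betw_def by blast
    have "h \<in> h <#\<^bsub>G\<^esub> (\<theta> p ` carrier G)"
      using s(2) p by (auto simp: G.l_coset_image intro!: image_eqI[of _ _ "\<one>\<^bsub>G\<^esub>"])
    then obtain x where x: "x \<in> carrier G" "h = g \<otimes>\<^bsub>G\<^esub> \<theta> p x" unfolding g(2) by (auto simp: G.l_coset_image)
    \<comment> \<open>The common element is (h, q)(1, p) = (g, p)(x, q), by commutativity of
      P.\<close>
    have "(h, q \<otimes>\<^bsub>P\<^esub> p) \<in> pideal S s"
      unfolding s(1) mem_pideal using s p by (intro bexI[of _ "\<one>\<^bsub>G\<^esub>"] bexI[of _ p]) auto
    moreover have "(h, q \<otimes>\<^bsub>P\<^esub> p) \<in> pideal S (g, p)"
      unfolding mem_pideal using s p x by (intro bexI[of _ x] bexI[of _ q]) (auto simp: P.m_comm)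
    ultimately show "\<exists>t\<in>set (map (\<lambda>g. (g, p)) gs). pideal S s \<inter> pideal S t \<noteq> {}"
      using g(1) gs(1) by auto
  qed (use gs T p in auto)
  ultimately show ?thesis unfolding Er belements_def by blast
qed

lemma E_relations:
  assumes "r \<in> all_relations (cnp_letters G P) (cnp_relations G P \<theta>)"
  shows "E r \<in> J"
proof -
  have zero: "\<zero>\<^bsub>A\<^esub> \<in> J" using additive_subgroup.zero_closed[OF ideal.axioms(1)[OF J_ideal]] .
  consider "r \<in> rep_relations G P \<union> CNP1 G P \<theta> \<union> CNP2 G P \<theta>" | "r \<in> CNP3 G P \<theta>" | x where "r = gen x" "x \<notin> cnp_letters G P"
    using assms unfolding all_relations_def cnp_relations_def by blast
  then show ?thesis
  proof cases
    case 1
    then show ?thesis using zero by (simp only: E_rep)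
  next
    case 2
    then show ?thesis using E_CNP3 belements_J by blast
  next
    case 3
    then show ?thesis using zero by (simp add: E_outside)
  qed
qed

end

section \<open>From the dynamical system to the semigroup\<close>

locale cnp_rep = irreversible_system G P \<theta> + A?: cstar_algebra A
  for G :: "'g monoid" and P :: "'p monoid" and \<theta> and A :: "('a, 'm) cstar_scheme" +
  fixes u :: "'g \<Rightarrow> 'a" and s :: "'p \<Rightarrow> 'a"
  assumes u_closed [simp]: "\<And>g. g \<in> carrier G \<Longrightarrow> u g \<in> carrier A"
    and s_closed [simp]: "\<And>p. p \<in> carrier P \<Longrightarrow> s p \<in> carrier A"
    and u_isometry: "\<And>g. g \<in> carrier G \<Longrightarrow> cadj A (u g) \<otimes>\<^bsub>A\<^esub> u g = \<one>\<^bsub>A\<^esub>"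
    and u_coisometry: "\<And>g. g \<in> carrier G \<Longrightarrow> u g \<otimes>\<^bsub>A\<^esub> cadj A (u g) = \<one>\<^bsub>A\<^esub>"
    and u_mult: "\<And>g h. g \<in> carrier G \<Longrightarrow> h \<in> carrier G \<Longrightarrow> u g \<otimes>\<^bsub>A\<^esub> u h = u (g \<otimes>\<^bsub>G\<^esub> h)"
    and s_isometry: "\<And>p. p \<in> carrier P \<Longrightarrow> cadj A (s p) \<otimes>\<^bsub>A\<^esub> s p = \<one>\<^bsub>A\<^esub>"
    and s_mult: "\<And>p q. p \<in> carrier P \<Longrightarrow> q \<in> carrier P \<Longrightarrow> s p \<otimes>\<^bsub>A\<^esub> s q = s (p \<otimes>\<^bsub>P\<^esub> q)"
    and s_one: "s \<one>\<^bsub>P\<^esub> = \<one>\<^bsub>A\<^esub>"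
    and cnp1: "\<And>p g. p \<in> carrier P \<Longrightarrow> g \<in> carrier G \<Longrightarrow> s p \<otimes>\<^bsub>A\<^esub> u g = u (\<theta> p g) \<otimes>\<^bsub>A\<^esub> s p"
    and cnp2: "\<And>p q g k l d p' q'. \<lbrakk>p \<in> carrier P; q \<in> carrier P; g \<in> carrier G; k \<in> carrier G; l \<in> carrier G;
        g = \<theta> p k \<otimes>\<^bsub>G\<^esub> \<theta> q l; d \<in> carrier P; d gcdof\<^bsub>P\<^esub> p q; p' \<in> carrier P; q' \<in> carrier P;
        p = d \<otimes>\<^bsub>P\<^esub> p'; q = d \<otimes>\<^bsub>P\<^esub> q'\<rbrakk> \<Longrightarrow>
        cadj A (s p) \<otimes>\<^bsub>A\<^esub> u g \<otimes>\<^bsub>A\<^esub> s q = u k \<otimes>\<^bsub>A\<^esub> s q' \<otimes>\<^bsub>A\<^esub> cadj A (s p') \<otimes>\<^bsub>A\<^esub> u l"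
    and cnp2_zero: "\<And>p q g. \<lbrakk>p \<in> carrier P; q \<in> carrier P; g \<in> carrier G;
        \<not> (\<exists>k\<in>carrier G. \<exists>l\<in>carrier G. g = \<theta> p k \<otimes>\<^bsub>G\<^esub> \<theta> q l)\<rbrakk> \<Longrightarrow>
        cadj A (s p) \<otimes>\<^bsub>A\<^esub> u g \<otimes>\<^bsub>A\<^esub> s q = \<zero>\<^bsub>A\<^esub>"
    and cnp3: "\<And>p T. \<lbrakk>p \<in> carrier P; finite (lcosets\<^bsub>G\<^esub> (\<theta> p ` carrier G)); T \<subseteq> carrier G;
        bij_betw (\<lambda>g. g <#\<^bsub>G\<^esub> (\<theta> p ` carrier G)) T (lcosets\<^bsub>G\<^esub> (\<theta> p ` carrier G))\<rbrakk> \<Longrightarrow>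
        (\<Oplus>\<^bsub>A\<^esub>g\<in>T. u g \<otimes>\<^bsub>A\<^esub> s p \<otimes>\<^bsub>A\<^esub> cadj A (s p) \<otimes>\<^bsub>A\<^esub> cadj A (u g)) = \<one>\<^bsub>A\<^esub>"
begin

lemma adj_us_closed [simp]:
  "g \<in> carrier G \<Longrightarrow> cadj A (u g) \<in> carrier A" "p \<in> carrier P \<Longrightarrow> cadj A (s p) \<in> carrier A"
  by (simp_all add: A.adj_closed)

lemma us_cancel [simp]:
  "g \<in> carrier G \<Longrightarrow> x \<in> carrier A \<Longrightarrow> cadj A (u g) \<otimes>\<^bsub>A\<^esub> (u g \<otimes>\<^bsub>A\<^esub> x) = x"
  "g \<in> carrier G \<Longrightarrow> x \<in> carrier A \<Longrightarrow> u g \<otimes>\<^bsub>A\<^esub> (cadj A (u g) \<otimes>\<^bsub>A\<^esub> x) = x"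
  "p \<in> carrier P \<Longrightarrow> x \<in> carrier A \<Longrightarrow> cadj A (s p) \<otimes>\<^bsub>A\<^esub> (s p \<otimes>\<^bsub>A\<^esub> x) = x"
  by (simp_all add: u_isometry u_coisometry s_isometry flip: A.m_assoc)

lemma u_one: "u \<one>\<^bsub>G\<^esub> = \<one>\<^bsub>A\<^esub>"
  using us_cancel(1)[of "\<one>\<^bsub>G\<^esub>" "u \<one>\<^bsub>G\<^esub>"] u_isometry[of "\<one>\<^bsub>G\<^esub>"] u_mult[of "\<one>\<^bsub>G\<^esub>" "\<one>\<^bsub>G\<^esub>"] by simp

lemma u_inv: "g \<in> carrier G \<Longrightarrow> u (inv\<^bsub>G\<^esub> g) = cadj A (u g)"
  using us_cancel(1)[of g "u (inv\<^bsub>G\<^esub> g)"] u_mult[of g "inv\<^bsub>G\<^esub> g"] u_one by simp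

definition w :: "'g \<times> 'p \<Rightarrow> 'a" where
  "w t = u (fst t) \<otimes>\<^bsub>A\<^esub> s (snd t)"

text \<open>The projection is indexed by the ideal, so a generator is chosen;
  \<open>proj_pideal\<close> shows that the choice does not matter.\<close>

definition proj :: "('g \<times> 'p) set \<Rightarrow> 'a" where
  "proj X = (if X = {} then \<zero>\<^bsub>A\<^esub> else
     let t = (SOME t. t \<in> carrier S \<and> pideal S t = X) in w t \<otimes>\<^bsub>A\<^esub> cadj A (w t))"

lemma w_closed [simp]: "t \<in> carrier S \<Longrightarrow> w t \<in> carrier A" "t \<in> carrier S \<Longrightarrow> cadj A (w t) \<in> carrier A"
  by (auto simp: w_def A.adj_closed)

lemma w_mult: "t \<in> carrier S \<Longrightarrow> t' \<in> carrier S \<Longrightarrow> w t \<otimes>\<^bsub>A\<^esub> w t' = w (t \<otimes>\<^bsub>S\<^esub> t')"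
proof -
  assume "t \<in> carrier S" "t' \<in> carrier S"
  then obtain g p h q where t: "t = (g, p)" "t' = (h, q)" and c: "g \<in> carrier G" "p \<in> carrier P" "h \<in> carrier G" "q \<in> carrier P"
    by auto
  have "w t \<otimes>\<^bsub>A\<^esub> w t' = u g \<otimes>\<^bsub>A\<^esub> (s p \<otimes>\<^bsub>A\<^esub> u h) \<otimes>\<^bsub>A\<^esub> s q" using c by (simp add: w_def t A.m_assoc)
  also have "\<dots> = (u g \<otimes>\<^bsub>A\<^esub> u (\<theta> p h)) \<otimes>\<^bsub>A\<^esub> (s p \<otimes>\<^bsub>A\<^esub> s q)" using c by (simp add: cnp1 A.m_assoc)
  finally show ?thesis using c by (simp add: u_mult s_mult w_def t)
qed

lemma w_isometry: "t \<in> carrier S \<Longrightarrow> cadj A (w t) \<otimes>\<^bsub>A\<^esub> w t = \<one>\<^bsub>A\<^esub>"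
  by (auto simp: w_def A.adj_mult A.m_assoc s_isometry)

text \<open>Another generator of the ideal of (g, p) is (g theta_p(k), p). By CNP 1 its
  \<open>w\<close> is \<open>w t\<close> times the unitary u_k, which cancels in the range
  projection.\<close>

lemma proj_pideal:
  assumes t: "t \<in> carrier S" shows "proj (pideal S t) = w t \<otimes>\<^bsub>A\<^esub> cadj A (w t)"
proof -
  let ?t = "SOME t'. t' \<in> carrier S \<and> pideal S t' = pideal S t"
  have t': "?t \<in> carrier S \<and> pideal S ?t = pideal S t" by (rule someI[of _ t]) (simp add: t del: S_simps)
  obtain g p h q where gp: "t = (g, p)" "?t = (h, q)" by (meson surj_pair)
  have c: "g \<in> carrier G" "p \<in> carrier P" "h \<in> carrier G" "q \<in> carrier P" using t t' gp by auto
  have eq: "pideal S (g, p) = pideal S (h, q)" using conjunct2[OF t', unfolded gp(2)] gp(1) by simp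
  note * = pideal_eqD[OF eq c(1,3,2,4)]
  obtain k where k: "k \<in> carrier G" "h = g \<otimes>\<^bsub>G\<^esub> \<theta> p k" using *(2) by blast
  have "w ?t = w t \<otimes>\<^bsub>A\<^esub> u k"
    unfolding gp(2) unfolding gp(1) w_def using c k *(1) by (simp add: A.m_assoc cnp1 u_mult[symmetric])
  then have "w ?t \<otimes>\<^bsub>A\<^esub> cadj A (w ?t) = w t \<otimes>\<^bsub>A\<^esub> cadj A (w t)"
    using t k by (simp add: A.adj_mult A.m_assoc)
  moreover have "pideal S t \<noteq> {}" using pideal_self[OF t] by blast
  ultimately show ?thesis by (simp add: proj_def Let_def)
qed

lemma cidealE:
  assumes "X \<in> cideals S"
  obtains "X = {}" | t where "t \<in> carrier S" "X = pideal S t"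
  using assms by (auto simp: cideals_def simp del: S_simps)

text \<open>The middle factor w_t^* w_t' is s_p^* u_x s_q with x = g^-1 h, the left side of CNP 2.
  The two cases of CNP 2 match \<open>pideal_Int_disjoint\<close> and \<open>pideal_Int\<close>, so
  the product is 0 or the range projection of \<open>w\<close> at the LCM.\<close>

lemma w_range_mult:
  assumes t: "t \<in> carrier S" "t' \<in> carrier S"
  shows "w t \<otimes>\<^bsub>A\<^esub> cadj A (w t) \<otimes>\<^bsub>A\<^esub> (w t' \<otimes>\<^bsub>A\<^esub> cadj A (w t')) = proj (pideal S t \<inter> pideal S t')"
proof -
  interpret S: monoid S by (rule S_monoid)
  obtain g p h q where gp: "t = (g, p)" "t' = (h, q)" by (meson surj_pair)
  have c: "g \<in> carrier G" "h \<in> carrier G" "p \<in> carrier P" "q \<in> carrier P" using t gp by auto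
  let ?g = "inv\<^bsub>G\<^esub> g \<otimes>\<^bsub>G\<^esub> h"
  have mid: "cadj A (w t) \<otimes>\<^bsub>A\<^esub> w t' = cadj A (s p) \<otimes>\<^bsub>A\<^esub> u ?g \<otimes>\<^bsub>A\<^esub> s q"
    unfolding gp w_def using c by (simp add: A.adj_mult A.m_assoc u_inv flip: u_mult)
  have assoc: "w t \<otimes>\<^bsub>A\<^esub> cadj A (w t) \<otimes>\<^bsub>A\<^esub> (w t' \<otimes>\<^bsub>A\<^esub> cadj A (w t')) = w t \<otimes>\<^bsub>A\<^esub> (cadj A (w t) \<otimes>\<^bsub>A\<^esub> w t') \<otimes>\<^bsub>A\<^esub> cadj A (w t')"
    using t by (simp add: A.m_assoc del: S_simps)
  show ?thesis
  proof (cases "\<exists>k\<in>carrier G. \<exists>l\<in>carrier G. ?g = \<theta> p k \<otimes>\<^bsub>G\<^esub> \<theta> q l")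
    case False
    then have "pideal S t \<inter> pideal S t' = {}" unfolding gp using c by (intro pideal_Int_disjoint)
    moreover have "cadj A (w t) \<otimes>\<^bsub>A\<^esub> w t' = \<zero>\<^bsub>A\<^esub>" unfolding mid using c False by (intro cnp2_zero) simp_all
    ultimately show ?thesis unfolding assoc using t by (simp add: proj_def del: S_simps)
  next
    case True
    then obtain k l where kl: "k \<in> carrier G" "l \<in> carrier G" "?g = \<theta> p k \<otimes>\<^bsub>G\<^esub> \<theta> q l" by blast
    obtain d p' q' where d: "d \<in> carrier P" "p' \<in> carrier P" "q' \<in> carrier P"
      "d gcdof\<^bsub>P\<^esub> p q" "p = d \<otimes>\<^bsub>P\<^esub> p'" "q = d \<otimes>\<^bsub>P\<^esub> q'"
      using c(3,4) by (rule ex_gcd)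
    note meet = pideal_Int[OF c(1,2) kl(1,2) d(1-3) d(5,6,4) kl(3)]
    let ?a = "(k, q')" and ?b = "(inv\<^bsub>G\<^esub> l, p')"
    have ab: "?a \<in> carrier S" "?b \<in> carrier S" using kl d by simp_all
    have "cadj A (w t) \<otimes>\<^bsub>A\<^esub> w t' = u k \<otimes>\<^bsub>A\<^esub> s q' \<otimes>\<^bsub>A\<^esub> cadj A (s p') \<otimes>\<^bsub>A\<^esub> u l"
      unfolding mid by (rule cnp2[OF c(3,4) _ kl d(1,4,2,3,5,6)]) (use c in simp)
    also have "\<dots> = w ?a \<otimes>\<^bsub>A\<^esub> cadj A (w ?b)"
      using kl d by (simp add: w_def A.adj_mult u_inv A.adj_adj A.m_assoc)
    finally have "w t \<otimes>\<^bsub>A\<^esub> cadj A (w t) \<otimes>\<^bsub>A\<^esub> (w t' \<otimes>\<^bsub>A\<^esub> cadj A (w t'))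
        = w t \<otimes>\<^bsub>A\<^esub> w ?a \<otimes>\<^bsub>A\<^esub> cadj A (w t' \<otimes>\<^bsub>A\<^esub> w ?b)"
      unfolding assoc using t ab by (simp add: A.adj_mult A.m_assoc del: S_simps)
    also have "\<dots> = proj (pideal S (t \<otimes>\<^bsub>S\<^esub> ?a))"
      using t ab meet(1) by (simp add: w_mult proj_pideal gp del: S_simps)
    finally show ?thesis using meet(2) by (simp add: gp)
  qed
qed

sublocale system_rep G P \<theta> A w proj
proof (intro system_rep.intro irreversible_system_axioms lcm_rep.intro lcm_rep_axioms.intro S_monoid A.cstar_algebra_axioms)
  fix t t' X Y
  show "\<exists>a\<in>carrier S. \<exists>b\<in>carrier S. t \<otimes>\<^bsub>S\<^esub> a = t' \<otimes>\<^bsub>S\<^esub> b \<and> pideal S t \<inter> pideal S t' = pideal S (t \<otimes>\<^bsub>S\<^esub> a)"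
    if "t \<in> carrier S" "t' \<in> carrier S" "pideal S t \<inter> pideal S t' \<noteq> {}"
    using S_right_lcm[OF that] by metis
  show "w t \<in> carrier A" if "t \<in> carrier S" using that by (rule w_closed)
  show "cadj A (w t) \<otimes>\<^bsub>A\<^esub> w t = \<one>\<^bsub>A\<^esub>" if "t \<in> carrier S" using that by (rule w_isometry)
  show "w t \<otimes>\<^bsub>A\<^esub> w t' = w (t \<otimes>\<^bsub>S\<^esub> t')" if "t \<in> carrier S" "t' \<in> carrier S" using that by (rule w_mult)
  show "proj X \<in> carrier A" if "X \<in> cideals S"
    using that by (rule cidealE) (simp_all add: proj_pideal w_closed del: S_simps, simp add: proj_def)
  show "cadj A (proj X) = proj X" if "X \<in> cideals S"
    using that by (rule cidealE) (simp_all add: proj_pideal w_closed A.adj_mult A.adj_adj del: S_simps, simp add: proj_def)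
  show "w t \<otimes>\<^bsub>A\<^esub> proj X \<otimes>\<^bsub>A\<^esub> cadj A (w t) = proj (t <#\<^bsub>S\<^esub> X)" if t: "t \<in> carrier S" and "X \<in> cideals S"
    using that(2)
  proof (cases rule: cidealE)
    case 1
    then show ?thesis using t by (simp add: proj_def l_coset_def del: S_simps)
  next
    case (2 t')
    interpret S: monoid S by (rule S_monoid)
    show ?thesis unfolding 2(2) l_coset_pideal[OF t 2(1)] using t 2(1)
      by (simp add: proj_pideal A.adj_mult A.m_assoc del: S_simps flip: w_mult)
  qed
  show "proj (carrier S) = \<one>\<^bsub>A\<^esub>"
  proof -
    have one: "\<one>\<^bsub>S\<^esub> \<in> carrier S" by simp
    have "w \<one>\<^bsub>S\<^esub> = \<one>\<^bsub>A\<^esub>" by (simp add: w_def u_one s_one)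
    then show ?thesis using proj_pideal[OF one] by (simp add: pideal_one A.adj_one_A del: S_simps)
  qed
  show "proj {} = \<zero>\<^bsub>A\<^esub>" by (simp add: proj_def)
  show "proj X \<otimes>\<^bsub>A\<^esub> proj Y = proj (X \<inter> Y)" if XY: "X \<in> cideals S" "Y \<in> cideals S"
  proof -
    have c: "proj Z \<in> carrier A" if "Z \<in> cideals S" for Z
      using that by (rule cidealE) (simp_all add: proj_pideal w_closed del: S_simps, simp add: proj_def)
    show ?thesis
    proof (cases "X = {} \<or> Y = {}")
      case True
      then show ?thesis using c XY by (auto simp: proj_def[of "{}"])
    next
      case False
      then obtain t t' where "t \<in> carrier S" "X = pideal S t" "t' \<in> carrier S" "Y = pideal S t'"
        using XY unfolding cideals_def by blast
      then show ?thesis using w_range_mult by (simp add: proj_pideal del: S_simps)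
    qed
  qed
qed

lemma ex_transversal:
  "\<exists>T\<subseteq>carrier G. bij_betw (\<lambda>g. g <#\<^bsub>G\<^esub> H) T (lcosets\<^bsub>G\<^esub> H)"
proof -
  define r where "r X = (SOME g. g \<in> carrier G \<and> g <#\<^bsub>G\<^esub> H = X)" for X
  have r: "r X \<in> carrier G \<and> r X <#\<^bsub>G\<^esub> H = X" if "X \<in> lcosets\<^bsub>G\<^esub> H" for X
    unfolding r_def by (rule someI_ex) (use that in \<open>auto simp: LCOSETS_def\<close>)
  have "bij_betw (\<lambda>g. g <#\<^bsub>G\<^esub> H) (r ` (lcosets\<^bsub>G\<^esub> H)) (lcosets\<^bsub>G\<^esub> H)"
    by (rule bij_betw_byWitness[where f' = r]) (use r in auto)
  then show ?thesis using r by (intro exI[of _ "r ` (lcosets\<^bsub>G\<^esub> H)"]) auto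
qed

text \<open>Refine the foundation set to the level \<open>m\<close>: the projections of \<open>(g, m)\<close> for \<open>g\<close> in a transversal sum to \<open>1\<close>
  by \<open>cnp3\<close>, and each of them is annihilated by a factor \<open>1 - e\<close>.\<close>

lemma belements_zero:
  assumes "x \<in> belements"
  shows "x = \<zero>\<^bsub>A\<^esub>"
proof -
  obtain ss where x: "x = bprod ss" and F: "foundation_set S (set ss)"
    using assms unfolding belements_def by blast
  have sub: "set ss \<subseteq> carrier S" using F unfolding foundation_set_def by blast
  obtain m where m: "m \<in> carrier P" "finite_index m" "\<And>g. g \<in> carrier G \<Longrightarrow> \<exists>t\<in>set ss. (g, m) \<in> pideal S t"
    using foundation_set_refinement[OF F] by blast
  obtain T where T: "T \<subseteq> carrier G"
    "bij_betw (\<lambda>g. g <#\<^bsub>G\<^esub> (\<theta> m ` carrier G)) T (lcosets\<^bsub>G\<^esub> (\<theta> m ` carrier G))"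
    using ex_transversal by blast
  have fin: "finite (lcosets\<^bsub>G\<^esub> (\<theta> m ` carrier G))" by (rule finite_index_lcosets[OF m(2,1)])
  then have "finite T" using T(2) bij_betw_finite by blast
  have b: "bprod ss \<in> carrier A" using bprod_diagonal[OF sub] by simp
  let ?h = "\<lambda>g. u g \<otimes>\<^bsub>A\<^esub> s m \<otimes>\<^bsub>A\<^esub> cadj A (s m) \<otimes>\<^bsub>A\<^esub> cadj A (u g)"
  have h: "?h g = proj (pideal S (g, m))" "?h g \<in> carrier A" if "g \<in> carrier G" for g
    using that m(1) by (simp_all add: proj_pideal w_def A.adj_mult A.m_assoc)
  have zero: "bprod ss \<otimes>\<^bsub>A\<^esub> ?h g = \<zero>\<^bsub>A\<^esub>" if g: "g \<in> T" for g
  proof -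
    have gc: "g \<in> carrier G" using g T(1) by blast
    then obtain t where t: "t \<in> set ss" "(g, m) \<in> pideal S t" using m(3) by blast
    have tc: "t \<in> carrier S" using t sub by blast
    have gm: "(g, m) \<in> carrier S" using gc m(1) by simp
    have "pideal S (g, m) \<subseteq> pideal S t"
    proof -
      interpret S: monoid S by (rule S_monoid)
      obtain a where "a \<in> carrier S" "(g, m) = t \<otimes>\<^bsub>S\<^esub> a"
        using t(2) unfolding pideal_def l_coset_def by blast
      then show ?thesis using tc unfolding pideal_def l_coset_def by (auto simp: S.m_assoc simp del: S_simps)
    qed
    then have "proj (pideal S t) \<otimes>\<^bsub>A\<^esub> proj (pideal S (g, m)) = proj (pideal S (g, m))"
      using tc gm by (simp add: e_mult Int_absorb1 del: S_simps)
    then show ?thesis unfolding h(1)[OF gc]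
      using t(1) sub gm by (intro bprod_mult_zero) (auto intro: diagonal_e simp del: S_simps)
  qed
  have "x = bprod ss \<otimes>\<^bsub>A\<^esub> (\<Oplus>\<^bsub>A\<^esub>g\<in>T. ?h g)"
    unfolding cnp3[OF m(1) fin T] x using b by simp
  also have "\<dots> = (\<Oplus>\<^bsub>A\<^esub>g\<in>T. bprod ss \<otimes>\<^bsub>A\<^esub> ?h g)"
    by (rule A.finsum_rdistr) (use \<open>finite T\<close> b h(2) T(1) in auto)
  also have "\<dots> = (\<Oplus>\<^bsub>A\<^esub>g\<in>T. \<zero>\<^bsub>A\<^esub>)" by (rule A.finsum_cong') (use zero in auto)
  finally show ?thesis by simp
qed

end

section \<open>The isomorphism\<close>

text \<open>Uniqueness in the universal property of the free *-algebra. It identifies the composites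
  of \<open>E\<close> with \<open>\<Psi>\<close> and with \<open>free_hom\<close> by looking at
  generators only.\<close>

lemma (in cstar_algebra) eval_in_unique:
  fixes h :: "'x free_star \<Rightarrow> 'a"
  assumes h: "\<And>a. h a \<in> carrier A" and add: "\<And>a b. h (a + b) = h a \<oplus> h b" and mult: "\<And>a b. h (a * b) = h a \<otimes> h b"
    and scl: "\<And>c a. h (scl c a) = cscale A c (h a)" and adj: "\<And>a. h (adj a) = cadj A (h a)" and one: "h 1 = \<one>"
  shows "h a = eval_in A (\<lambda>x. h (gen x)) a"
proof -
  have word: "h (Poly_Mapping.single (Word ls) 1) = word_val A (\<lambda>x. h (gen x)) (Word ls)" for ls
  proof (induction ls)
    case Nil
    have "Poly_Mapping.single (Word []) 1 = (1 :: 'x free_star)" by (simp flip: zero_star_word_def)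
    then show ?case by (simp add: one word_val_def)
  next
    case (Cons l ls)
    have l: "h (Poly_Mapping.single (Word [l]) 1) = letter_val A (\<lambda>x. h (gen x)) l"
    proof (cases l)
      case (Starred x)
      then have "Poly_Mapping.single (Word [l]) 1 = adj (gen x)" by (simp add: gen_def adj_single word_adj_def)
      then show ?thesis by (simp add: adj Starred letter_val_def)
    qed (simp add: letter_val_def gen_def)
    have "Poly_Mapping.single (Word (l # ls)) 1 = (Poly_Mapping.single (Word [l]) 1 * Poly_Mapping.single (Word ls) 1 :: 'x free_star)"
      by (simp add: mult_single plus_star_word_def)
    then show ?case by (simp add: mult Cons l) (simp add: word_val_def)
  qed
  show ?thesis
  proof (induction a rule: free_star_induct)
    case (single w c)
    have "Poly_Mapping.single w c = scl c (Poly_Mapping.single (Word (letters w)) 1)" by (simp add: scl_def mult_single)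
    then have "h (Poly_Mapping.single w c) = cscale A c (word_val A (\<lambda>x. h (gen x)) w)" using word[of "letters w"] by (simp add: scl)
    then show ?case by (simp add: ev_single[where f = "\<lambda>x. h (gen x)", OF h])
  next
    case (sum f k v)
    then show ?case by (simp add: add ev_add[where f = "\<lambda>x. h (gen x)", OF h])
  qed
qed

section \<open>Computation with constant Cauchy classes\<close>

context bounded_relations begin

lemma const_simps:
  "const_cl a \<in> carrier UA"
  "const_cl a \<otimes>\<^bsub>UA\<^esub> const_cl b = const_cl (a * b)"
  "const_cl a \<oplus>\<^bsub>UA\<^esub> const_cl b = const_cl (a + b)"
  "const_cl a \<ominus>\<^bsub>UA\<^esub> const_cl b = const_cl (a - b)"
  "cscale UA c (const_cl a) = const_cl (scl c a)"
  "cadj UA (const_cl a) = const_cl (adj a)"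
  by (simp_all add: cl_in mult_cl add_cl diff_cl scale_cl adj_cl)

lemma const_eqI: "a - b \<in> R \<Longrightarrow> const_cl a = const_cl b"
  using N_rel[of "a - b"] by (simp add: cl_eq eqv_def)

lemma const_zero_iff: "const_cl a = \<zero>\<^bsub>UA\<^esub> \<longleftrightarrow> N a = 0"
proof -
  interpret UA: cstar_algebra UA by (rule cstar_algebra_completion)
  show ?thesis using UA.norm_eq_zero[OF const_simps(1)[of a]] by (simp add: norm_const)
qed

lemma const_sum: "finite T \<Longrightarrow> finsum UA (\<lambda>g. const_cl (f g)) T = const_cl (sum f T)"
proof (induction T rule: finite_induct)
  interpret UA: cstar_algebra UA by (rule cstar_algebra_completion)
  case empty
  then show ?case by (simp add: zero_cl)
next
  interpret UA: cstar_algebra UA by (rule cstar_algebra_completion)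
  case (insert g T)
  then show ?case by (simp add: const_simps)
qed

end

lemma cnp_rep_ads:
  assumes "irreversible_system G P \<theta>"
  shows "cnp_rep G P \<theta> \<O>[G, P, \<theta>] (ads_u G P \<theta>) (ads_s G P \<theta>)"
proof -
  interpret irreversible_system G P \<theta> by fact
  let ?R = "all_relations (cnp_letters G P) (cnp_relations G P \<theta>)"
  interpret R: bounded_relations ?R by (rule cnp_bounded)
  have O: "\<O>[G, P, \<theta>] = R.UA" by (simp add: ads_cstar_def univ_cstar_def)
  have us: "ads_u G P \<theta> g = R.const_cl (\<u> g)" "ads_s G P \<theta> p = R.const_cl (\<s> p)" for g p
    by (simp_all add: ads_u_def ads_s_def univ_gen_def)
  have rel: "R.const_cl a = R.const_cl b" if "a - b \<in> cnp_relations G P \<theta>" for a b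
    using that by (intro R.const_eqI) (simp add: all_relations_def)
  have rep: "R.const_cl a = R.const_cl b" if "a - b \<in> rep_relations G P" for a b
    using that by (intro rel) (simp add: cnp_relations_def)
  show ?thesis
    unfolding O
  proof (intro cnp_rep.intro cnp_rep_axioms.intro irreversible_system_axioms R.cstar_algebra_completion,
      unfold us R.const_simps R.one_cl R.zero_cl)
    fix g h assume gh: "g \<in> carrier G" "h \<in> carrier G"
    show "R.const_cl (\<u> g * \<u> h) = R.const_cl (\<u> (g \<otimes>\<^bsub>G\<^esub> h))"
      by (rule rep) (use gh in \<open>auto simp: rep_relations_def\<close>)
  next
    fix g assume g: "g \<in> carrier G"
    show "R.const_cl (adj (\<u> g) * \<u> g) = R.const_cl 1" "R.const_cl (\<u> g * adj (\<u> g)) = R.const_cl 1"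
      by (rule rep; use g in \<open>auto simp: rep_relations_def\<close>)+
  next
    fix p assume p: "p \<in> carrier P"
    show "R.const_cl (adj (\<s> p) * \<s> p) = R.const_cl 1"
      by (rule rep) (use p in \<open>auto simp: rep_relations_def\<close>)
  next
    fix p q assume pq: "p \<in> carrier P" "q \<in> carrier P"
    show "R.const_cl (\<s> p * \<s> q) = R.const_cl (\<s> (p \<otimes>\<^bsub>P\<^esub> q))"
      by (rule rep) (use pq in \<open>auto simp: rep_relations_def\<close>)
  next
    show "R.const_cl (\<s> \<one>\<^bsub>P\<^esub>) = R.const_cl 1" by (rule rep) (auto simp: rep_relations_def)
  next
    fix p g assume pg: "p \<in> carrier P" "g \<in> carrier G"
    show "R.const_cl (\<s> p * \<u> g) = R.const_cl (\<u> (\<theta> p g) * \<s> p)"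
      by (rule rel) (use pg in \<open>auto simp: cnp_relations_def CNP1_def\<close>)
  next
    fix p q g k l d p' q'
    assume a: "p \<in> carrier P" "q \<in> carrier P" "g \<in> carrier G" "k \<in> carrier G" "l \<in> carrier G"
      "g = \<theta> p k \<otimes>\<^bsub>G\<^esub> \<theta> q l" "d \<in> carrier P" "d gcdof\<^bsub>P\<^esub> p q" "p' \<in> carrier P" "q' \<in> carrier P"
      "p = d \<otimes>\<^bsub>P\<^esub> p'" "q = d \<otimes>\<^bsub>P\<^esub> q'"
    have "adj (\<s> p) * \<u> g * \<s> q - \<u> k * \<s> q' * adj (\<s> p') * \<u> l \<in> CNP2 G P \<theta>"
      unfolding CNP2_def using a by blast
    then show "R.const_cl (adj (\<s> p) * \<u> g * \<s> q) = R.const_cl (\<u> k * \<s> q' * adj (\<s> p') * \<u> l)"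
      by (intro rel) (simp add: cnp_relations_def)
  next
    fix p q g
    assume a: "p \<in> carrier P" "q \<in> carrier P" "g \<in> carrier G"
      "\<not> (\<exists>k\<in>carrier G. \<exists>l\<in>carrier G. g = \<theta> p k \<otimes>\<^bsub>G\<^esub> \<theta> q l)"
    have "adj (\<s> p) * \<u> g * \<s> q \<in> CNP2 G P \<theta>" unfolding CNP2_def using a by blast
    then show "R.const_cl (adj (\<s> p) * \<u> g * \<s> q) = R.const_cl 0"
      by (intro rel) (simp add: cnp_relations_def)
  next
    fix p T
    assume a: "p \<in> carrier P" "finite (lcosets\<^bsub>G\<^esub> (\<theta> p ` carrier G))" "T \<subseteq> carrier G"
      "bij_betw (\<lambda>g. g <#\<^bsub>G\<^esub> (\<theta> p ` carrier G)) T (lcosets\<^bsub>G\<^esub> (\<theta> p ` carrier G))"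
    have "finite T" using a(2,4) bij_betw_finite by blast
    have "1 - (\<Sum>g\<in>T. \<u> g * \<s> p * adj (\<s> p) * adj (\<u> g)) \<in> CNP3 G P \<theta>" unfolding CNP3_def using a by blast
    then have "R.const_cl 1 = R.const_cl (\<Sum>g\<in>T. \<u> g * \<s> p * adj (\<s> p) * adj (\<u> g))"
      by (intro rel) (simp add: cnp_relations_def)
    then show "(\<Oplus>\<^bsub>R.UA\<^esub>g\<in>T. R.const_cl (\<u> g * \<s> p * adj (\<s> p) * adj (\<u> g))) = R.const_cl 1"
      using R.const_sum[OF \<open>finite T\<close>] by simp
  qed (simp_all add: R.const_simps)
qed

lemma lcm_rep_sg:
  assumes "irreversible_system G P \<theta>"
  shows "generating_lcm_rep C\<^sup>*(semidirect G P \<theta>) (semidirect G P \<theta>)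
    (sg_v (semidirect G P \<theta>)) (sg_e (semidirect G P \<theta>))"
proof -
  interpret irreversible_system G P \<theta> by fact
  let ?R = "all_relations (sg_letters S) (sg_relations S)"
  interpret R: bounded_relations ?R by (rule sg_bounded)
  interpret UA: cstar_algebra R.UA by (rule R.cstar_algebra_completion)
  have C: "C\<^sup>*(S) = R.UA" by (simp add: sg_cstar_def univ_cstar_def)
  have ve: "sg_v S t = R.const_cl (\<v> t)" "sg_e S X = R.const_cl (\<e> X)" for t X
    by (simp_all add: sg_v_def sg_e_def univ_gen_def)
  have rel: "R.const_cl a = R.const_cl b" if "a - b \<in> sg_relations S" for a b
    using that by (intro R.const_eqI) (simp add: all_relations_def)
  have e_adj: "R.const_cl (adj (\<e> X)) = R.const_cl (\<e> X)" if "X \<in> cideals S" for X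
    by (rule rel) (use that in \<open>unfold sg_relations_def, blast\<close>)
  have "lcm_rep R.UA S (sg_v S) (sg_e S)"
  proof (intro lcm_rep.intro lcm_rep_axioms.intro R.cstar_algebra_completion,
      unfold ve R.const_simps R.one_cl R.zero_cl)
    show "monoid S" by (rule S_monoid)
    show "\<exists>a\<in>carrier S. \<exists>b\<in>carrier S. s \<otimes>\<^bsub>S\<^esub> a = t \<otimes>\<^bsub>S\<^esub> b \<and> pideal S s \<inter> pideal S t = pideal S (s \<otimes>\<^bsub>S\<^esub> a)"
      if "s \<in> carrier S" "t \<in> carrier S" "pideal S s \<inter> pideal S t \<noteq> {}" for s t
      by (rule S_right_lcm[OF that]) blast
    show "R.const_cl (adj (\<v> s) * \<v> s) = R.const_cl 1" if "s \<in> carrier S" for s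
      by (rule rel) (use that in \<open>unfold sg_relations_def, blast\<close>)
    show "R.const_cl (\<v> s * \<v> t) = R.const_cl (\<v> (s \<otimes>\<^bsub>S\<^esub> t))" if "s \<in> carrier S" "t \<in> carrier S" for s t
      by (rule rel) (use that in \<open>unfold sg_relations_def, blast\<close>)
    show "R.const_cl (\<v> s * \<e> X * adj (\<v> s)) = R.const_cl (\<e> (s <#\<^bsub>S\<^esub> X))" if "s \<in> carrier S" "X \<in> cideals S" for s X
      by (rule rel) (use that in \<open>unfold sg_relations_def, blast\<close>)
    show "R.const_cl (\<e> (carrier S)) = R.const_cl 1" by (rule rel) (unfold sg_relations_def, simp)
    show "R.const_cl (\<e> {}) = R.const_cl 0" by (rule rel) (unfold sg_relations_def, simp)
    show "R.const_cl (\<e> X * \<e> Y) = R.const_cl (\<e> (X \<inter> Y))" if "X \<in> cideals S" "Y \<in> cideals S" for X Y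
      by (rule rel) (use that in \<open>unfold sg_relations_def, blast\<close>)
  qed (simp_all add: e_adj R.const_simps)
  moreover have "M = carrier R.UA"
    if M: "M \<subseteq> carrier R.UA" "norm_closed R.UA M" "\<one>\<^bsub>R.UA\<^esub> \<in> M"
      "\<And>x y. x \<in> M \<Longrightarrow> y \<in> M \<Longrightarrow> x \<oplus>\<^bsub>R.UA\<^esub> y \<in> M" "\<And>x y. x \<in> M \<Longrightarrow> y \<in> M \<Longrightarrow> x \<otimes>\<^bsub>R.UA\<^esub> y \<in> M"
      "\<And>x c. x \<in> M \<Longrightarrow> cscale R.UA c x \<in> M"
      "\<And>s. s \<in> carrier S \<Longrightarrow> sg_v S s \<in> M" "\<And>s. s \<in> carrier S \<Longrightarrow> cadj R.UA (sg_v S s) \<in> M"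
      "\<And>X. X \<in> cideals S \<Longrightarrow> sg_e S X \<in> M" for M
  proof -
    have zero: "\<zero>\<^bsub>R.UA\<^esub> \<in> M" using M(6)[OF M(3), of 0] UA.scale_zero[OF UA.one_closed] by simp
    have "R.const_cl (gen x) \<in> M \<and> cadj R.UA (R.const_cl (gen x)) \<in> M" for x
    proof (cases "x \<in> sg_letters S")
      case True
      then consider s where "s \<in> carrier S" "x = LetterV s" | X where "X \<in> cideals S" "x = LetterE X"
        unfolding sg_letters_def by blast
      then show ?thesis
      proof cases
        case 1
        then show ?thesis using M(7,8)[of s] by (simp add: ve)
      next
        case 2
        then show ?thesis using M(9)[of X] by (simp add: ve R.const_simps e_adj)
      qed
    next
      case False
      then have "R.const_cl (gen x) = \<zero>\<^bsub>R.UA\<^esub>" by (intro R.gen_rel_zero) (simp add: all_relations_def)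
      then show ?thesis using zero by simp
    qed
    then show ?thesis using M by (intro R.completion_induct) auto
  qed
  ultimately show ?thesis unfolding C
    by (intro generating_lcm_rep.intro generating_lcm_rep_axioms.intro) blast+
qed

theorem corollary4p2:
  fixes G :: "'g monoid" and P :: "'p monoid" and \<theta> :: "'p \<Rightarrow> 'g \<Rightarrow> 'g"
  assumes "irreversible_system G P \<theta>"
  shows "\<exists>\<phi>. star_iso \<O>[G, P, \<theta>] \<Q>(semidirect G P \<theta>) \<phi> \<and>
    (\<forall>g\<in>carrier G. \<forall>p\<in>carrier P.
       \<phi> (ads_u G P \<theta> g \<otimes>\<^bsub>\<O>[G, P, \<theta>]\<^esub> ads_s G P \<theta> p) = boundary_v (semidirect G P \<theta>) (g, p))"
proof -
  let ?S = "semidirect G P \<theta>"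
  define R1 where "R1 = all_relations (cnp_letters G P) (cnp_relations G P \<theta>)"
  define R2 where "R2 = all_relations (sg_letters ?S) (sg_relations ?S)"
  interpret R1: bounded_relations R1 unfolding R1_def by (rule cnp_bounded)
  interpret R2: bounded_relations R2 unfolding R2_def by (rule sg_bounded)
  have O: "\<O>[G, P, \<theta>] = R1.UA" by (simp add: ads_cstar_def univ_cstar_def R1_def)
  have C: "C\<^sup>*(?S) = R2.UA" by (simp add: sg_cstar_def univ_cstar_def R2_def)
  have us: "ads_u G P \<theta> g = R1.const_cl (\<u> g)" "ads_s G P \<theta> p = R1.const_cl (\<s> p)" for g p
    by (simp_all add: ads_u_def ads_s_def univ_gen_def R1_def)
  have ve: "sg_v ?S t = R2.const_cl (\<v> t)" "sg_e ?S X = R2.const_cl (\<e> X)" for t X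
    by (simp_all add: sg_v_def sg_e_def univ_gen_def R2_def)
  interpret N: cnp_rep G P \<theta> R1.UA "ads_u G P \<theta>" "ads_s G P \<theta>"
    using cnp_rep_ads[OF assms] unfolding O .
  interpret L: generating_lcm_rep R2.UA "?S" "sg_v ?S" "sg_e ?S"
    using lcm_rep_sg[OF assms] unfolding C .
  interpret L: system_rep G P \<theta> R2.UA "sg_v ?S" "sg_e ?S"
    by (intro system_rep.intro assms L.lcm_rep_axioms)
  note [simp del] = N.S_simps
  define wf where "wf t = (\<u> (fst t) * \<s> (snd t) :: ('g, 'p) cnp_letter free_star)" for t
  \<comment> \<open>The generators of C*(S) are expressed in the letters of O before completion. The
    choice of a generator repeats the one in \<open>N.proj\<close>, so that the class of
    \<open>f (LetterE X)\<close> is literally that projection.\<close>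
  define f where "f x = (case x of
      LetterV t \<Rightarrow> if t \<in> carrier ?S then wf t else 0
    | LetterE X \<Rightarrow> if X \<in> cideals ?S \<and> X \<noteq> {} then
        let t = (SOME t. t \<in> carrier ?S \<and> pideal ?S t = X) in wf t * adj (wf t) else 0)" for x
  have wf: "R1.const_cl (wf t) = N.w t" for t
    by (simp add: wf_def N.w_def us R1.const_simps)
  have f_V: "R1.const_cl (f (LetterV t)) = N.w t" if "t \<in> carrier ?S" for t
    using that by (simp add: f_def wf)
  have f_E: "R1.const_cl (f (LetterE X)) = N.proj X" if "X \<in> cideals ?S" for X
    using that by (simp add: f_def N.proj_def R1.zero_cl Let_def wf flip: R1.const_simps)
  let ?h = "\<lambda>b. R1.const_cl (free_hom f b)"
  have h: "?h (a * b) = ?h a \<otimes>\<^bsub>R1.UA\<^esub> ?h b" "?h (a - b) = ?h a \<ominus>\<^bsub>R1.UA\<^esub> ?h b" "?h (adj a) = cadj R1.UA (?h a)"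
    "?h 1 = \<one>\<^bsub>R1.UA\<^esub>" "?h 0 = \<zero>\<^bsub>R1.UA\<^esub>" "t \<in> carrier ?S \<Longrightarrow> ?h (\<v> t) = N.w t" "X \<in> cideals ?S \<Longrightarrow> ?h (\<e> X) = N.proj X"
    for a b t X
    by (simp_all add: free_hom_mult free_hom_diff free_hom_adj R1.const_simps R1.one_cl R1.zero_cl free_hom_def[of f 0] f_V f_E)
  have "R1.N (free_hom f r) = 0" if r: "r \<in> R2" for r
  proof -
    have eq: "?h (a - b) = \<zero>\<^bsub>R1.UA\<^esub>" if "?h a = ?h b" for a b
      using that R1.const_simps(1) by (simp add: h N.diff_eq_zero_iff)
    have "?h r = \<zero>\<^bsub>R1.UA\<^esub>"
    proof (cases "r \<in> sg_relations ?S")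
      case True
      \<comment> \<open>Writing \<open>\<e> {}\<close> as a difference with 0 gives every relation
        the form a - b to which \<open>eq\<close> applies.\<close>
      then consider
        s where "r = adj (\<v> s) * \<v> s - 1" "s \<in> carrier ?S"
      | X where "r = \<e> X * \<e> X - \<e> X" "X \<in> cideals ?S"
      | X where "r = adj (\<e> X) - \<e> X" "X \<in> cideals ?S"
      | s t where "r = \<v> s * \<v> t - \<v> (s \<otimes>\<^bsub>?S\<^esub> t)" "s \<in> carrier ?S" "t \<in> carrier ?S"
      | s X where "r = \<v> s * \<e> X * adj (\<v> s) - \<e> (s <#\<^bsub>?S\<^esub> X)" "s \<in> carrier ?S" "X \<in> cideals ?S"
      | "r = \<e> (carrier ?S) - 1"
      | "r = \<e> {} - 0"
      | X Y where "r = \<e> X * \<e> Y - \<e> (X \<inter> Y)" "X \<in> cideals ?S" "Y \<in> cideals ?S"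
        unfolding sg_relations_def by auto
      then show ?thesis
        by cases (simp_all only:, (rule eq, simp add: h N.v_isometry N.e_idem N.e_adj N.v_mult N.v_e N.e_carrier N.e_empty N.e_mult
              N.S.m_closed N.carrier_cideal N.cideal_coset N.cideal_Int cideals_def[of ?S, THEN equalityD2, THEN subsetD] del: free_hom_gen free_hom_one)+)
    next
      case False
      then obtain x where "r = gen x" "x \<notin> sg_letters ?S" using r by (auto simp: R2_def all_relations_def)
      then show ?thesis by (cases x) (auto simp: sg_letters_def f_def R1.zero_cl)
    qed
    then show ?thesis by (simp add: R1.const_zero_iff)
  qed
  from completion_hom[OF R2.bounded_relations_axioms R1.bounded_relations_axioms this]
  obtain \<Psi> where \<Psi>: "star_hom R2.UA R1.UA \<Psi>"
    "\<And>X. X \<in> carrier R2.UA \<Longrightarrow> cnorm R1.UA (\<Psi> X) \<le> cnorm R2.UA X"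
    "\<And>b. \<Psi> (R2.const_cl b) = ?h b" by blast
  interpret H: cstar_hom R2.UA R1.UA \<Psi>
    by (intro cstar_hom.intro cstar_hom_axioms.intro R1.cstar_algebra_completion R2.cstar_algebra_completion \<Psi>(1,2))
  have \<Psi>_v: "\<Psi> (sg_v ?S t) = N.w t" if "t \<in> carrier ?S" for t using that by (simp add: ve \<Psi>(3) f_V)
  have \<Psi>_e: "\<Psi> (sg_e ?S X) = N.proj X" if "X \<in> cideals ?S" for X using that by (simp add: ve \<Psi>(3) f_E)
  have \<Psi>_bprod: "\<Psi> (L.bprod ss) = N.bprod ss" if "set ss \<subseteq> carrier ?S" for ss
    using that
  proof (induction ss)
    case (Cons t ss)
    then have "t \<in> carrier (?S)" "set ss \<subseteq> carrier (?S)" by simp_all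
    then have "pideal ?S t \<in> cideals ?S" "sg_e ?S (pideal ?S t) \<in> carrier R2.UA" "L.bprod ss \<in> carrier R2.UA"
      using L.bprod_diagonal[of ss] by simp_all
    then show ?case using Cons by (simp add: H.hom_diff \<Psi>_e)
  qed simp
  have boundary: "boundary_ideal ?S = L.J"
  proof -
    have "boundary_elements ?S = L.belements"
      unfolding boundary_elements_def L.belements_def L.bprod_def C ..
    then show ?thesis by (simp add: boundary_ideal_def C)
  qed
  have "L.belements \<subseteq> H.K"
  proof
    fix x assume "x \<in> L.belements"
    then obtain ss where ss: "x = L.bprod ss" "distinct ss" "foundation_set (?S) (set ss)"
      unfolding L.belements_def by blast
    then have sub: "set ss \<subseteq> carrier (?S)" unfolding foundation_set_def by blast
    have "N.bprod ss \<in> N.belements" unfolding N.belements_def using ss by blast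
    then have "\<Psi> x = \<zero>\<^bsub>R1.UA\<^esub>" using \<Psi>_bprod[of ss] sub ss(1) by (simp add: N.belements_zero)
    then show "x \<in> H.K" using L.bprod_diagonal[OF sub] ss(1) by (simp add: H.mem_kernel)
  qed
  then have JK: "L.J \<subseteq> H.K"
    unfolding closed_ideal_gen_def using H.kernel_is_ideal H.kernel_closed by blast
  \<comment> \<open>Both sides are unital *-homomorphisms on the free *-algebra that agree on
    letters. This makes the norm of O at a the norm of \<open>\<Psi>\<close> at
    \<open>L.E a\<close>.\<close>
  have \<Psi>_E: "\<Psi> (L.E a) = R1.const_cl a" for a
  proof -
    have gen: "\<Psi> (L.E (gen x)) = R1.const_cl (gen x)" for x
    proof (cases "x \<in> cnp_letters G P")
      case True
      then consider g where "x = LetterU g" "g \<in> carrier G" | p where "x = LetterS p" "p \<in> carrier P"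
        unfolding cnp_letters_def by blast
      then show ?thesis
      proof cases
        case 1
        then show ?thesis using \<Psi>_v[of "(g, \<one>\<^bsub>P\<^esub>)"] N.s_one
          by (simp add: L.E_gen N.w_def N.S_simps) (simp add: us R1.const_simps)
      next
        case 2
        then show ?thesis using \<Psi>_v[of "(\<one>\<^bsub>G\<^esub>, p)"] N.u_one
          by (simp add: L.E_gen N.w_def N.S_simps) (simp add: us R1.const_simps)
      qed
    next
      case False
      then have "R1.const_cl (gen x) = \<zero>\<^bsub>R1.UA\<^esub>" by (intro R1.gen_rel_zero) (simp add: R1_def all_relations_def)
      then show ?thesis using False by (simp add: L.E_outside)
    qed
    have "\<Psi> (L.E a) = eval_in R1.UA (\<lambda>x. \<Psi> (L.E (gen x))) a"
      by (rule cstar_algebra.eval_in_unique[OF R1.cstar_algebra_completion]) (simp_all add: L.E_simps L.E_scl H.hom_scale H.hom_adj)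
    also have "\<dots> = R1.const_cl a"
      unfolding gen by (rule cstar_algebra.eval_in_unique[OF R1.cstar_algebra_completion, symmetric]) (simp_all add: R1.const_simps R1.one_cl)
    finally show ?thesis .
  qed
  have E_wf: "L.E (wf t) = sg_v ?S t" if "t \<in> carrier ?S" for t
    using that L.v_split[of "fst t" "snd t"] by (auto simp: wf_def L.E_simps L.E_gen N.S_simps)
  \<comment> \<open>The letters of O contain no e_X, but e_X = v_t v_t^* for a generator t of X. So
    every constant class of C*(S) is a value of \<open>L.E\<close>, whose range is therefore
    dense.\<close>
  have E_onto: "L.E (free_hom f b) = R2.const_cl b" for b
  proof -
    have gen: "L.E (free_hom f (gen x)) = R2.const_cl (gen x)" for x
    proof (cases "x \<in> sg_letters ?S")
      case True
      then consider t where "x = LetterV t" "t \<in> carrier ?S" | "x = LetterE {}"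
        | X where "x = LetterE X" "X \<in> cideals ?S" "X \<noteq> {}"
        unfolding sg_letters_def by blast
      then show ?thesis
      proof cases
        case 1
        then show ?thesis by (simp add: f_def E_wf ve)
      next
        case 2
        then show ?thesis using L.e_empty by (simp add: f_def L.E_simps ve)
      next
        case 3
        let ?t = "SOME t. t \<in> carrier ?S \<and> pideal ?S t = X"
        have "?t \<in> carrier ?S \<and> pideal ?S ?t = X"
          by (rule someI_ex) (use 3 in \<open>auto simp: cideals_def\<close>)
        then show ?thesis using 3 L.e_pideal[of ?t] by (simp add: f_def Let_def L.E_simps E_wf) (simp add: ve)
      qed
    next
      case False
      then have "R2.const_cl (gen x) = \<zero>\<^bsub>R2.UA\<^esub>" by (intro R2.gen_rel_zero) (simp add: R2_def all_relations_def)
      moreover have "f x = 0" using False by (cases x) (auto simp: f_def sg_letters_def)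
      ultimately show ?thesis by (simp add: L.E_simps)
    qed
    have "L.E (free_hom f b) = eval_in R2.UA (\<lambda>x. L.E (free_hom f (gen x))) b"
      by (rule cstar_algebra.eval_in_unique[OF R2.cstar_algebra_completion]) (simp_all add: L.E_simps L.E_scl free_hom_add free_hom_mult free_hom_scl free_hom_adj del: free_hom_gen)
    also have "\<dots> = R2.const_cl b"
      unfolding gen by (rule cstar_algebra.eval_in_unique[OF R2.cstar_algebra_completion, symmetric]) (simp_all add: R2.const_simps R2.one_cl)
    finally show ?thesis .
  qed
  \<comment> \<open>By \<open>L.E_relations\<close> the distance to the ideal vanishes on all
    relations of O, CNP 3 included; the C*-identity comes from
    \<open>quot_norm_cstar\<close>.\<close>
  have "(\<lambda>a. quot_norm R2.UA L.J (L.E a)) \<in> seminorms R1"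
    using L.J.quot_norm_seminorm[where f = L.letter_map, OF L.letter_map_closed] L.E_relations
    by (simp add: seminorms_def R1_def L.J.quot_norm_ideal)
  then have bound: "quot_norm R2.UA L.J (L.E a) \<le> R1.N a" for a by (rule R1.le_N)
  have dense: "\<exists>y\<in>range L.E. cnorm R2.UA (x \<ominus>\<^bsub>R2.UA\<^esub> y) < \<epsilon>" if "x \<in> carrier R2.UA" "\<epsilon> > 0" for x \<epsilon>
    using that R2.approx E_onto unfolding R2.carrier_A by (metis rangeI)
  have dense_image: "\<exists>y\<in>range L.E. cnorm R1.UA (z \<ominus>\<^bsub>R1.UA\<^esub> \<Psi> y) < \<epsilon>" if "z \<in> carrier R1.UA" "\<epsilon> > 0" for z \<epsilon>
    using that R1.approx \<Psi>_E unfolding R1.carrier_A by (metis rangeI)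
  have "quot_norm R2.UA L.J y \<le> cnorm R1.UA (\<Psi> y)" if "y \<in> range L.E" for y
    using that bound by (auto simp: \<Psi>_E R1.norm_const)
  moreover have "range L.E \<subseteq> carrier R2.UA" by auto
  ultimately have kr: "H.K = L.J" "\<Psi> ` carrier R2.UA = carrier R1.UA"
    using H.kernel_and_range[OF L.J.cstar_ideal_axioms JK _ dense dense_image] by blast+
  obtain \<phi> where \<phi>: "star_iso R1.UA (cstar_quot R2.UA L.J) \<phi>"
    "\<And>x. x \<in> carrier R2.UA \<Longrightarrow> \<phi> (\<Psi> x) = L.J +>\<^bsub>R2.UA\<^esub> x"
    using H.quotient_iso[OF kr(2)] unfolding kr(1) by blast
  have "\<phi> (ads_u G P \<theta> g \<otimes>\<^bsub>R1.UA\<^esub> ads_s G P \<theta> p) = boundary_v ?S (g, p)"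
    if gp: "g \<in> carrier G" "p \<in> carrier P" for g p
  proof -
    have c: "(g, p) \<in> carrier ?S" using gp by (simp add: semidirect_def)
    have "ads_u G P \<theta> g \<otimes>\<^bsub>R1.UA\<^esub> ads_s G P \<theta> p = \<Psi> (sg_v ?S (g, p))" using \<Psi>_v[OF c] by (simp add: N.w_def)
    then show ?thesis using \<phi>(2)[of "sg_v ?S (g, p)"] by (simp add: boundary_v_def boundary C ve R2.const_simps)
  qed
  then show ?thesis using \<phi>(1) unfolding boundary_quotient_def boundary C O by blast
qed

end
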